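(* Let $\theta$ be a complex number such that $\theta\notin\mathbb{Q}(i)$ and let $\varepsilon>0$ be an arbitrary constant. Then there exist infinitely many Gaussian primes $p$ such that $$\|p\theta\|\le \mathcal{N}(p)^{-1/24+\varepsilon}.$$
   Context: $\mathbb{Z}[i]$ is the ring of Gaussian integers, and $\mathcal{N}(n)=|n|^2$ denotes the norm of $n\in\mathbb{Z}[i]$. A Gaussian prime is a prime element of $\mathbb{Z}[i]$. For a real number $x$, $\|x\|$ denotes the distance from $x$ to the nearest integer. For a complex number $z$, $\|z\|:=\max\{\|\Re(z)\|,\|\Im(z)\|\}$, where $\Re(z)$ and $\Im(z)$ are the real and imaginary parts of $z$ (so $\|z\|$ is the supremum-norm distance from $z$ to the nearest Gaussian integer). *)

theory Defs
  imports "HOL-Analysis.Analysis"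
begin

typedef gauss_int = "{z :: complex. Re z \<in> \<int> \<and> Im z \<in> \<int>}"
  morphisms complex_of_gauss_int Abs_gauss_int
  by (rule exI[of _ 0]) simp

setup_lifting type_definition_gauss_int

instantiation gauss_int :: idom
begin

lift_definition zero_gauss_int :: gauss_int is 0 by simp
lift_definition one_gauss_int :: gauss_int is 1 by simp
lift_definition plus_gauss_int :: "gauss_int \<Rightarrow> gauss_int \<Rightarrow> gauss_int" is "(+)" by simp
lift_definition minus_gauss_int :: "gauss_int \<Rightarrow> gauss_int \<Rightarrow> gauss_int" is "(-)" by simp
lift_definition uminus_gauss_int :: "gauss_int \<Rightarrow> gauss_int" is uminus by simp
lift_definition times_gauss_int :: "gauss_int \<Rightarrow> gauss_int \<Rightarrow> gauss_int" is "(*)" by simp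

instance
  by standard (transfer; simp add: algebra_simps)+

end

definition gauss_norm :: "gauss_int \<Rightarrow> real" where
  "gauss_norm n = (cmod (complex_of_gauss_int n))\<^sup>2"

definition gauss_rats :: "complex set" where
  "gauss_rats = {of_rat a + of_rat b * \<i> | a b. True}"

definition dist_nearest_int :: "real \<Rightarrow> real" where
  "dist_nearest_int x = \<bar>x - of_int (round x)\<bar>"

definition dist_nearest_gauss_int :: "complex \<Rightarrow> real" where
  "dist_nearest_gauss_int z = max (dist_nearest_int (Re z)) (dist_nearest_int (Im z))"

end

theory Submission
  imports Defs "HOL-Computational_Algebra.Computational_Algebra" "HOL-Real_Asymp.Real_Asymp"
begin

text \<open>
  The primes are weighted by the von Mangoldt function \<open>\<Lambda>\<close> of the ring and by a trigonometric
  polynomial in \<open>p\<theta>\<close> that is concentrated near the Gaussian integers. Expanding this polynomial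
  leaves a main term, the Chebyshev function at \<open>y\<close>, and the sums of \<open>\<Lambda> n e(Re (n h \<theta>))\<close> over
  \<open>N n \<le> y\<close> with \<open>h \<noteq> 0\<close> and \<open>N h\<close> slightly below \<open>y\<^bsup>1/12\<^esup>\<close>. Vaughan's identity, cut at \<open>y\<^bsup>1/6\<^esup>\<close> and
  \<open>y\<^bsup>1/2\<^esup>\<close>, splits these into type I and type II sums, whose inner sums run over all Gaussian integers
  of a disc and are estimated row by row by geometric series. What remains is the number of multiples
  \<open>k\<theta>\<close> close to Gaussian integers; it is controlled by moduli \<open>Q\<close> for which the points
  \<open>k\<theta>\<close> with \<open>N k < Q\<close> stay at distance of order \<open>Q\<^bsup>-1/2\<^esup>\<close> from the Gaussian integers. Such \<open>Q\<close> are
  arbitrarily large, and every \<open>y\<close> between \<open>Q\<^bsup>12/5\<^esup>\<close> and \<open>Q\<^sup>4\<close> is admissible; this range is long enough for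
  an elementary argument in the style of Mertens to supply a \<open>y\<close> whose Chebyshev function is at least
  \<open>y / 100\<close>.
\<close>

subsection \<open>The ring of Gaussian integers\<close>

text \<open>Where the exponents come from. Let the frequencies \<open>h\<close> run up to norm H =
  y^t. The main term has size y / H, so every error must stay below y^(1-t). In the type II bound
  the term y / U forces U >= y^(2t), and H y / sqrt V forces V >= y^(6t); the type I term H sqrt (y
  U V) forces U V <= y^(1-4t). Hence 8t <= 1 - 4t, and t = 1/12 is the limit, where all three become
  equalities. The terms containing Q then ask for y^(3t) <= Q <= y^(1/2-t), that is y^(1/4) <= Q <=
  y^(5/12). A polynomial of degree about J in each of the two coordinates resolves distances of size
  1 / J and has frequencies of norm about J^2 = H, so the distance reached is H^(-1/2) = y^(-1/24).
  The obstacle is that nothing is known about the gaps between good moduli: y has to be adapted to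
  Q, and a lower bound for primes is wanted somewhere in a range dictated by Q, not at every large
  y. This is why an argument by contradiction with Mertens sums can stand in for the prime number
  theorem of Z[i].\<close>

abbreviation gdist :: "complex \<Rightarrow> real" where "gdist \<equiv> dist_nearest_gauss_int"

abbreviation gnorm :: "gauss_int \<Rightarrow> real" where "gnorm \<equiv> gauss_norm"

abbreviation cx :: "gauss_int \<Rightarrow> complex" where "cx \<equiv> complex_of_gauss_int"

lemma cx_simps [simp]:
  "cx 0 = 0" "cx 1 = 1" "cx (m + n) = cx m + cx n" "cx (m - n) = cx m - cx n"
  "cx (- n) = - cx n" "cx (m * n) = cx m * cx n"
  by (transfer; simp)+

lemma cx_inject [simp]: "cx m = cx n \<longleftrightarrow> m = n"
  by (rule complex_of_gauss_int_inject)

lemma cx_eq_0_iff [simp]: "cx n = 0 \<longleftrightarrow> n = 0"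
  using cx_inject[of n 0] by simp

lemma cx_Ints: "Re (cx n) \<in> \<int>" "Im (cx n) \<in> \<int>"
  by (transfer; simp)+

lift_definition gauss_of :: "int \<Rightarrow> int \<Rightarrow> gauss_int"
  is "\<lambda>a b. Complex (of_int a) (of_int b)" by simp

definition gre :: "gauss_int \<Rightarrow> int" where "gre n = \<lfloor>Re (cx n)\<rfloor>"
definition gim :: "gauss_int \<Rightarrow> int" where "gim n = \<lfloor>Im (cx n)\<rfloor>"

lemma cx_gauss_of: "cx (gauss_of a b) = Complex (of_int a) (of_int b)"
  by transfer simp

lemma of_int_gre [simp]: "of_int (gre n) = Re (cx n)"
  and of_int_gim [simp]: "of_int (gim n) = Im (cx n)"
  unfolding gre_def gim_def using cx_Ints[of n] by (auto elim!: Ints_cases)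

lemma gre_gauss_of [simp]: "gre (gauss_of a b) = a"
  and gim_gauss_of [simp]: "gim (gauss_of a b) = b"
  by (simp_all add: gre_def gim_def cx_gauss_of)

lemma gauss_of_gre_gim [simp]: "gauss_of (gre n) (gim n) = n"
  by (subst cx_inject[symmetric]) (simp add: cx_gauss_of complex_eq_iff)

lemma gauss_int_eq_iff: "m = n \<longleftrightarrow> gre m = gre n \<and> gim m = gim n"
  by (metis gauss_of_gre_gim)

lemma gre_diff [simp]: "gre (m - n) = gre m - gre n"
  and gim_diff [simp]: "gim (m - n) = gim m - gim n"
proof -
  have "of_int (gre (m - n)) = (of_int (gre m - gre n) :: real)"
       "of_int (gim (m - n)) = (of_int (gim m - gim n) :: real)" by simp_all
  then show "gre (m - n) = gre m - gre n" "gim (m - n) = gim m - gim n"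
    by (simp_all only: of_int_eq_iff)
qed

lemma gnorm_eq: "gnorm n = of_int ((gre n)\<^sup>2 + (gim n)\<^sup>2)"
  by (simp add: gauss_norm_def cmod_power2)

lemma gnorm_nonneg [simp]: "gnorm n \<ge> 0"
  by (simp add: gauss_norm_def)

lemma gnorm_0 [simp]: "gnorm 0 = 0"
  and gnorm_1 [simp]: "gnorm 1 = 1"
  and gnorm_mult: "gnorm (m * n) = gnorm m * gnorm n"
  and sqrt_gnorm: "sqrt (gnorm n) = cmod (cx n)"
  by (simp_all add: gauss_norm_def norm_mult power_mult_distrib)

lemma gnorm_eq_0_iff [simp]: "gnorm n = 0 \<longleftrightarrow> n = 0"
  by (simp add: gauss_norm_def)

lemma gnorm_power: "gnorm (n ^ k) = gnorm n ^ k"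
  by (induction k) (simp_all add: gnorm_mult)

lemma gnorm_less_iff_sq: "gnorm m < gnorm n \<longleftrightarrow> cmod (cx m) < cmod (cx n)"
  by (metis sqrt_gnorm real_sqrt_less_iff)

lemma gnorm_ge_1: "n \<noteq> 0 \<Longrightarrow> gnorm n \<ge> 1"
proof -
  have *: "gnorm n \<ge> 1" if "n \<noteq> 0" for n
  proof -
    have "gnorm n \<noteq> 0" using that by simp
    then have "(gre n)\<^sup>2 + (gim n)\<^sup>2 \<noteq> 0" unfolding gnorm_eq by linarith
    then have "(gre n)\<^sup>2 + (gim n)\<^sup>2 > 0" by (smt (verit) zero_le_power2)
    then show ?thesis unfolding gnorm_eq by linarith
  qed
  show "n \<noteq> 0 \<Longrightarrow> gnorm n \<ge> 1" using * .
qed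

lemma gnorm_Nats: "gnorm n \<in> \<nat>"
proof -
  have "gnorm n = real (nat ((gre n)\<^sup>2 + (gim n)\<^sup>2))"
    unfolding gnorm_eq by (subst of_nat_nat) simp_all
  then show ?thesis by (metis of_nat_in_Nats)
qed

section \<open>Euclidean division, which makes the general theory of prime factorization
  available\<close>

instantiation gauss_int :: idom_modulo
begin

definition divide_gauss_int :: "gauss_int \<Rightarrow> gauss_int \<Rightarrow> gauss_int" where
  "m div n = gauss_of (round (Re (cx m / cx n))) (round (Im (cx m / cx n)))"

definition modulo_gauss_int :: "gauss_int \<Rightarrow> gauss_int \<Rightarrow> gauss_int" where
  "m mod n = m - m div n * (n :: gauss_int)"

instance
proof
  fix m n :: gauss_int
  show "m div 0 = 0"
    by (subst cx_inject[symmetric]) (simp add: divide_gauss_int_def cx_gauss_of complex_eq_iff)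
  show "m * n div n = m" if "n \<noteq> 0"
  proof -
    have "cx (m * n) / cx n = cx m" using that by simp
    moreover have "gauss_of (round (Re (cx m))) (round (Im (cx m))) = m"
      using of_int_gre[of m] of_int_gim[of m] gauss_of_gre_gim[of m] by (metis round_of_int)
    ultimately show ?thesis by (simp add: divide_gauss_int_def)
  qed
  show "m div n * n + m mod n = m"
    by (simp add: modulo_gauss_int_def)
qed

end

text \<open>Rounding both coordinates of the quotient leaves an error \<open>w\<close> in the square
  of side 1 around 0, so |w|^2 <= 1/2, and the remainder is \<open>w\<close> times the
  divisor.\<close>

lemma cmod_mod_less:
  assumes "n \<noteq> 0"
  shows "cmod (cx (m mod n)) < cmod (cx n)"
proof -
  define z where "z = cx m / cx n"
  define w where "w = z - cx (m div n)"
  have "\<bar>Re w\<bar> \<le> 1 / 2" "\<bar>Im w\<bar> \<le> 1 / 2"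
    using of_int_round_abs_le[of "Re z"] of_int_round_abs_le[of "Im z"]
    by (simp_all add: w_def divide_gauss_int_def cx_gauss_of z_def abs_minus_commute)
  then have "(Re w)\<^sup>2 \<le> (1 / 2)\<^sup>2" "(Im w)\<^sup>2 \<le> (1 / 2)\<^sup>2"
    using abs_le_square_iff[of "Re w" "1/2"] abs_le_square_iff[of "Im w" "1/2"] by simp_all
  then have "(Re w)\<^sup>2 + (Im w)\<^sup>2 < 1" by (simp add: power2_eq_square)
  then have "(cmod w)\<^sup>2 < 1" by (simp only: cmod_power2)
  then have w: "cmod w < 1" by (simp add: power2_less_1_iff)
  have "cx (m mod n) = w * cx n"
    using assms by (simp add: modulo_gauss_int_def w_def z_def field_simps)
  then show ?thesis using w assms by (simp add: norm_mult)
qed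

instantiation gauss_int :: euclidean_ring
begin

definition euclidean_size_gauss_int :: "gauss_int \<Rightarrow> nat" where
  "euclidean_size (n :: gauss_int) = nat \<lfloor>gnorm n\<rfloor>"

instance
proof
  fix m n :: gauss_int
  have nat: "real (euclidean_size k) = gnorm k" for k :: gauss_int
  proof -
    obtain j where "gnorm k = real j" using gnorm_Nats Nats_cases by blast
    then show ?thesis by (simp add: euclidean_size_gauss_int_def)
  qed
  show "euclidean_size (0 :: gauss_int) = 0" by (simp add: euclidean_size_gauss_int_def)
  show "euclidean_size (m mod n) < euclidean_size n" if "n \<noteq> 0"
    using cmod_mod_less[OF that, of m] by (simp add: nat gnorm_less_iff_sq flip: of_nat_less_iff[where ?'a = real])
  show "euclidean_size m \<le> euclidean_size (m * n)" if "n \<noteq> 0"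
    using gnorm_ge_1[OF that]
      mult_left_mono[of 1 "gnorm n" "gnorm m"]
    by (simp add: nat gnorm_mult flip: of_nat_le_iff[where ?'a = real])
qed

end

text \<open>Any choice of representatives of the classes of associates does.\<close>

instantiation gauss_int :: normalization_euclidean_semiring
begin

definition normalize_gauss_int :: "gauss_int \<Rightarrow> gauss_int" where
  "normalize (n :: gauss_int) = (if n dvd 1 then 1 else SOME m. m dvd n \<and> n dvd m)"

definition unit_factor_gauss_int :: "gauss_int \<Rightarrow> gauss_int" where
  "unit_factor (n :: gauss_int) = n div normalize n"

instance
proof
  have normalize: "normalize n dvd n \<and> n dvd normalize n" for n :: gauss_int
    using someI[of "\<lambda>m. m dvd n \<and> n dvd m" n] by (auto simp: normalize_gauss_int_def)
  have unit: "unit_factor n * normalize n = n" for n :: gauss_int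
    using normalize[of n] by (simp add: unit_factor_gauss_int_def)
  fix m n :: gauss_int
  show "unit_factor n * normalize n = n" by (rule unit)
  show "normalize (0 :: gauss_int) = 0" using normalize[of 0] by simp
  then show "unit_factor (0 :: gauss_int) = 0" by (simp add: unit_factor_gauss_int_def)
  show "unit_factor m = m" if "m dvd 1"
    using that by (simp add: unit_factor_gauss_int_def normalize_gauss_int_def)
  show "unit_factor n dvd 1" if "n \<noteq> 0"
  proof -
    obtain k where "normalize n = n * k" using normalize[of n] by blast
    then have "n * (unit_factor n * k) = n * 1" using unit[of n] by (simp add: mult_ac)
    then have "unit_factor n * k = 1" using that by (metis mult_cancel_left)
    then show ?thesis by (metis dvd_triv_left)
  qed
  show "unit_factor (m * n) = m * unit_factor n" if "m dvd 1"
  proof -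
    \<comment> \<open>A unit factor does not change the predicate under the choice operator, so the
      very same element is chosen.\<close>
    have "normalize (m * n) = normalize n"
      using that by (simp add: normalize_gauss_int_def mult_unit_dvd_iff' dvd_mult_unit_iff')
    then show ?thesis using normalize[of n] that
      by (simp add: unit_factor_gauss_int_def div_mult_swap)
  qed
qed

end

lemma is_unit_gnorm: "is_unit n \<Longrightarrow> gnorm n = 1"
proof -
  assume "is_unit n"
  then obtain m where m: "1 = n * m" by blast
  then have "gnorm n * gnorm m = 1" by (metis gnorm_1 gnorm_mult)
  moreover have "n \<noteq> 0" "m \<noteq> 0" using m by auto
  ultimately show ?thesis
    using gnorm_ge_1[of n] gnorm_ge_1[of m]
    by (smt (verit) mult_le_cancel_left1 gnorm_nonneg)
qed

lemma gnorm_normalize [simp]: "gnorm (normalize n) = gnorm n"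
proof (cases "n = 0")
  case False
  then have "gnorm (unit_factor n * normalize n) = gnorm (normalize n)"
    by (simp only: gnorm_mult) (simp add: is_unit_gnorm)
  then show ?thesis by simp
qed auto

text \<open>An element of norm 1 is inverted by its conjugate, here \<open>c\<close>. Norms are
  natural numbers, so the next possible value is 2.\<close>

lemma gnorm_nonunit_ge_2: "n \<noteq> 0 \<Longrightarrow> \<not> is_unit n \<Longrightarrow> gnorm n \<ge> 2"
proof -
  assume n: "n \<noteq> 0" "\<not> is_unit n"
  have "gnorm n \<noteq> 1"
  proof
    assume "gnorm n = 1"
    define c where "c = gauss_of (gre n) (- gim n)"
    have "(Re (cx n))\<^sup>2 + (Im (cx n))\<^sup>2 = 1"
      using \<open>gnorm n = 1\<close> by (simp add: gauss_norm_def cmod_power2)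
    then have "cx (n * c) = 1"
      by (simp add: c_def cx_gauss_of complex_eq_iff power2_eq_square)
    then have "n * c = 1" using cx_inject[of "n * c" 1] by simp
    then show False using n(2) by (metis dvd_triv_left)
  qed
  moreover have "gnorm n \<ge> 1" using n gnorm_ge_1 by blast
  moreover obtain k where "gnorm n = real k" using gnorm_Nats Nats_cases by blast
  ultimately show ?thesis by simp
qed

text \<open>The disc is punctured because divisor sums and \<open>ln (gnorm n)\<close> are
  meaningful only for nonzero \<open>n\<close>. The full disc, natural for exponential sums, is
  \<open>cdisc\<close> below.\<close>

definition gdisc :: "real \<Rightarrow> gauss_int set" where
  "gdisc x = {n. n \<noteq> 0 \<and> gnorm n \<le> x}"

lemma gnorm_le_bounds:
  assumes "gnorm n \<le> x"
  shows "real_of_int \<bar>gre n\<bar> \<le> sqrt x" "real_of_int \<bar>gim n\<bar> \<le> sqrt x"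
proof -
  have "cmod (cx n) \<le> sqrt x" using assms by (metis sqrt_gnorm real_sqrt_le_iff)
  then show "real_of_int \<bar>gre n\<bar> \<le> sqrt x" "real_of_int \<bar>gim n\<bar> \<le> sqrt x"
    using abs_Re_le_cmod[of "cx n"] abs_Im_le_cmod[of "cx n"] by simp_all
qed

lemma finite_gnorm_le: "finite {n. gnorm n \<le> x}"
proof -
  have "{n. gnorm n \<le> x} \<subseteq> (\<lambda>(a, b). gauss_of a b) ` ({-\<lfloor>sqrt x\<rfloor>..\<lfloor>sqrt x\<rfloor>} \<times> {-\<lfloor>sqrt x\<rfloor>..\<lfloor>sqrt x\<rfloor>})"
  proof
    fix n assume "n \<in> {n. gnorm n \<le> x}"
    then have "\<bar>gre n\<bar> \<le> \<lfloor>sqrt x\<rfloor>" "\<bar>gim n\<bar> \<le> \<lfloor>sqrt x\<rfloor>"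
      using gnorm_le_bounds[of n x] by (simp_all add: le_floor_iff)
    then show "n \<in> (\<lambda>(a, b). gauss_of a b) ` ({-\<lfloor>sqrt x\<rfloor>..\<lfloor>sqrt x\<rfloor>} \<times> {-\<lfloor>sqrt x\<rfloor>..\<lfloor>sqrt x\<rfloor>})"
      by (intro image_eqI[of _ _ "(gre n, gim n)"]) auto
  qed
  then show ?thesis by (rule finite_subset) auto
qed

lemma finite_gdisc [simp]: "finite (gdisc x)"
  unfolding gdisc_def by (rule finite_subset[OF _ finite_gnorm_le[of x]]) auto

lemma gdisc_mono: "x \<le> y \<Longrightarrow> gdisc x \<subseteq> gdisc y"
  by (auto simp: gdisc_def)

subsection \<open>The functions of von Mangoldt and Moebius\<close>

text \<open>One divisor from each class of associates, so that sums over divisors behave like sums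
  over the ideals dividing \<open>n\<close>.\<close>

definition gdivisors :: "gauss_int \<Rightarrow> gauss_int set" where
  "gdivisors n = {d. d dvd n \<and> normalize d = d}"

definition ndisc :: "real \<Rightarrow> gauss_int set" where
  "ndisc x = {d \<in> gdisc x. normalize d = d}"

definition gmangoldt :: "gauss_int \<Rightarrow> real" where
  "gmangoldt n = (if card (prime_factors n) = 1 then ln (gnorm (the_elem (prime_factors n))) else 0)"

text \<open>The condition says that no prime is repeated in the factorization, that is,
  \<open>n\<close> is squarefree.\<close>

definition gmoebius :: "gauss_int \<Rightarrow> real" where
  "gmoebius n = (if prime_factorization n = mset_set (prime_factors n)
           then (- 1) ^ card (prime_factors n) else 0)"

lemma gnorm_dvd_le:
  assumes "d dvd n" "n \<noteq> 0"
  shows "gnorm d \<le> gnorm n"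
proof -
  obtain k where k: "n = d * k" using assms by blast
  then have "gnorm k \<ge> 1" using assms by (intro gnorm_ge_1) auto
  then show ?thesis using k mult_left_mono[of 1 "gnorm k" "gnorm d"] by (simp add: gnorm_mult)
qed

lemma gdivisors_subset_gdisc: "n \<noteq> 0 \<Longrightarrow> gdivisors n \<subseteq> gdisc (gnorm n)"
  by (auto simp: gdivisors_def gdisc_def gnorm_dvd_le)

lemma finite_gdivisors [simp]: "n \<noteq> 0 \<Longrightarrow> finite (gdivisors n)"
  using finite_subset[OF gdivisors_subset_gdisc] by simp

lemma gnorm_pos: "n \<noteq> 0 \<Longrightarrow> gnorm n > 0"
  using gnorm_ge_1[of n] by simp

lemma finite_ndisc [simp]: "finite (ndisc x)"
  by (simp add: ndisc_def)

lemma ndisc_subset: "ndisc x \<subseteq> gdisc x"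
  by (auto simp: ndisc_def)

lemma abs_gmoebius_le: "\<bar>gmoebius n\<bar> \<le> 1"
  by (simp add: gmoebius_def)

lemma gnorm_prime_ge_2: "prime p \<Longrightarrow> gnorm p \<ge> 2"
  by (rule gnorm_nonunit_ge_2) auto

lemma gmangoldt_nonneg: "gmangoldt n \<ge> 0"
proof (cases "card (prime_factors n) = 1")
  case True
  then obtain p where p: "prime_factors n = {p}" by (auto simp: card_1_singleton_iff)
  then have "prime p" by (metis in_prime_factors_imp_prime singletonI)
  then show ?thesis using gnorm_prime_ge_2[of p] p by (simp add: gmangoldt_def)
qed (simp add: gmangoldt_def)

lemma gmangoldt_normalize [simp]: "gmangoldt (normalize n) = gmangoldt n"
  by (simp add: gmangoldt_def)

lemma normalize_prod_prime_factorization: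
  "n \<noteq> 0 \<Longrightarrow> normalize n = n \<Longrightarrow> normalize (prod_mset (prime_factorization n)) = n"
  using prod_mset_prime_factorization_weak[of n] by simp

text \<open>Turns divisor sums into sums over submultisets of the prime factorization, where the
  identities for \<open>gmoebius\<close> and \<open>gmangoldt\<close> become purely
  combinatorial.\<close>

lemma bij_betw_prime_factorization_gdivisors:
  assumes "n \<noteq> 0"
  shows "bij_betw prime_factorization (gdivisors n) {M. M \<subseteq># prime_factorization n}"
proof (rule bij_betwI[of _ _ _ "\<lambda>M. normalize (prod_mset M)"])
  have *: "d dvd n" "normalize d = d" "d \<noteq> 0" if "d \<in> gdivisors n" for d
    using that assms by (auto simp: gdivisors_def)
  show "normalize (prod_mset (prime_factorization d)) = d" if "d \<in> gdivisors n" for d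
    using *[OF that] by (intro normalize_prod_prime_factorization)
  show "prime_factorization \<in> gdivisors n \<rightarrow> {M. M \<subseteq># prime_factorization n}"
    using * assms by (simp add: prime_factorization_subset_iff_dvd)
  have primes: "prime p" if "M \<in> {M. M \<subseteq># prime_factorization n}" "p \<in># M" for M p
    using that by (meson in_prime_factors_imp_prime mem_Collect_eq mset_subset_eqD)
  have pf: "prime_factorization (prod_mset M) = M" if "M \<in> {M. M \<subseteq># prime_factorization n}" for M
    using primes[OF that] by (intro prime_factorization_prod_mset_primes) auto
  then show "prime_factorization (normalize (prod_mset M)) = M"
    if "M \<in> {M. M \<subseteq># prime_factorization n}" for M using that by simp
  show "(\<lambda>M. normalize (prod_mset M)) \<in> {M. M \<subseteq># prime_factorization n} \<rightarrow> gdivisors n"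
  proof
    fix M assume M: "M \<in> {M. M \<subseteq># prime_factorization n}"
    then have "prod_mset M \<noteq> 0"
      using primes[OF M, of 0] by (auto simp: prod_mset_zero_iff)
    then have "prod_mset M dvd n"
      using M pf[OF M] assms by (metis mem_Collect_eq prime_factorization_subset_iff_dvd)
    then show "normalize (prod_mset M) \<in> gdivisors n" by (simp add: gdivisors_def)
  qed
qed

lemma sum_gdivisors_submultisets:
  assumes "n \<noteq> 0"
  shows "(\<Sum>d\<in>gdivisors n. f (prime_factorization d)) = sum f {M. M \<subseteq># prime_factorization n}"
  using sum.reindex_bij_betw[OF bij_betw_prime_factorization_gdivisors[OF assms]] .

lemma finite_submultisets_prime_factorization:
  fixes n :: gauss_int
  shows "n \<noteq> 0 \<Longrightarrow> finite {M. M \<subseteq># prime_factorization n}"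
  using bij_betw_finite[OF bij_betw_prime_factorization_gdivisors] finite_gdivisors by blast

text \<open>Inserting a fixed element \<open>a\<close> pairs off the subsets with opposite
  signs.\<close>

lemma sum_alternating_Pow:
  assumes "finite A" "A \<noteq> {}"
  shows "(\<Sum>S\<in>Pow A. (- 1 :: real) ^ card S) = 0"
proof -
  obtain a B where A: "A = insert a B" "a \<notin> B" "finite B"
    using assms by (metis finite_insert mk_disjoint_insert all_not_in_conv)
  have inj: "inj_on (insert a) (Pow B)" using A by (auto simp: inj_on_def)
  have "(\<Sum>S\<in>Pow A. (- 1 :: real) ^ card S) =
      (\<Sum>S\<in>Pow B. (- 1) ^ card S) + (\<Sum>S\<in>insert a ` Pow B. (- 1) ^ card S)"
    unfolding A(1) Pow_insert using A by (intro sum.union_disjoint) auto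
  also have "(\<Sum>S\<in>insert a ` Pow B. (- 1 :: real) ^ card S) = (\<Sum>S\<in>Pow B. - ((- 1) ^ card S))"
    unfolding sum.reindex[OF inj] o_def
  proof (rule sum.cong)
    fix S assume "S \<in> Pow B"
    then have "card (insert a S) = Suc (card S)" using A by (metis card_insert_disjoint PowD finite_subset subsetD)
    then show "(- 1 :: real) ^ card (insert a S) = - ((- 1) ^ card S)" by simp
  qed simp
  finally show ?thesis by (simp add: sum_negf)
qed

text \<open>Only submultisets without repetition contribute. They correspond to the subsets of the
  set of prime factors, whose signs cancel unless this set is empty, that is, unless
  \<open>n\<close> is a unit.\<close>

lemma sum_gmoebius_gdivisors:
  assumes "n \<noteq> 0"
  shows "(\<Sum>d\<in>gdivisors n. gmoebius d) = (if is_unit n then 1 else 0)"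
proof -
  let ?P = "prime_factors n"
  let ?f = "\<lambda>M. if M = mset_set (set_mset M) then (- 1 :: real) ^ card (set_mset M) else 0"
  have "(\<Sum>d\<in>gdivisors n. gmoebius d) = (\<Sum>d\<in>gdivisors n. ?f (prime_factorization d))"
    by (simp add: gmoebius_def)
  also have "\<dots> = sum ?f {M. M \<subseteq># prime_factorization n}"
    by (rule sum_gdivisors_submultisets[OF assms])
  also have "\<dots> = sum ?f (mset_set ` Pow ?P)"
  proof (rule sum.mono_neutral_right)
    show "finite {M. M \<subseteq># prime_factorization n}" by (rule finite_submultisets_prime_factorization[OF assms])
    show "mset_set ` Pow ?P \<subseteq> {M. M \<subseteq># prime_factorization n}"
    proof clarify
      fix S assume "S \<subseteq> ?P"
      then show "mset_set S \<subseteq># prime_factorization n"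
        by (meson mset_set_set_mset_msubset subset_imp_msubset_mset_set subset_mset.order_trans finite_set_mset)
    qed
    show "\<forall>M\<in>{M. M \<subseteq># prime_factorization n} - mset_set ` Pow ?P. ?f M = 0"
    proof
      fix M assume M: "M \<in> {M. M \<subseteq># prime_factorization n} - mset_set ` Pow ?P"
      then have "set_mset M \<in> Pow ?P" by (auto dest: mset_subset_eqD)
      then have "M \<noteq> mset_set (set_mset M)" using M by blast
      then show "?f M = 0" by simp
    qed
  qed
  also have "\<dots> = (\<Sum>S\<in>Pow ?P. (- 1) ^ card S)"
  proof (subst sum.reindex)
    show "inj_on mset_set (Pow ?P)"
      by (rule inj_onI) (metis PowD finite_set_mset finite_set_mset_mset_set finite_subset)
    show "sum (?f \<circ> mset_set) (Pow ?P) = (\<Sum>S\<in>Pow ?P. (- 1) ^ card S)"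
    proof (rule sum.cong)
      fix S assume "S \<in> Pow ?P"
      then have "finite S" by (meson PowD finite_set_mset finite_subset)
      then show "(?f \<circ> mset_set) S = (- 1) ^ card S" by simp
    qed simp
  qed
  also have "\<dots> = (if is_unit n then 1 else 0)"
  proof (cases "is_unit n")
    case True
    then show ?thesis by (simp add: prime_factorization_unit)
  next
    case False
    then have "?P \<noteq> {}" using assms by (simp add: prime_factorization_empty_iff)
    then show ?thesis using False sum_alternating_Pow[of ?P] by simp
  qed
  finally show ?thesis .
qed

lemma gnorm_prod_mset: "gnorm (prod_mset M) = prod_mset (image_mset gnorm M)"
  by (induction M) (simp_all add: gnorm_mult)

lemma ln_gnorm_eq_sum:
  assumes "n \<noteq> 0"
  shows "ln (gnorm n) = (\<Sum>p\<in>prime_factors n. real (count (prime_factorization n) p) * ln (gnorm p))"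
proof -
  have "gnorm n = gnorm (normalize (prod_mset (prime_factorization n)))"
    using prod_mset_prime_factorization_weak[OF assms] by simp
  also have "\<dots> = (\<Prod>p\<in>prime_factors n. gnorm p ^ count (prime_factorization n) p)"
    by (simp add: gnorm_prod_mset image_prod_mset_multiplicity)
  finally have "gnorm n = (\<Prod>p\<in>prime_factors n. gnorm p ^ count (prime_factorization n) p)" .
  moreover have "gnorm p ^ count (prime_factorization n) p > 0" if "p \<in> prime_factors n" for p
    using that by (intro zero_less_power gnorm_pos) auto
  ultimately have "ln (gnorm n) = (\<Sum>p\<in>prime_factors n. ln (gnorm p ^ count (prime_factorization n) p))"
    using ln_prod[OF finite_set_mset, of "prime_factorization n" "\<lambda>p. gnorm p ^ count (prime_factorization n) p"]
    by (metis order_less_irrefl)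
  also have "\<dots> = (\<Sum>p\<in>prime_factors n. real (count (prime_factorization n) p) * ln (gnorm p))"
  proof (rule sum.cong)
    fix p assume "p \<in> prime_factors n"
    then have "gnorm p > 0" using gnorm_prime_ge_2[of p] by (auto dest: in_prime_factors_imp_prime)
    then show "ln (gnorm p ^ count (prime_factorization n) p) = real (count (prime_factorization n) p) * ln (gnorm p)"
      by (simp add: ln_realpow)
  qed simp
  finally show ?thesis .
qed

text \<open>The contributing submultisets are \<open>replicate_mset k p\<close> with
  \<open>k\<close> from 1 to the multiplicity of \<open>p\<close>, so \<open>ln (gnorm p)\<close> is
  counted once for each occurrence of \<open>p\<close> in \<open>n\<close>.\<close>

lemma sum_gmangoldt_gdivisors:
  assumes "n \<noteq> 0"
  shows "(\<Sum>d\<in>gdivisors n. gmangoldt d) = ln (gnorm n)"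
proof -
  let ?N = "prime_factorization n"
  let ?f = "\<lambda>M. if card (set_mset M) = 1 then ln (gnorm (the_elem (set_mset M))) else 0"
  let ?S = "SIGMA p:set_mset ?N. {1..count ?N p}"
  let ?g = "\<lambda>(p, k). replicate_mset k p"
  have "(\<Sum>d\<in>gdivisors n. gmangoldt d) = (\<Sum>d\<in>gdivisors n. ?f (prime_factorization d))"
    by (simp add: gmangoldt_def)
  also have "\<dots> = sum ?f {M. M \<subseteq># ?N}"
    by (rule sum_gdivisors_submultisets[OF assms])
  also have "\<dots> = sum ?f (?g ` ?S)"
  proof (rule sum.mono_neutral_right)
    show "finite {M. M \<subseteq># ?N}" by (rule finite_submultisets_prime_factorization[OF assms])
    show "?g ` ?S \<subseteq> {M. M \<subseteq># ?N}"
      by (auto simp: count_le_replicate_mset_subset_eq)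
    show "\<forall>M\<in>{M. M \<subseteq># ?N} - ?g ` ?S. ?f M = 0"
    proof
      fix M assume M: "M \<in> {M. M \<subseteq># ?N} - ?g ` ?S"
      have "card (set_mset M) \<noteq> 1"
      proof
        assume "card (set_mset M) = 1"
        then obtain p where p: "set_mset M = {p}" by (auto simp: card_1_singleton_iff)
        then have "M = replicate_mset (count M p) p"
          by (intro multiset_eqI) (auto simp: not_in_iff[symmetric])
        moreover have "p \<in># M" using p by simp
        moreover have "M \<subseteq># ?N" using M by simp
        ultimately have "M = ?g (p, count M p)" "(p, count M p) \<in> ?S"
          by (auto dest: mset_subset_eqD simp: mset_subset_eq_count Suc_le_eq)
        then show False using M by blast
      qed
      then show "?f M = 0" by simp
    qed
  qed
  also have "\<dots> = (\<Sum>(p, k)\<in>?S. ln (gnorm p))"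
  proof (subst sum.reindex)
    show "inj_on ?g ?S"
    proof (rule inj_onI, clarify)
      fix p q k l assume *: "k \<in> {1..count ?N p}" "l \<in> {1..count ?N q}" "replicate_mset k p = replicate_mset l q"
      then have "k = l" by (metis size_replicate_mset)
      moreover have "p = q" using * by (metis atLeastAtMost_iff in_replicate_mset not_one_le_zero neq0_conv)
      ultimately show "p = q \<and> k = l" by simp
    qed
    show "sum (?f \<circ> ?g) ?S = (\<Sum>(p, k)\<in>?S. ln (gnorm p))"
      by (rule sum.cong) auto
  qed
  also have "\<dots> = ln (gnorm n)"
    by (subst sum.Sigma[symmetric]) (auto simp: ln_gnorm_eq_sum[OF assms])
  finally show ?thesis .
qed

lemma gmangoldt_le:
  assumes "n \<noteq> 0"
  shows "gmangoldt n \<le> ln (gnorm n)"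
proof -
  have "gmangoldt (normalize n) \<le> (\<Sum>d\<in>gdivisors n. gmangoldt d)"
    using assms by (intro member_le_sum finite_gdivisors) (auto simp: gdivisors_def gmangoldt_nonneg)
  then show ?thesis by (simp add: sum_gmangoldt_gdivisors[OF assms])
qed

text \<open>In \<open>n = d * k\<close> the divisor is normalized while the cofactor
  \<open>k\<close> runs over a full disc and carries the unit. This asymmetry keeps the inner sums
  over complete discs of Gaussian integers, where geometric series apply.\<close>

lemma sum_gdivisors_hyperbola:
  fixes g :: "gauss_int \<Rightarrow> gauss_int \<Rightarrow> 'a :: comm_monoid_add"
  shows "(\<Sum>n\<in>gdisc y. \<Sum>d\<in>gdivisors n. g d (n div d)) =
         (\<Sum>d\<in>ndisc y. \<Sum>k\<in>gdisc (y / gnorm d). g d k)"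
proof -
  note pos = gnorm_pos
  have "(\<Sum>n\<in>gdisc y. \<Sum>d\<in>gdivisors n. g d (n div d)) = (\<Sum>(n, d)\<in>Sigma (gdisc y) gdivisors. g d (n div d))"
    by (rule sum.Sigma) (simp, metis (mono_tags, lifting) finite_gdivisors gdisc_def mem_Collect_eq)
  also have "\<dots> = (\<Sum>(d, k)\<in>(SIGMA d:ndisc y. gdisc (y / gnorm d)). g d k)"
  proof (rule sum.reindex_bij_witness[of _ "\<lambda>(d, k). (d * k, d)" "\<lambda>(n, d). (d, n div d)"]; clarsimp)
    fix n d assume "n \<in> gdisc y" "d \<in> gdivisors n"
    then obtain k where k: "n = d * k" "d \<noteq> 0" "k \<noteq> 0" "normalize d = d" "gnorm d * gnorm k \<le> y"
      by (auto simp: gdisc_def gdivisors_def gnorm_mult)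
    then show "d * (n div d) = n" by simp
    have "gnorm d \<le> gnorm d * gnorm k"
      using k gnorm_ge_1[of k] mult_left_mono[of 1 "gnorm k" "gnorm d"] by simp
    then have "gnorm d \<le> y" using k by linarith
    then show "d \<in> ndisc y \<and> n div d \<in> gdisc (y / gnorm d)"
      using k pos[of d] by (simp add: ndisc_def gdisc_def pos_le_divide_eq mult.commute)
  next
    fix d k assume dk: "d \<in> ndisc y" "k \<in> gdisc (y / gnorm d)"
    then show "d * k div d = k" by (auto simp: ndisc_def gdisc_def)
    from dk show "d * k \<in> gdisc y \<and> d \<in> gdivisors (d * k)"
      using pos[of d] by (auto simp: ndisc_def gdisc_def gdivisors_def gnorm_mult pos_le_divide_eq mult.commute)
  qed
  also have "\<dots> = (\<Sum>d\<in>ndisc y. \<Sum>k\<in>gdisc (y / gnorm d). g d k)"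
    by (subst sum.Sigma) auto
  finally show ?thesis .
qed

section \<open>Vaughan's identity\<close>

definition gmangoldt_big :: "real \<Rightarrow> gauss_int \<Rightarrow> real" where
  "gmangoldt_big U n = (\<Sum>c\<in>gdivisors n. if gnorm c > U then gmangoldt c else 0)"

lemma gmangoldt_big_nonneg: "gmangoldt_big U n \<ge> 0"
  unfolding gmangoldt_big_def by (intro sum_nonneg) (auto simp: gmangoldt_nonneg)

lemma gmangoldt_big_le: "n \<noteq> 0 \<Longrightarrow> gmangoldt_big U n \<le> ln (gnorm n)"
  unfolding sum_gmangoldt_gdivisors[symmetric] gmangoldt_big_def by (intro sum_mono) (auto simp: gmangoldt_nonneg)

lemma gmangoldt_big_eq_0:
  assumes "n \<noteq> 0" "gnorm n \<le> U"
  shows "gmangoldt_big U n = 0"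
proof -
  have "gnorm c \<le> U" if "c \<in> gdivisors n" for c
    using gnorm_dvd_le[of c n] that assms by (simp add: gdivisors_def)
  then show ?thesis unfolding gmangoldt_big_def by (intro sum.neutral) (metis linorder_not_le)
qed

text \<open>Moebius inversion: \<open>gmangoldt_big U\<close> is the convolution of the constant 1
  with the part of \<Lambda> above \<open>U\<close>. After exchanging the divisors \<open>d\<close>
  and \<open>c\<close>, the sum of \<open>gmoebius d\<close> over the divisors of
  \<open>n div c\<close> vanishes unless \<open>c\<close> is associated to \<open>n\<close>, and
  among normalized \<open>c\<close> this leaves only \<open>normalize n\<close>.\<close>

lemma gmangoldt_big_eq_convolution:
  assumes "n \<noteq> 0"
  shows "(\<Sum>d\<in>gdivisors n. gmoebius d * gmangoldt_big U (n div d)) = (if gnorm n > U then gmangoldt n else 0)"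
proof -
  define h where "h = (\<lambda>c. if gnorm c > U then gmangoldt c else 0)"
  have nz: "n div d \<noteq> 0" if "d \<in> gdivisors n" for d using that assms by (auto simp: gdivisors_def)
  have "(\<Sum>d\<in>gdivisors n. gmoebius d * gmangoldt_big U (n div d)) = (\<Sum>(d, c)\<in>(SIGMA d:gdivisors n. gdivisors (n div d)). gmoebius d * h c)"
    using nz assms by (simp add: gmangoldt_big_def h_def sum_distrib_left sum.Sigma)
  also have "\<dots> = (\<Sum>(c, d)\<in>(SIGMA c:gdivisors n. gdivisors (n div c)). gmoebius d * h c)"
  proof -
    have swap: "d \<in> gdivisors n \<and> c \<in> gdivisors (n div d)" if "c \<in> gdivisors n" "d \<in> gdivisors (n div c)" for c d
    proof -
      have "c \<noteq> 0" "d \<noteq> 0" using that assms by (auto simp: gdivisors_def)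
      moreover have "d * c dvd n" using that \<open>c \<noteq> 0\<close> by (auto simp: gdivisors_def dvd_div_iff_mult)
      ultimately show ?thesis using that
        by (auto simp: gdivisors_def dvd_div_iff_mult mult.commute intro: dvd_mult_left)
    qed
    show ?thesis
      by (rule sum.reindex_bij_witness[of _ "\<lambda>(c, d). (d, c)" "\<lambda>(d, c). (c, d)"]) (auto dest: swap)
  qed
  also have "\<dots> = (\<Sum>c\<in>gdivisors n. h c * (\<Sum>d\<in>gdivisors (n div c). gmoebius d))"
    using nz assms by (simp add: sum.Sigma[symmetric] sum_distrib_left mult.commute)
  also have "\<dots> = (\<Sum>c\<in>gdivisors n. if c = normalize n then h c else 0)"
  proof (rule sum.cong)
    fix c assume c: "c \<in> gdivisors n"
    have "is_unit (n div c) \<longleftrightarrow> c = normalize n"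
    proof
      assume "is_unit (n div c)"
      then have "normalize (n div c * c) = normalize c" by (simp add: normalize_mult_unit_left)
      then show "c = normalize n" using c by (simp add: gdivisors_def)
    next
      assume "c = normalize n"
      then show "is_unit (n div c)" using assms by simp
    qed
    then show "h c * (\<Sum>d\<in>gdivisors (n div c). gmoebius d) = (if c = normalize n then h c else 0)"
      using sum_gmoebius_gdivisors[OF nz[OF c]] by simp
  qed simp
  also have "\<dots> = h (normalize n)"
    using assms sum.delta[OF finite_gdivisors[OF assms], of "normalize n" h] by (simp add: gdivisors_def)
  finally show ?thesis by (simp add: h_def)
qed

text \<open>Here only the cut at \<open>U\<close> is made. The cut at \<open>V\<close> is made in
  \<open>exp_sum_bound\<close>, by the size of \<open>d\<close>: for small \<open>d\<close> the
  coefficients in \<open>k\<close> are made smooth by \<open>type_I_split\<close>, for large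
  \<open>d\<close> cancellation comes from Cauchy-Schwarz.\<close>

lemma sum_gmangoldt_eq_bilinear:
  fixes \<psi> :: "gauss_int \<Rightarrow> complex"
  shows "(\<Sum>n\<in>gdisc y. gmangoldt n * \<psi> n) = (\<Sum>n\<in>gdisc y \<inter> gdisc U. gmangoldt n * \<psi> n) +
    (\<Sum>d\<in>ndisc y. \<Sum>k\<in>gdisc (y / gnorm d). gmoebius d * gmangoldt_big U k * \<psi> (d * k))"
proof -
  have "(\<Sum>d\<in>ndisc y. \<Sum>k\<in>gdisc (y / gnorm d). gmoebius d * gmangoldt_big U k * \<psi> (d * k)) =
      (\<Sum>n\<in>gdisc y. \<Sum>d\<in>gdivisors n. gmoebius d * gmangoldt_big U (n div d) * \<psi> (d * (n div d)))"
    by (rule sum_gdivisors_hyperbola[symmetric])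
  also have "\<dots> = (\<Sum>n\<in>gdisc y. of_real (\<Sum>d\<in>gdivisors n. gmoebius d * gmangoldt_big U (n div d)) * \<psi> n)"
    unfolding of_real_sum sum_distrib_right by (intro sum.cong) (auto simp: gdivisors_def)
  also have "\<dots> = (\<Sum>n\<in>gdisc y. of_real (if gnorm n > U then gmangoldt n else 0) * \<psi> n)"
    by (intro sum.cong refl) (subst gmangoldt_big_eq_convolution, auto simp: gdisc_def)
  finally have "(\<Sum>d\<in>ndisc y. \<Sum>k\<in>gdisc (y / gnorm d). gmoebius d * gmangoldt_big U k * \<psi> (d * k)) =
    (\<Sum>n\<in>gdisc y. of_real (if gnorm n > U then gmangoldt n else 0) * \<psi> n)" .
  moreover have "(\<Sum>n\<in>gdisc y \<inter> gdisc U. gmangoldt n * \<psi> n) = (\<Sum>n\<in>gdisc y. if n \<in> gdisc U then gmangoldt n * \<psi> n else 0)"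
    by (rule sum.inter_restrict) simp
  ultimately show ?thesis
    by (simp add: sum.distrib[symmetric]) (intro sum.cong, auto simp: gdisc_def)
qed

lemma gmangoldt_big_eq_ln_minus:
  assumes "n \<noteq> 0"
  shows "gmangoldt_big U n = ln (gnorm n) - (\<Sum>c\<in>gdivisors n. if gnorm c \<le> U then gmangoldt c else 0)"
  unfolding sum_gmangoldt_gdivisors[OF assms, symmetric] gmangoldt_big_def sum_subtractf[symmetric]
  by (intro sum.cong) auto

text \<open>The sum of \<Lambda> over the large divisors of \<open>k\<close> equals
  \<open>ln (gnorm k)\<close> minus the sum over the small ones. The logarithm is a smooth weight,
  and in the remaining sum only short ranges of \<open>c\<close> occur, with free inner sums over
  \<open>m\<close>.\<close>

lemma type_I_split:
  fixes \<psi> :: "gauss_int \<Rightarrow> complex"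
  shows "(\<Sum>k\<in>gdisc x. gmangoldt_big U k * \<psi> k) = (\<Sum>k\<in>gdisc x. ln (gnorm k) * \<psi> k) -
    (\<Sum>c\<in>ndisc x. if gnorm c \<le> U then gmangoldt c * (\<Sum>m\<in>gdisc (x / gnorm c). \<psi> (c * m)) else 0)"
proof -
  have "(\<Sum>k\<in>gdisc x. gmangoldt_big U k * \<psi> k) = (\<Sum>k\<in>gdisc x. ln (gnorm k) * \<psi> k) -
      (\<Sum>k\<in>gdisc x. \<Sum>c\<in>gdivisors k. (if gnorm c \<le> U then gmangoldt c else 0) * \<psi> (c * (k div c)))"
    unfolding sum_subtractf[symmetric]
    by (intro sum.cong refl)
       (auto simp: gmangoldt_big_eq_ln_minus gdisc_def gdivisors_def algebra_simps sum_distrib_left intro!: sum.cong)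
  also have "(\<Sum>k\<in>gdisc x. \<Sum>c\<in>gdivisors k. complex_of_real (if gnorm c \<le> U then gmangoldt c else 0) * \<psi> (c * (k div c))) =
      (\<Sum>c\<in>ndisc x. \<Sum>m\<in>gdisc (x / gnorm c). (if gnorm c \<le> U then gmangoldt c else 0) * \<psi> (c * m))"
    by (rule sum_gdivisors_hyperbola)
  also have "\<dots> = (\<Sum>c\<in>ndisc x. if gnorm c \<le> U then gmangoldt c * (\<Sum>m\<in>gdisc (x / gnorm c). \<psi> (c * m)) else 0)"
    by (intro sum.cong) (auto simp: sum_distrib_left)
  finally show ?thesis .
qed

text \<open>The coefficients of the second type I sum are dominated by \<open>\<Sum>\<^bsub>c | e\<^esub> \<Lambda> c = ln (N e)\<close>.\<close>

lemma sum_gmangoldt_products_le: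
  assumes G: "\<And>e. G e \<ge> 0" and "U \<ge> 0" "V \<ge> 0"
  shows "(\<Sum>d\<in>ndisc V. \<Sum>c\<in>ndisc U. gmangoldt c * G (d * c)) \<le> (\<Sum>e\<in>gdisc (U * V). ln (gnorm e) * G e)"
proof -
  have inj: "inj_on (\<lambda>(d, c). (d * c, c)) (ndisc V \<times> ndisc U)"
    by (auto simp: inj_on_def ndisc_def gdisc_def)
  have "(\<Sum>d\<in>ndisc V. \<Sum>c\<in>ndisc U. gmangoldt c * G (d * c)) = (\<Sum>(d, c)\<in>ndisc V \<times> ndisc U. gmangoldt c * G (d * c))"
    by (simp add: sum.cartesian_product)
  also have "\<dots> = (\<Sum>(e, c)\<in>(\<lambda>(d, c). (d * c, c)) ` (ndisc V \<times> ndisc U). gmangoldt c * G e)"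
    by (subst sum.reindex[OF inj]) (auto intro!: sum.cong)
  also have "\<dots> \<le> (\<Sum>(e, c)\<in>Sigma (gdisc (U * V)) gdivisors. gmangoldt c * G e)"
  proof (rule sum_mono2)
    show "finite (Sigma (gdisc (U * V)) gdivisors)"
      by (intro finite_SigmaI finite_gdisc) (metis (mono_tags, lifting) finite_gdivisors gdisc_def mem_Collect_eq)
    show "(\<lambda>(d, c). (d * c, c)) ` (ndisc V \<times> ndisc U) \<subseteq> Sigma (gdisc (U * V)) gdivisors"
    proof clarsimp
      fix d c assume "d \<in> ndisc V" "c \<in> ndisc U"
      moreover from this have "gnorm d * gnorm c \<le> V * U"
        using assms by (intro mult_mono) (auto simp: ndisc_def gdisc_def)
      ultimately show "d * c \<in> gdisc (U * V) \<and> c \<in> gdivisors (d * c)"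
        by (auto simp: ndisc_def gdisc_def gdivisors_def gnorm_mult mult.commute)
    qed
  qed (auto simp: gmangoldt_nonneg G)
  also have "\<dots> = (\<Sum>e\<in>gdisc (U * V). \<Sum>c\<in>gdivisors e. gmangoldt c * G e)"
    by (rule sum.Sigma[symmetric]) (simp, metis (mono_tags, lifting) finite_gdivisors gdisc_def mem_Collect_eq)
  also have "\<dots> = (\<Sum>e\<in>gdisc (U * V). ln (gnorm e) * G e)"
    by (intro sum.cong refl) (auto simp: gdisc_def sum_gmangoldt_gdivisors sum_distrib_right[symmetric])
  finally show ?thesis .
qed

subsection \<open>Exponential sums over discs\<close>

text \<open>Up to 1/3 the cosine is at least 1/2, so the derivative pi cos (pi t) - 1 is nonnegative
  because pi > 3. Beyond 1/3 the sine is at least sqrt 3 / 2, which exceeds 1/2 and so t.\<close>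

lemma sin_pi_ge:
  assumes "0 \<le> t" "t \<le> 1 / 2"
  shows "t \<le> sin (pi * t)"
proof (cases "t \<le> 1 / 3")
  case True
  have "sin (pi * 0) - 0 \<le> sin (pi * t) - t"
  proof (rule DERIV_nonneg_imp_nondecreasing[where f = "\<lambda>t. sin (pi * t) - t"])
    show "0 \<le> t" by fact
    fix x assume x: "0 \<le> x" "x \<le> t"
    have "cos (pi / 3) \<le> cos (pi * x)" using x True by (intro cos_monotone_0_pi_le) (auto simp: field_simps)
    then have "cos (pi * x) \<ge> 1 / 2" by (simp add: cos_60)
    then have "pi * cos (pi * x) \<ge> 3 * (1 / 2)" using pi_gt3 by (intro mult_mono) auto
    then have "cos (pi * x) * pi - 1 \<ge> 0" by (simp add: mult.commute)
    moreover have "((\<lambda>t. sin (pi * t) - t) has_real_derivative cos (pi * x) * pi - 1) (at x)"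
      by (auto intro!: derivative_eq_intros)
    ultimately show "\<exists>y. ((\<lambda>t. sin (pi * t) - t) has_real_derivative y) (at x) \<and> 0 \<le> y" by blast
  qed
  then show ?thesis by simp
next
  case False
  then have "sin (pi / 3) \<le> sin (pi * t)" using assms by (intro sin_monotone_2pi_le) (auto simp: field_simps)
  moreover have "sqrt 1 \<le> sqrt 3" by (intro real_sqrt_le_mono) simp
  ultimately have "1 \<le> 2 * sin (pi * t)" unfolding sin_60 real_sqrt_one by linarith
  then show ?thesis using assms by simp
qed

lemma cis_2pi_int_shift: "cis (2 * pi * (u - of_int m)) = cis (2 * pi * u)"
  by (simp add: right_diff_distrib cis_divide[symmetric] cis_multiple_2pi)

lemma dist_nearest_int_nonneg [simp]: "dist_nearest_int u \<ge> 0"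
  by (simp add: dist_nearest_int_def)

lemma dist_nearest_int_le_half: "dist_nearest_int u \<le> 1 / 2"
  using of_int_round_abs_le[of u] by (simp add: dist_nearest_int_def abs_minus_commute)

lemma dist_nearest_int_le: "dist_nearest_int u \<le> \<bar>u - of_int m\<bar>"
  unfolding dist_nearest_int_def by (rule round_diff_minimal)

lemma dist_nearest_int_minus [simp]: "dist_nearest_int (- u) = dist_nearest_int u"
proof -
  have "dist_nearest_int (- u) \<le> dist_nearest_int u" for u
    using dist_nearest_int_le[of "- u" "- round u"] by (simp add: dist_nearest_int_def)
  from this[of u] this[of "- u"] show ?thesis by simp
qed

lemma cmod_cis_2pi_minus_1:
  "cmod (cis (2 * pi * u) - 1) \<ge> 2 * dist_nearest_int u"
proof -
  define t where "t = u - of_int (round u)"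
  have abst: "\<bar>t\<bar> = dist_nearest_int u" by (simp add: t_def dist_nearest_int_def)
  have "cmod (cis (2 * pi * u) - 1) = cmod (cis (2 * pi * t) - 1)"
    unfolding t_def by (subst cis_2pi_int_shift) simp
  also have "\<dots> = 2 * \<bar>sin (2 * pi * t / 2)\<bar>"
    unfolding cis_conv_exp using dist_exp_i_1[of "2 * pi * t"] by simp
  also have "\<bar>sin (2 * pi * t / 2)\<bar> = \<bar>sin (pi * \<bar>t\<bar>)\<bar>" by (cases "t \<ge> 0") simp_all
  also have "2 * \<dots> \<ge> 2 * \<bar>t\<bar>"
    using sin_pi_ge[of "\<bar>t\<bar>"] dist_nearest_int_le_half[of u] abst by simp
  finally show ?thesis using abst by simp
qed

text \<open>This is \<open>min T (1 / t)\<close>, with the value \<open>T\<close> at \<open>t = 0\<close>, where \<open>1 / t = 0\<close>.\<close>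

definition min_inverse :: "real \<Rightarrow> real \<Rightarrow> real" where
  "min_inverse T t = inverse (max (inverse T) t)"

lemma min_inverse_pos: "T > 0 \<Longrightarrow> min_inverse T t > 0"
  by (simp add: min_inverse_def less_max_iff_disj)

lemma min_inverse_le: "T > 0 \<Longrightarrow> min_inverse T t \<le> T"
  unfolding min_inverse_def by (metis inverse_inverse_eq le_imp_inverse_le max.cobounded1 positive_imp_inverse_positive)

lemma min_inverse_le_inverse: "t > 0 \<Longrightarrow> min_inverse T t \<le> inverse t"
  unfolding min_inverse_def by (intro le_imp_inverse_le) auto

lemma min_inverse_mono: "0 < T \<Longrightarrow> T \<le> T' \<Longrightarrow> min_inverse T t \<le> min_inverse T' t"
  unfolding min_inverse_def by (intro le_imp_inverse_le max.mono) (auto simp: less_max_iff_disj)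

lemma min_inverse_antimono: "0 < T \<Longrightarrow> t \<le> t' \<Longrightarrow> min_inverse T t' \<le> min_inverse T t"
  unfolding min_inverse_def by (intro le_imp_inverse_le max.mono) (auto simp: less_max_iff_disj)

text \<open>The second bound is stated as a product so that the case \<open>t = 0\<close> is
  included.\<close>

lemma le_kerI:
  assumes "T > 0" "x \<le> T" "x * t \<le> 1"
  shows "x \<le> min_inverse T t"
proof (cases "t \<le> inverse T")
  case True
  then show ?thesis using assms by (simp add: min_inverse_def max_def)
next
  case False
  then have "t > 0" using assms by (smt (verit) positive_imp_inverse_positive)
  then show ?thesis using assms False by (simp add: min_inverse_def max_def field_simps)
qed

text \<open>The geometric sum multiplied by \<open>z - 1\<close> telescopes to modulus at most 2,
  while \<open>z - 1\<close> has modulus at least twice the distance of \<open>u\<close> to the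
  integers.\<close>

lemma cmod_sum_cis_le:
  "cmod (\<Sum>a\<in>{A..B::int}. cis (2 * pi * (u * of_int a))) * dist_nearest_int u \<le> 1"
proof (cases "A \<le> B \<and> dist_nearest_int u > 0")
  case True
  define z where "z = cis (2 * pi * u)"
  define N where "N = nat (B - A + 1)"
  have z1: "cmod (z - 1) \<ge> 2 * dist_nearest_int u" unfolding z_def by (rule cmod_cis_2pi_minus_1)
  have "(\<Sum>a\<in>{A..B}. cis (2 * pi * (u * of_int a))) = (\<Sum>j<N. cis (2 * pi * (u * of_int A)) * z ^ j)"
  proof (rule sum.reindex_bij_witness[of _ "\<lambda>j. A + int j" "\<lambda>a. nat (a - A)"]; clarsimp?)
    fix a assume "A \<le> a" "a \<le> B"
    then show "nat (a - A) < N" by (auto simp: N_def)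
    have "u * of_int a = u * of_int A + u * real (nat (a - A))"
      using \<open>A \<le> a\<close> by (simp add: algebra_simps)
    then show "cis (2 * pi * (u * of_int A)) * z ^ nat (a - A) = cis (2 * pi * (u * of_int a))"
      by (simp add: z_def Complex.DeMoivre cis_mult algebra_simps)
  qed (use True in \<open>auto simp: N_def\<close>)
  also have "\<dots> * (z - 1) = cis (2 * pi * (u * of_int A)) * (z ^ N - 1)"
    unfolding sum_distrib_left[symmetric] power_diff_1_eq[of z N] by (simp only: mult_ac)
  finally have "cmod (\<Sum>a\<in>{A..B}. cis (2 * pi * (u * of_int a))) * cmod (z - 1) = cmod (z ^ N - 1)"
    by (metis norm_mult norm_cis mult_1)
  also have "\<dots> \<le> 2" using norm_triangle_ineq4[of "z ^ N" 1] by (simp add: z_def norm_power)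
  finally have "cmod (\<Sum>a\<in>{A..B}. cis (2 * pi * (u * of_int a))) * cmod (z - 1) \<le> 2" .
  moreover have "cmod (\<Sum>a\<in>{A..B}. cis (2 * pi * (u * of_int a))) * (2 * dist_nearest_int u)
      \<le> cmod (\<Sum>a\<in>{A..B}. cis (2 * pi * (u * of_int a))) * cmod (z - 1)"
    using z1 by (intro mult_left_mono) auto
  ultimately show ?thesis by simp
next
  case False
  then show ?thesis using dist_nearest_int_nonneg[of u] by (auto simp: not_less)
qed

section \<open>Sums of additive characters over discs\<close>

definition gchar :: "complex \<Rightarrow> gauss_int \<Rightarrow> complex" where
  "gchar \<beta> n = cis (2 * pi * Re (cx n * \<beta>))"

definition cdisc :: "real \<Rightarrow> gauss_int set" where
  "cdisc X = {n. gnorm n \<le> X}"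

lemma finite_cdisc [simp]: "finite (cdisc X)"
  unfolding cdisc_def by (rule finite_gnorm_le)

lemma norm_gchar [simp]: "cmod (gchar \<beta> n) = 1"
  by (simp add: gchar_def)

lemma gchar_0 [simp]: "gchar \<beta> 0 = 1"
  by (simp add: gchar_def)

text \<open>Cut the disc into horizontal rows. Each row is an interval of integers, and its sum is a
  geometric series in \<open>Re \<beta>\<close>; \<open>Im \<beta>\<close> contributes only a
  constant phase to the row. There are at most 3 sqrt X rows, each with at most 3 sqrt X
  terms.\<close>

lemma cmod_cdisc_sum_le_Re:
  assumes X: "X \<ge> 1"
  shows "cmod (\<Sum>n\<in>cdisc X. gchar \<beta> n) \<le> 3 * sqrt X * min_inverse (3 * sqrt X) (dist_nearest_int (Re \<beta>))"
proof -
  define B where "B = \<lfloor>sqrt X\<rfloor>"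
  define A where "A = (\<lambda>b::int. \<lfloor>sqrt (X - (of_int b)\<^sup>2)\<rfloor>)"
  have sq: "sqrt X \<ge> 1" using X by simp
  have B: "0 \<le> B" "of_int B \<le> sqrt X" using X by (auto simp: B_def)
  have iff: "gnorm (gauss_of a b) \<le> X \<longleftrightarrow> b \<in> {-B..B} \<and> a \<in> {-A b..A b}" for a b
  proof -
    have Bb: "b \<in> {-B..B} \<longleftrightarrow> (of_int b)\<^sup>2 \<le> X"
    proof -
      have "b \<in> {-B..B} \<longleftrightarrow> \<bar>b\<bar> \<le> B" by auto
      also have "\<dots> \<longleftrightarrow> \<bar>of_int b :: real\<bar> \<le> sqrt X" unfolding B_def le_floor_iff by simp
      also have "\<dots> \<longleftrightarrow> (of_int b)\<^sup>2 \<le> X" using X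
        by (metis abs_le_square_iff abs_of_nonneg order_trans real_sqrt_ge_zero real_sqrt_pow2 zero_le_one)
      finally show ?thesis .
    qed
    have Aa: "a \<in> {-A b..A b} \<longleftrightarrow> (of_int a)\<^sup>2 \<le> X - (of_int b)\<^sup>2" if "(of_int b)\<^sup>2 \<le> X"
    proof -
      have "a \<in> {-A b..A b} \<longleftrightarrow> \<bar>a\<bar> \<le> A b" by auto
      also have "\<dots> \<longleftrightarrow> \<bar>of_int a :: real\<bar> \<le> sqrt (X - (of_int b)\<^sup>2)" unfolding A_def le_floor_iff by simp
      also have "\<dots> \<longleftrightarrow> (of_int a)\<^sup>2 \<le> X - (of_int b)\<^sup>2" using that
        by (metis abs_le_square_iff abs_of_nonneg diff_ge_0_iff_ge real_sqrt_ge_zero real_sqrt_pow2)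
      finally show ?thesis .
    qed
    have "gnorm (gauss_of a b) \<le> X \<longleftrightarrow> (of_int a)\<^sup>2 \<le> X - (of_int b)\<^sup>2"
      unfolding gnorm_eq by (simp add: le_diff_eq)
    moreover have "(of_int b)\<^sup>2 \<le> X" if "(of_int a)\<^sup>2 \<le> X - (of_int b)\<^sup>2"
      using that zero_le_power2[of "of_int a :: real"] by linarith
    ultimately show ?thesis using Aa Bb by blast
  qed
  define row where "row = (\<lambda>b. \<Sum>a\<in>{-A b..A b}. cis (2 * pi * (Re \<beta> * of_int a)))"
  have "(\<Sum>n\<in>cdisc X. gchar \<beta> n) = (\<Sum>(b, a)\<in>(SIGMA b:{-B..B}. {-A b..A b}). gchar \<beta> (gauss_of a b))"
  proof (rule sum.reindex_bij_witness[of _ "\<lambda>(b, a). gauss_of a b" "\<lambda>n. (gim n, gre n)"])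
    fix n assume "n \<in> cdisc X"
    then show "(gim n, gre n) \<in> (SIGMA b:{-B..B}. {-A b..A b})"
      using iff[of "gre n" "gim n"] by (simp add: cdisc_def)
  next
    fix p assume "p \<in> (SIGMA b:{-B..B}. {-A b..A b})"
    then show "(case p of (b, a) \<Rightarrow> gauss_of a b) \<in> cdisc X"
      using iff by (auto simp: cdisc_def)
  qed auto
  also have "\<dots> = (\<Sum>b\<in>{-B..B}. \<Sum>a\<in>{-A b..A b}. gchar \<beta> (gauss_of a b))"
    by (rule sum.Sigma[symmetric]) auto
  also have "\<dots> = (\<Sum>b\<in>{-B..B}. cis (- (2 * pi * (Im \<beta> * of_int b))) * row b)"
    unfolding row_def sum_distrib_left
    by (intro sum.cong refl) (simp add: gchar_def cx_gauss_of cis_mult algebra_simps)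
  finally have "cmod (\<Sum>n\<in>cdisc X. gchar \<beta> n) \<le> (\<Sum>b\<in>{-B..B}. cmod (row b))"
    by (simp only:) (rule sum_norm_le, simp add: norm_mult)
  also have "\<dots> \<le> (\<Sum>b\<in>{-B..B}. min_inverse (3 * sqrt X) (dist_nearest_int (Re \<beta>)))"
  proof (rule sum_mono)
    fix b assume "b \<in> {-B..B}"
    show "cmod (row b) \<le> min_inverse (3 * sqrt X) (dist_nearest_int (Re \<beta>))"
    proof (rule le_kerI)
      have "A b \<le> B" unfolding A_def B_def by (intro floor_mono real_sqrt_le_mono) simp
      then have "card {-A b..A b} \<le> card {-B..B}" by (intro card_mono) auto
      moreover have "cmod (row b) \<le> real (card {-A b..A b})"
        unfolding row_def by (rule order_trans[OF norm_sum]) simp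
      moreover have "real (card {-B..B}) = 2 * of_int B + 1" using B by simp
      ultimately show "cmod (row b) \<le> 3 * sqrt X" using B(2) sq by linarith
      show "cmod (row b) * dist_nearest_int (Re \<beta>) \<le> 1"
        unfolding row_def by (rule cmod_sum_cis_le)
    qed (use X in auto)
  qed
  also have "\<dots> = (2 * of_int B + 1) * min_inverse (3 * sqrt X) (dist_nearest_int (Re \<beta>))"
    using B by simp
  also have "\<dots> \<le> 3 * sqrt X * min_inverse (3 * sqrt X) (dist_nearest_int (Re \<beta>))"
  proof (rule mult_right_mono)
    show "2 * of_int B + 1 \<le> 3 * sqrt X" using B(2) sq by linarith
    show "0 \<le> min_inverse (3 * sqrt X) (dist_nearest_int (Re \<beta>))" using X by (intro less_imp_le[OF min_inverse_pos]) auto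
  qed
  finally show ?thesis .
qed

text \<open>Multiplication by the imaginary unit permutes the disc and exchanges the roles of
  \<open>Re \<beta>\<close> and \<open>Im \<beta>\<close> up to sign, so columns may replace rows.
  The better of the two estimates involves the larger distance, which is
  \<open>gdist \<beta>\<close>.\<close>

lemma cmod_cdisc_sum_le:
  assumes X: "X \<ge> 1"
  shows "cmod (\<Sum>n\<in>cdisc X. gchar \<beta> n) \<le> 3 * sqrt X * min_inverse (3 * sqrt X) (gdist \<beta>)"
proof -
  define I where "I = gauss_of 0 1"
  have cxI: "cx I = \<i>" by (simp add: I_def cx_gauss_of complex_eq_iff)
  define J where "J = gauss_of 0 (- 1)"
  have cxJ: "cx J = - \<i>" by (simp add: J_def cx_gauss_of complex_eq_iff)
  have "I * J = 1" "J * I = 1"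
    by (subst cx_inject[symmetric], simp add: cxI cxJ)+
  then have IJ: "I * (J * n) = n" "J * (I * n) = n" for n
    unfolding mult.assoc[symmetric] by simp_all
  have "(\<Sum>n\<in>cdisc X. gchar \<beta> n) = (\<Sum>n\<in>cdisc X. gchar (\<i> * \<beta>) n)"
  proof (rule sum.reindex_bij_witness[of _ "\<lambda>n. I * n" "\<lambda>n. J * n"])
    show "gchar (\<i> * \<beta>) (J * n) = gchar \<beta> n" for n
      by (simp add: gchar_def cxJ)
    show "J * n \<in> cdisc X" if "n \<in> cdisc X" for n
      using that by (simp add: cdisc_def gauss_norm_def cxJ norm_mult)
    show "I * n \<in> cdisc X" if "n \<in> cdisc X" for n
      using that by (simp add: cdisc_def gauss_norm_def cxI norm_mult)
  qed (rule IJ)+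
  then have "cmod (\<Sum>n\<in>cdisc X. gchar \<beta> n) \<le> 3 * sqrt X * min_inverse (3 * sqrt X) (dist_nearest_int (Im \<beta>))"
    using cmod_cdisc_sum_le_Re[OF X, of "\<i> * \<beta>"] by simp
  then show ?thesis using cmod_cdisc_sum_le_Re[OF X, of \<beta>]
    unfolding dist_nearest_gauss_int_def by (auto simp: max_def)
qed

text \<open>Twice the bound for the full disc: the second half pays for the missing term at 0, as
  the bound is at least 1 because \<open>gdist \<beta> \<le> 1 / 2\<close>.\<close>

definition disc_bound :: "real \<Rightarrow> complex \<Rightarrow> real" where
  "disc_bound Z \<beta> = 6 * sqrt Z * min_inverse (3 * sqrt Z) (gdist \<beta>)"

lemma disc_bound_mono: "0 < Z \<Longrightarrow> Z \<le> Z' \<Longrightarrow> disc_bound Z \<beta> \<le> disc_bound Z' \<beta>"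
  unfolding disc_bound_def by (intro mult_mono min_inverse_mono) (auto intro!: less_imp_le[OF min_inverse_pos])

lemma disc_bound_nonneg: "0 < Z \<Longrightarrow> disc_bound Z \<beta> \<ge> 0"
  unfolding disc_bound_def by (intro mult_nonneg_nonneg) (auto intro!: less_imp_le[OF min_inverse_pos])

lemma disc_bound_le: "0 < Z \<Longrightarrow> disc_bound Z \<beta> \<le> 18 * Z"
proof -
  assume "0 < Z"
  then have "6 * sqrt Z * min_inverse (3 * sqrt Z) (gdist \<beta>) \<le> 6 * sqrt Z * (3 * sqrt Z)"
    by (intro mult_left_mono min_inverse_le) auto
  then show ?thesis using \<open>0 < Z\<close> by (simp add: disc_bound_def)
qed

lemma gdist_bounds:
  "0 \<le> gdist z" "gdist z \<le> 1 / 2"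
  using dist_nearest_int_le_half[of "Re z"] dist_nearest_int_le_half[of "Im z"]
  by (auto simp: dist_nearest_gauss_int_def le_max_iff_disj)

lemma cmod_gdisc_sum_le:
  assumes "0 < Z" "X \<le> Z"
  shows "cmod (\<Sum>n\<in>gdisc X. gchar \<beta> n) \<le> disc_bound Z \<beta>"
proof (cases "X \<ge> 1")
  case True
  have "cdisc X = insert 0 (gdisc X)" "0 \<notin> gdisc X" using True by (auto simp: cdisc_def gdisc_def)
  then have "(\<Sum>n\<in>gdisc X. gchar \<beta> n) = (\<Sum>n\<in>cdisc X. gchar \<beta> n) - 1" by simp
  then have "cmod (\<Sum>n\<in>gdisc X. gchar \<beta> n) \<le> cmod (\<Sum>n\<in>cdisc X. gchar \<beta> n) + 1"
    using norm_triangle_ineq4[of "\<Sum>n\<in>cdisc X. gchar \<beta> n" 1] by simp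
  also have "\<dots> \<le> 3 * sqrt X * min_inverse (3 * sqrt X) (gdist \<beta>) +
      3 * sqrt X * min_inverse (3 * sqrt X) (gdist \<beta>)"
  proof (intro add_mono cmod_cdisc_sum_le True)
    have "3 * sqrt X \<ge> 1" using real_sqrt_le_mono[OF True] by (simp only: real_sqrt_one)
    moreover have "1 \<le> min_inverse (3 * sqrt X) (gdist \<beta>)"
      using gdist_bounds[of \<beta>] \<open>3 * sqrt X \<ge> 1\<close> True by (intro le_kerI) auto
    ultimately have "1 * 1 \<le> (3 * sqrt X) * min_inverse (3 * sqrt X) (gdist \<beta>)"
      using True by (intro mult_mono) auto
    then show "1 \<le> 3 * sqrt X * min_inverse (3 * sqrt X) (gdist \<beta>)" by simp
  qed
  also have "\<dots> = disc_bound X \<beta>" by (simp add: disc_bound_def)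
  also have "\<dots> \<le> disc_bound Z \<beta>" using assms True by (intro disc_bound_mono) auto
  finally show ?thesis .
next
  case False
  then have "gdisc X = {}" using gnorm_ge_1 by (force simp: gdisc_def)
  then show ?thesis using disc_bound_nonneg[OF assms(1)] by simp
qed

lemma cmod_gdisc_diff_sum_le:
  assumes "0 < Z" "X \<le> Z"
  shows "cmod (\<Sum>n\<in>gdisc X - gdisc Y. gchar \<beta> n) \<le> 2 * disc_bound Z \<beta>"
proof -
  have *: "gdisc X - gdisc Y = gdisc X - gdisc (min X Y)" "gdisc (min X Y) \<subseteq> gdisc X"
    by (auto simp: gdisc_def)
  have "(\<Sum>n\<in>gdisc X - gdisc Y. gchar \<beta> n) = (\<Sum>n\<in>gdisc X. gchar \<beta> n) - (\<Sum>n\<in>gdisc (min X Y). gchar \<beta> n)"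
    unfolding *(1) by (rule sum_diff) (use *(2) in auto)
  then show ?thesis
    using cmod_gdisc_sum_le[OF assms, of \<beta>] cmod_gdisc_sum_le[of Z "min X Y" \<beta>] assms
      norm_triangle_ineq4[of "\<Sum>n\<in>gdisc X. gchar \<beta> n" "\<Sum>n\<in>gdisc (min X Y). gchar \<beta> n"]
    by (smt (verit) min.cobounded1)
qed

lemma ln_real_eq_sum: "n \<ge> 1 \<Longrightarrow> ln (real n) = (\<Sum>j=2..n. ln (real j) - ln (real (j - 1)))"
proof (induction n rule: nat_induct_at_least)
  case (Suc n)
  then show ?case by simp
qed simp

text \<open>Partial summation: \<open>ln (gnorm n)\<close> is the sum of the increments
  \<open>w j\<close> over 2 <= j <= N n, so the weighted sum is a nonnegative combination of
  unweighted sums over annuli, with total weight at most \<open>ln X\<close>.\<close>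

lemma cmod_ln_gdisc_sum_le:
  assumes "1 \<le> X" "X \<le> Z"
  shows "cmod (\<Sum>n\<in>gdisc X. of_real (ln (gnorm n)) * gchar \<beta> n) \<le> 2 * ln X * disc_bound Z \<beta>"
proof -
  define w where "w = (\<lambda>j. ln (real j) - ln (real (j - 1)))"
  define K where "K = nat \<lfloor>X\<rfloor>"
  have K: "K \<ge> 1" "real K \<le> X" using assms by (auto simp: K_def le_nat_iff le_floor_iff)
  have w: "w j \<ge> 0" if "j \<ge> 2" for j using that by (simp add: w_def)
  have "ln (gnorm n) = (\<Sum>j=2..K. if n \<notin> gdisc (real (j - 1)) then w j else 0)" if "n \<in> gdisc X" for n
  proof -
    obtain i where i: "gnorm n = real i" using gnorm_Nats Nats_cases by blast
    have n: "n \<noteq> 0" "gnorm n \<le> X" using that by (auto simp: gdisc_def)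
    then have "1 \<le> i" "i \<le> K" using i gnorm_ge_1[of n] by (auto simp: K_def le_nat_iff le_floor_iff)
    then have "ln (gnorm n) = (\<Sum>j\<in>{2..K} \<inter> {j. j \<le> i}. w j)"
      using i ln_real_eq_sum[of i] by (auto simp: w_def intro!: sum.cong)
    also have "\<dots> = (\<Sum>j=2..K. if j \<in> {j. j \<le> i} then w j else 0)"
      by (rule sum.inter_restrict) simp
    also have "\<dots> = (\<Sum>j=2..K. if n \<notin> gdisc (real (j - 1)) then w j else 0)"
      using n i by (intro sum.cong) (auto simp: gdisc_def)
    finally show ?thesis .
  qed
  then have "(\<Sum>n\<in>gdisc X. of_real (ln (gnorm n)) * gchar \<beta> n) =
     (\<Sum>n\<in>gdisc X. \<Sum>j=2..K. if n \<notin> gdisc (real (j - 1)) then w j * gchar \<beta> n else 0)"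
    by (intro sum.cong refl) (auto simp: sum_distrib_right intro!: sum.cong)
  also have "\<dots> = (\<Sum>j=2..K. \<Sum>n\<in>gdisc X. if n \<notin> gdisc (real (j - 1)) then w j * gchar \<beta> n else 0)"
    by (rule sum.swap)
  also have "\<dots> = (\<Sum>j=2..K. w j * (\<Sum>n\<in>gdisc X - gdisc (real (j - 1)). gchar \<beta> n))"
    by (intro sum.cong refl) (auto simp: sum_distrib_left Diff_eq sum.inter_restrict intro!: sum.cong)
  also have "cmod \<dots> \<le> (\<Sum>j=2..K. w j * (2 * disc_bound Z \<beta>))"
  proof (rule sum_norm_le)
    fix j assume "j \<in> {2..K}"
    then show "cmod (w j * (\<Sum>n\<in>gdisc X - gdisc (real (j - 1)). gchar \<beta> n)) \<le> w j * (2 * disc_bound Z \<beta>)"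
      unfolding norm_mult using w[of j] assms by (intro mult_mono cmod_gdisc_diff_sum_le) auto
  qed
  also have "\<dots> = ln (real K) * (2 * disc_bound Z \<beta>)"
    unfolding sum_distrib_right[symmetric] w_def by (subst ln_real_eq_sum[OF K(1)]) simp
  also have "\<dots> \<le> ln X * (2 * disc_bound Z \<beta>)"
    using K assms disc_bound_nonneg[of Z \<beta>] by (intro mult_right_mono) auto
  finally show ?thesis by simp
qed

lemma gdist_le:
  "gdist z \<le> max \<bar>Re z - of_int a\<bar> \<bar>Im z - of_int b\<bar>"
  unfolding dist_nearest_gauss_int_def by (intro max.mono dist_nearest_int_le)

text \<open>Plays the part of a denominator of a good approximation to \<theta>. Applied to
  differences, it separates modulo Z[i] the points \<open>cx k * \<theta>\<close> of any set of
  \<open>k\<close> whose mutual differences have norm below \<open>Q\<close>. Such a set can have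
  about Q points on a torus of area 1, so spacing of order Q^(-1/2) is the best possible.\<close>

definition well_spaced :: "complex \<Rightarrow> real \<Rightarrow> bool" where
  "well_spaced \<theta> Q \<longleftrightarrow> Q \<ge> 1 \<and> (\<forall>k. k \<noteq> 0 \<longrightarrow> gnorm k < Q \<longrightarrow> 1 / (3 * sqrt Q) \<le> gdist (cx k * \<theta>))"

subsection \<open>Existence of well-spaced moduli\<close>

definition nearest :: "complex \<Rightarrow> gauss_int" where
  "nearest z = gauss_of (round (Re z)) (round (Im z))"

text \<open>Euclidean distance instead of \<open>gdist\<close>, since it is scaled exactly when the
  approximation is multiplied by a Gaussian integer; this is used in the division argument
  below.\<close>

definition approx_error :: "complex \<Rightarrow> gauss_int \<Rightarrow> real" where
  "approx_error \<theta> k = cmod (cx k * \<theta> - cx (nearest (cx k * \<theta>)))"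

lemma approx_error_le: "approx_error \<theta> k \<le> cmod (cx k * \<theta> - cx b)"
proof -
  let ?z = "cx k * \<theta>"
  have "(Re ?z - of_int (round (Re ?z)))\<^sup>2 \<le> (Re ?z - of_int (gre b))\<^sup>2"
       "(Im ?z - of_int (round (Im ?z)))\<^sup>2 \<le> (Im ?z - of_int (gim b))\<^sup>2"
    unfolding abs_le_square_iff[symmetric] by (rule round_diff_minimal)+
  then show ?thesis
    unfolding approx_error_def nearest_def cx_gauss_of
    by (simp add: cmod_def) 
qed

lemma approx_error_le_dist: "approx_error \<theta> k \<le> sqrt 2 * gdist (cx k * \<theta>)"
proof -
  let ?z = "cx k * \<theta>" and ?d = "gdist (cx k * \<theta>)"
  have "\<bar>Re ?z - of_int (round (Re ?z))\<bar> \<le> \<bar>?d\<bar>" "\<bar>Im ?z - of_int (round (Im ?z))\<bar> \<le> \<bar>?d\<bar>"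
    by (auto simp: dist_nearest_gauss_int_def dist_nearest_int_def)
  then have "(Re ?z - of_int (round (Re ?z)))\<^sup>2 + (Im ?z - of_int (round (Im ?z)))\<^sup>2 \<le> 2 * ?d\<^sup>2"
    unfolding abs_le_square_iff by simp
  then have "approx_error \<theta> k \<le> sqrt (2 * ?d\<^sup>2)"
    unfolding approx_error_def nearest_def cx_gauss_of by (simp add: cmod_def)
  then show ?thesis using gdist_bounds by (simp add: real_sqrt_mult)
qed

lemma approx_error_pos:
  assumes "\<theta> \<notin> gauss_rats" "k \<noteq> 0"
  shows "approx_error \<theta> k > 0"
proof (rule ccontr)
  assume "\<not> approx_error \<theta> k > 0"
  moreover define b where "b = nearest (cx k * \<theta>)"
  ultimately have "cx k * \<theta> = cx b" by (simp add: approx_error_def)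
  then have "\<theta> = cx b / cx k" using assms by (simp add: field_simps)
  then have "Re \<theta> = of_int (gre b * gre k + gim b * gim k) / of_int ((gre k)\<^sup>2 + (gim k)\<^sup>2)"
      "Im \<theta> = of_int (gim b * gre k - gre b * gim k) / of_int ((gre k)\<^sup>2 + (gim k)\<^sup>2)"
    by (simp_all add: Re_divide Im_divide)
  then have "Re \<theta> \<in> \<rat>" "Im \<theta> \<in> \<rat>" by (metis Rats_divide Rats_of_int)+
  then obtain a b where "Re \<theta> = of_rat a" "Im \<theta> = of_rat b" by (auto elim!: Rats_cases)
  moreover have "of_rat r = complex_of_real (of_rat r)" for r
    by (cases r) (simp add: of_rat_rat)
  ultimately have "\<theta> = of_rat a + of_rat b * \<i>"
    by (simp add: complex_eq_iff)
  then show False using assms(1) by (auto simp: gauss_rats_def)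
qed

text \<open>Dirichlet's pigeonhole principle with rational integers: the M^2 + 1 multiples n\<theta>
  for 0 <= n <= M^2 fall into M^2 boxes of side 1 / M, and the difference of two in the same box has
  error below sqrt 2 / M.\<close>

lemma ex_approx_error_less:
  assumes "\<eta> > 0"
  shows "\<exists>k. k \<noteq> 0 \<and> approx_error \<theta> k < \<eta>"
proof -
  obtain M :: nat where M: "real M > sqrt 2 / \<eta>" "M > 0"
    using reals_Archimedean2[of "max 0 (sqrt 2 / \<eta>)"] by auto
  define f where "f = (\<lambda>n::nat. (\<lfloor>real M * frac (Re (of_nat n * \<theta>))\<rfloor>, \<lfloor>real M * frac (Im (of_nat n * \<theta>))\<rfloor>))"
  have "f n \<in> {0..<int M} \<times> {0..<int M}" for n
    using M by (auto simp: f_def floor_less_iff frac_lt_1)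
  then have "f ` {0..M * M} \<subseteq> {0..<int M} \<times> {0..<int M}" by blast
  then have "card (f ` {0..M * M}) \<le> card ({0..<int M} \<times> {0..<int M})" by (intro card_mono) auto
  then have "\<not> inj_on f {0..M * M}" using card_image[of f "{0..M * M}"] by auto
  then obtain m n where mn: "m < n" "f m = f n" by (auto simp: inj_on_def) (metis nat_neq_iff)
  define k where "k = gauss_of (int n - int m) 0"
  define b where "b = gauss_of (\<lfloor>Re (of_nat n * \<theta>)\<rfloor> - \<lfloor>Re (of_nat m * \<theta>)\<rfloor>) (\<lfloor>Im (of_nat n * \<theta>)\<rfloor> - \<lfloor>Im (of_nat m * \<theta>)\<rfloor>)"
  have floors: "\<bar>real M * x - real M * y\<bar> < 1" if "\<lfloor>real M * x\<rfloor> = \<lfloor>real M * y\<rfloor>" for x y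
    using that by linarith
  have "\<bar>real M * (frac (Re (of_nat n * \<theta>)) - frac (Re (of_nat m * \<theta>)))\<bar> < 1"
       "\<bar>real M * (frac (Im (of_nat n * \<theta>)) - frac (Im (of_nat m * \<theta>)))\<bar> < 1"
    using mn(2) unfolding right_diff_distrib by (auto simp: f_def intro!: floors)
  moreover have "Re (cx k * \<theta> - cx b) = frac (Re (of_nat n * \<theta>)) - frac (Re (of_nat m * \<theta>))"
      "Im (cx k * \<theta> - cx b) = frac (Im (of_nat n * \<theta>)) - frac (Im (of_nat m * \<theta>))"
    by (simp_all add: k_def b_def cx_gauss_of frac_def algebra_simps)
  ultimately have "\<bar>Re (of_nat M * (cx k * \<theta> - cx b))\<bar> < 1" "\<bar>Im (of_nat M * (cx k * \<theta> - cx b))\<bar> < 1"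
    by simp_all
  then have "(Re (of_nat M * (cx k * \<theta> - cx b)))\<^sup>2 < 1" "(Im (of_nat M * (cx k * \<theta> - cx b)))\<^sup>2 < 1"
    by (simp_all only: abs_square_less_1)
  then have "(cmod (of_nat M * (cx k * \<theta> - cx b)))\<^sup>2 < 2" unfolding cmod_power2 by linarith
  then have "real M * cmod (cx k * \<theta> - cx b) < sqrt 2"
    by (metis norm_mult norm_of_nat real_less_rsqrt)
  also have "\<dots> < real M * \<eta>" using M assms by (simp add: field_simps)
  finally have "cmod (cx k * \<theta> - cx b) < \<eta>" using M by simp
  then have "approx_error \<theta> k < \<eta>" using approx_error_le[of \<theta> k b] by linarith
  moreover have "k \<noteq> 0" using mn(1) cx_eq_0_iff[of k] by (simp add: k_def cx_gauss_of complex_eq_iff)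
  ultimately show ?thesis by blast
qed

text \<open>
  Let \<open>p\<close> minimise the error among the nonzero integers of norm at most \<open>K\<close>, and let \<open>q\<close> be an element of least norm with
  a smaller error. For the nearest Gaussian integers \<open>c\<close> and \<open>b\<close> to \<open>p\<theta>\<close> and \<open>q\<theta>\<close> the determinant \<open>q c - p b\<close>
  does not vanish, as otherwise division of \<open>q\<close> by \<open>p\<close> would contradict the choice of \<open>p\<close> or \<open>q\<close>. So
  the error of \<open>p\<close>, the least one below the norm of \<open>q\<close>, is at least \<open>1 / (2 |q|)\<close>.
\<close>

lemma ex_well_spaced_ge:
  assumes "\<theta> \<notin> gauss_rats"
  shows "\<exists>Q\<ge>K. well_spaced \<theta> Q"
proof -
  define K0 where "K0 = max K 1"
  have "gdisc K0 \<noteq> {}" by (auto simp: gdisc_def K0_def intro!: exI[of _ 1])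
  then obtain p where p: "p \<in> gdisc K0" "\<And>k. k \<in> gdisc K0 \<Longrightarrow> approx_error \<theta> p \<le> approx_error \<theta> k"
    using ex_is_arg_min_if_finite[of "gdisc K0" "approx_error \<theta>"] by (auto simp: is_arg_min_linorder)
  have p0: "p \<noteq> 0" using p by (auto simp: gdisc_def)
  define \<eta> where "\<eta> = approx_error \<theta> p"
  have \<eta>: "\<eta> > 0" unfolding \<eta>_def by (rule approx_error_pos[OF assms p0])
  obtain q where q: "q \<noteq> 0" "approx_error \<theta> q < \<eta>"
    and qmin: "\<And>k. k \<noteq> 0 \<Longrightarrow> approx_error \<theta> k < \<eta> \<Longrightarrow> euclidean_size q \<le> euclidean_size k"
    using ex_has_least_nat[of "\<lambda>k. k \<noteq> 0 \<and> approx_error \<theta> k < \<eta>" _ euclidean_size] ex_approx_error_less[OF \<eta>, of \<theta>] by metis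
  have eu: "real (euclidean_size k) = gnorm k" for k :: gauss_int
  proof -
    obtain j where "gnorm k = real j" using gnorm_Nats Nats_cases by blast
    then show ?thesis by (simp add: euclidean_size_gauss_int_def)
  qed
  have qmin': "\<eta> \<le> approx_error \<theta> k" if "k \<noteq> 0" "gnorm k < gnorm q" for k
    using qmin[OF that(1)] that(2) eu[of k] eu[of q] by (metis linorder_not_le of_nat_less_iff)
  have qK: "gnorm q > K0" using p(2)[of q] q by (force simp: gdisc_def \<eta>_def)
  then have pq: "cmod (cx p) \<le> cmod (cx q)"
    using p(1) gnorm_less_iff_sq[of p q] by (auto simp: gdisc_def)
  define b where "b = nearest (cx q * \<theta>)"
  define c where "c = nearest (cx p * \<theta>)"
  have eq: "approx_error \<theta> q = cmod (cx q * \<theta> - cx b)" "\<eta> = cmod (cx p * \<theta> - cx c)"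
    by (simp_all add: approx_error_def b_def c_def \<eta>_def)
  have "q * c \<noteq> p * b"
  proof
    assume det: "q * c = p * b"
    define s where "s = q div p"
    define r where "r = q mod p"
    have qsr: "q = s * p + r" by (simp add: s_def r_def)
    have "p * (b - s * c) = r * c" using det unfolding qsr by (simp add: algebra_simps)
    then have "cx p * (cx b - cx s * cx c) = cx r * cx c" by (metis cx_simps(4,6))
    then have "cx p * (cx r * \<theta> - (cx b - cx s * cx c)) = cx r * (cx p * \<theta> - cx c)"
      by (simp add: algebra_simps)
    \<comment> \<open>Division carries the approximation of \<open>p\<close> over to
      \<open>r\<close> with the error scaled by |r| / |p| < 1, although \<open>r\<close> lies in the
      disc where \<open>p\<close> has the least error. For \<open>r = 0\<close> it shows instead
      that the error of \<open>q\<close> is |s| times that of \<open>p\<close>.\<close>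
    then have err: "cmod (cx p) * cmod (cx r * \<theta> - (cx b - cx s * cx c)) = cmod (cx r) * \<eta>"
      unfolding eq by (metis norm_mult)
    show False
    proof (cases "r = 0")
      case True
      then have "s \<noteq> 0" using q qsr by auto
      have "cx b = cx s * cx c" using err True p0 by simp
      then have "cx q * \<theta> - cx b = cx s * (cx p * \<theta> - cx c)" using qsr True by (simp add: algebra_simps)
      then have "approx_error \<theta> q = cmod (cx s) * \<eta>" unfolding eq by (simp add: norm_mult)
      moreover have "cmod (cx s) \<ge> 1"
        using gnorm_ge_1[OF \<open>s \<noteq> 0\<close>] sqrt_gnorm[of s] by (metis real_sqrt_ge_one)
      ultimately have "approx_error \<theta> q \<ge> 1 * \<eta>" using \<eta> by (simp add: mult_right_mono)
      then show False using q by simp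
    next
      case False
      have rp: "cmod (cx r) < cmod (cx p)" unfolding r_def by (rule cmod_mod_less[OF p0])
      then have "r \<in> gdisc K0" using False p(1) gnorm_less_iff_sq[of r p] by (auto simp: gdisc_def)
      then have "\<eta> \<le> approx_error \<theta> r" using p(2) by (simp add: \<eta>_def)
      also have "\<dots> \<le> cmod (cx r * \<theta> - (cx b - cx s * cx c))" using approx_error_le[of \<theta> r "b - s * c"] by simp
      finally have "cmod (cx p) * \<eta> \<le> cmod (cx r) * \<eta>" unfolding err[symmetric] by (simp add: mult_left_mono)
      then show False using rp \<eta> by simp
    qed
  qed
  then have "gnorm (q * c - p * b) \<ge> 1" by (intro gnorm_ge_1) simp
  then have "1 \<le> cmod (cx (q * c - p * b))" by (metis real_sqrt_ge_one sqrt_gnorm)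
  also have "cx (q * c - p * b) = cx p * (cx q * \<theta> - cx b) - cx q * (cx p * \<theta> - cx c)"
    by (simp add: algebra_simps)
  also have "cmod \<dots> \<le> cmod (cx p) * approx_error \<theta> q + cmod (cx q) * \<eta>"
    unfolding eq norm_mult[symmetric] by (rule norm_triangle_ineq4)
  also have "\<dots> \<le> cmod (cx q) * \<eta> + cmod (cx q) * \<eta>"
    using pq q \<eta> by (intro add_mono mult_mono) (auto simp: approx_error_def)
  finally have main: "1 \<le> 2 * sqrt (gnorm q) * \<eta>" by (simp add: sqrt_gnorm mult_ac)
  have "well_spaced \<theta> (gnorm q)"
    unfolding well_spaced_def
  proof (intro conjI allI impI)
    show "1 \<le> gnorm q" using gnorm_ge_1 q by simp
    fix k assume k: "k \<noteq> 0" "gnorm k < gnorm q"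
    define S where "S = sqrt (gnorm q)"
    define D where "D = gdist (cx k * \<theta>)"
    have S: "S > 0" using q gnorm_pos by (simp add: S_def)
    have "\<eta> \<le> sqrt 2 * D" using qmin'[OF k] approx_error_le_dist[of \<theta> k] by (simp add: D_def)
    \<comment> \<open>Passing from Euclidean to supremum distance costs sqrt 2 <= 3/2, and 2 * (3/2)
      is the 3 in \<open>well_spaced\<close>.\<close>
    also have "\<dots> \<le> (3 / 2) * D"
    proof (rule mult_right_mono)
      show "sqrt 2 \<le> 3 / 2" by (rule real_le_lsqrt) (auto simp: power2_eq_square)
    qed (simp add: D_def gdist_bounds)
    finally have "2 * S * \<eta> \<le> 2 * S * ((3 / 2) * D)" using S by (intro mult_left_mono) auto
    then have "1 \<le> 3 * S * D" using main by (simp add: S_def mult_ac)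
    then show "1 / (3 * sqrt (gnorm q)) \<le> gdist (cx k * \<theta>)"
      using S by (simp add: field_simps S_def D_def)
  qed
  then show ?thesis using qK by (intro exI[of _ "gnorm q"]) (auto simp: K0_def)
qed

subsection \<open>Sums over spaced points\<close>

text \<open>One factor 2 comes from choosing which coordinate attains the maximum, the other from
  its sign; the second coordinate then has \<open>2 * r + 1\<close> values.\<close>

lemma sum_pairs_max_le:
  fixes f :: "nat \<Rightarrow> real"
  assumes f: "\<And>r. f r \<ge> 0"
  shows "(\<Sum>(i, j)\<in>{-int R..int R} \<times> {-int R..int R}. f (nat (max \<bar>i\<bar> \<bar>j\<bar>))) \<le>
    4 * (\<Sum>r\<le>R. real (2 * r + 1) * f r)"
proof -
  let ?I = "{-int R..int R}"
  have half: "(\<Sum>i\<in>?I. \<Sum>j\<in>?I. if \<bar>j\<bar> \<le> \<bar>i\<bar> then f (nat \<bar>i\<bar>) else 0) \<le> 2 * (\<Sum>r\<le>R. real (2 * r + 1) * f r)"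
  proof -
    have "(\<Sum>j\<in>?I. if \<bar>j\<bar> \<le> \<bar>i\<bar> then f (nat \<bar>i\<bar>) else 0) = real (2 * nat \<bar>i\<bar> + 1) * f (nat \<bar>i\<bar>)" if "i \<in> ?I" for i
    proof -
      have "(\<Sum>j\<in>?I. if \<bar>j\<bar> \<le> \<bar>i\<bar> then f (nat \<bar>i\<bar>) else 0) = (\<Sum>j\<in>{-\<bar>i\<bar>..\<bar>i\<bar>}. f (nat \<bar>i\<bar>))"
        using that by (intro sum.mono_neutral_cong_right) auto
      then show ?thesis by (simp add: nat_add_distrib)
    qed
    then have "(\<Sum>i\<in>?I. \<Sum>j\<in>?I. if \<bar>j\<bar> \<le> \<bar>i\<bar> then f (nat \<bar>i\<bar>) else 0) =
        (\<Sum>i\<in>?I. real (2 * nat \<bar>i\<bar> + 1) * f (nat \<bar>i\<bar>))" by (intro sum.cong) auto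
    also have "\<dots> \<le> (\<Sum>i\<in>int ` {..R} \<union> (\<lambda>r. - int r) ` {..R}. real (2 * nat \<bar>i\<bar> + 1) * f (nat \<bar>i\<bar>))"
    proof (rule sum_mono2)
      show "?I \<subseteq> int ` {..R} \<union> (\<lambda>r. - int r) ` {..R}"
      proof
        fix i assume "i \<in> ?I"
        then have "i = int (nat \<bar>i\<bar>) \<or> i = - int (nat \<bar>i\<bar>)" "nat \<bar>i\<bar> \<le> R" by auto
        then show "i \<in> int ` {..R} \<union> (\<lambda>r. - int r) ` {..R}" by blast
      qed
    qed (auto simp: f)
    also have "\<dots> \<le> (\<Sum>i\<in>int ` {..R}. real (2 * nat \<bar>i\<bar> + 1) * f (nat \<bar>i\<bar>)) +
        (\<Sum>i\<in>(\<lambda>r. - int r) ` {..R}. real (2 * nat \<bar>i\<bar> + 1) * f (nat \<bar>i\<bar>))"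
      by (subst sum.union_inter[symmetric]) (auto intro!: sum_nonneg simp: f)
    also have "\<dots> = 2 * (\<Sum>r\<le>R. real (2 * r + 1) * f r)"
      by (subst (1 2) sum.reindex) (auto simp: inj_on_def)
    finally show ?thesis .
  qed
  have "(\<Sum>(i, j)\<in>?I \<times> ?I. f (nat (max \<bar>i\<bar> \<bar>j\<bar>))) = (\<Sum>i\<in>?I. \<Sum>j\<in>?I. f (nat (max \<bar>i\<bar> \<bar>j\<bar>)))"
    by (rule sum.cartesian_product[symmetric])
  also have "\<dots> \<le> (\<Sum>i\<in>?I. \<Sum>j\<in>?I. (if \<bar>j\<bar> \<le> \<bar>i\<bar> then f (nat \<bar>i\<bar>) else 0) + (if \<bar>i\<bar> \<le> \<bar>j\<bar> then f (nat \<bar>j\<bar>) else 0))"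
    by (intro sum_mono) (auto simp: f max_def)
  also have "\<dots> = (\<Sum>i\<in>?I. \<Sum>j\<in>?I. if \<bar>j\<bar> \<le> \<bar>i\<bar> then f (nat \<bar>i\<bar>) else 0) +
      (\<Sum>j\<in>?I. \<Sum>i\<in>?I. if \<bar>i\<bar> \<le> \<bar>j\<bar> then f (nat \<bar>j\<bar>) else 0)"
    unfolding sum.distrib by (rule arg_cong2[where f = "(+)"], rule refl, rule sum.swap)
  finally show ?thesis using half by linarith
qed

text \<open>The innermost frames r = 0 and r = 1 reach the origin and get the trivial bound, with
  weights 1 + 3 = 4. From r = 2 on, (2r + 1) / (r - 1) <= 5 makes every frame cost at most 5 / s,
  and there are at most 1 / s frames.\<close>

lemma sum_min_inverse_grid_le:
  assumes s: "0 < s" "s \<le> 1 / 2" and X: "X > 0"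
  defines "R \<equiv> nat \<lceil>1 / (2 * s)\<rceil>"
  shows "(\<Sum>r\<le>R. real (2 * r + 1) * min_inverse X (s * (real r - 1))) \<le> 4 * X + 5 / s\<^sup>2"
proof -
  let ?g = "\<lambda>r. real (2 * r + 1) * min_inverse X (s * (real r - 1))"
  have R: "real R \<le> 1 / s"
  proof -
    have "real R \<le> 1 / (2 * s) + 1" using s by (simp add: R_def)
    moreover have "1 \<le> 1 / (2 * s)" using s by (simp add: field_simps)
    moreover have "1 / (2 * s) + 1 / (2 * s) = 1 / s" using s by (simp add: field_simps)
    ultimately show ?thesis by linarith
  qed
  have "(\<Sum>r\<le>R. ?g r) \<le> (\<Sum>r\<in>{0, 1} \<union> {2..R}. ?g r)"
    using X by (intro sum_mono2) (auto intro!: mult_nonneg_nonneg less_imp_le[OF min_inverse_pos])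
  also have "\<dots> = (\<Sum>r\<in>{0, 1}. ?g r) + (\<Sum>r=2..R. ?g r)" by (rule sum.union_disjoint) auto
  also have "(\<Sum>r\<in>{0, 1}. ?g r) \<le> 4 * X"
    using min_inverse_le[OF X, of "- s"] min_inverse_le[OF X, of 0] by simp
  also have "(\<Sum>r=2..R. ?g r) \<le> (\<Sum>r=2..R. 5 / s)"
  proof (rule sum_mono)
    fix r assume "r \<in> {2..R}"
    then have r: "real r \<ge> 2" by simp
    have "?g r \<le> real (2 * r + 1) * inverse (s * (real r - 1))"
      using r s by (intro mult_left_mono min_inverse_le_inverse) auto
    also have "\<dots> = (real (2 * r + 1) / (real r - 1)) / s" by (simp add: field_simps)
    also have "\<dots> \<le> 5 / s" using r s by (intro divide_right_mono) (auto simp: field_simps)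
    finally show "?g r \<le> 5 / s" .
  qed
  also have "\<dots> \<le> real R * (5 / s)" using s by (simp add: mult_right_mono divide_right_mono)
  also have "\<dots> \<le> (1 / s) * (5 / s)" using R s by (intro mult_right_mono) auto
  also have "\<dots> = 5 / s\<^sup>2" by (simp add: power2_eq_square)
  finally show ?thesis by simp
qed

text \<open>Reduce the points modulo Z[i] to the unit square around 0 and cut it by a grid of side
  \<open>s\<close>. The cells are half open, so two points of one cell are at distance strictly less
  than \<open>s\<close>; hence each cell holds at most one point. A point with largest cell index r
  in modulus is only known to be at distance s (r - 1), since the floor moves negative coordinates
  outwards.\<close>

lemma sum_min_inverse_spaced_le:
  assumes s: "0 < s" "s \<le> 1 / 2" and X: "X > 0" and "finite S"
    and spaced: "\<And>k l. k \<in> S \<Longrightarrow> l \<in> S \<Longrightarrow> k \<noteq> l \<Longrightarrow> s \<le> gdist (cx (k - l) * \<theta>)"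
  shows "(\<Sum>k\<in>S. min_inverse X (gdist (cx k * \<theta>))) \<le> 16 * X + 20 / s\<^sup>2"
proof -
  define u where "u = (\<lambda>k. Re (cx k * \<theta>) - of_int (round (Re (cx k * \<theta>))))"
  define v where "v = (\<lambda>k. Im (cx k * \<theta>) - of_int (round (Im (cx k * \<theta>))))"
  define F where "F = (\<lambda>k. (\<lfloor>u k / s\<rfloor>, \<lfloor>v k / s\<rfloor>))"
  define R where "R = nat \<lceil>1 / (2 * s)\<rceil>"
  define f where "f = (\<lambda>r::nat. min_inverse X (s * (real r - 1)))"
  have dist: "gdist (cx k * \<theta>) = max \<bar>u k\<bar> \<bar>v k\<bar>" for k
    by (simp add: dist_nearest_gauss_int_def dist_nearest_int_def u_def v_def)
  have inj: "inj_on F S"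
  proof (rule inj_onI, rule ccontr)
    fix k l assume kl: "k \<in> S" "l \<in> S" "F k = F l" "k \<noteq> l"
    have "\<bar>u k / s - u l / s\<bar> < 1" "\<bar>v k / s - v l / s\<bar> < 1" using kl(3) unfolding F_def prod.inject by linarith+
    then have "\<bar>u k - u l\<bar> < s" "\<bar>v k - v l\<bar> < s"
      using s by (simp_all add: diff_divide_distrib[symmetric] abs_divide)
    moreover have "gdist (cx (k - l) * \<theta>) \<le> max \<bar>u k - u l\<bar> \<bar>v k - v l\<bar>"
      using gdist_le[of "cx (k - l) * \<theta>"
          "round (Re (cx k * \<theta>)) - round (Re (cx l * \<theta>))" "round (Im (cx k * \<theta>)) - round (Im (cx l * \<theta>))"]
      by (simp add: u_def v_def algebra_simps)
    ultimately show False using spaced[OF kl(1,2,4)] by simp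
  qed
  have range: "\<lfloor>x / s\<rfloor> \<in> {-int R..int R}" if "\<bar>x\<bar> \<le> 1 / 2" for x
  proof -
    have "\<bar>x / s\<bar> \<le> (1 / 2) / s" unfolding abs_divide using divide_right_mono[OF that, of s] s by simp
    also have "\<dots> \<le> real R" by (simp add: R_def) linarith
    finally have *: "\<bar>x / s\<bar> \<le> real R" .
    then have "\<lfloor>x / s\<rfloor> \<ge> - int R" "\<lfloor>x / s\<rfloor> \<le> int R" unfolding le_floor_iff floor_le_iff by (simp_all only: of_int_minus of_int_of_nat_eq)
    then show ?thesis by simp
  qed
  have "\<bar>u k\<bar> \<le> 1 / 2" "\<bar>v k\<bar> \<le> 1 / 2" for k
    using gdist_bounds(2)[of "cx k * \<theta>"] unfolding dist by simp_all
  then have sub: "F ` S \<subseteq> {-int R..int R} \<times> {-int R..int R}"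
    unfolding F_def using range by blast
  have lower: "s * (real_of_int \<bar>\<lfloor>x / s\<rfloor>\<bar> - 1) \<le> \<bar>x\<bar>" for x
  proof -
    have "real_of_int \<bar>\<lfloor>x / s\<rfloor>\<bar> - 1 \<le> \<bar>x / s\<bar>" by linarith
    also have "\<bar>x / s\<bar> = \<bar>x\<bar> / s" using s by simp
    finally show ?thesis using s by (simp add: field_simps)
  qed
  have "(\<Sum>k\<in>S. min_inverse X (gdist (cx k * \<theta>))) \<le> (\<Sum>k\<in>S. case F k of (i, j) \<Rightarrow> f (nat (max \<bar>i\<bar> \<bar>j\<bar>)))"
  proof (rule sum_mono)
    fix k assume "k \<in> S"
    have "s * (real (nat (max \<bar>\<lfloor>u k / s\<rfloor>\<bar> \<bar>\<lfloor>v k / s\<rfloor>\<bar>)) - 1) \<le> max \<bar>u k\<bar> \<bar>v k\<bar>"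
      using lower[of "u k"] lower[of "v k"] by (auto simp: max_def split: if_splits)
    then show "min_inverse X (gdist (cx k * \<theta>)) \<le> (case F k of (i, j) \<Rightarrow> f (nat (max \<bar>i\<bar> \<bar>j\<bar>)))"
      unfolding dist F_def f_def prod.case using X by (intro min_inverse_antimono)
  qed
  also have "\<dots> = (\<Sum>(i, j)\<in>F ` S. f (nat (max \<bar>i\<bar> \<bar>j\<bar>)))"
    by (subst sum.reindex[OF inj]) simp
  also have "\<dots> \<le> (\<Sum>(i, j)\<in>{-int R..int R} \<times> {-int R..int R}. f (nat (max \<bar>i\<bar> \<bar>j\<bar>)))"
    using sub X by (intro sum_mono2) (auto simp: f_def intro!: less_imp_le[OF min_inverse_pos])
  also have "\<dots> \<le> 4 * (\<Sum>r\<le>R. real (2 * r + 1) * f r)"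
    using X by (intro sum_pairs_max_le) (auto simp: f_def intro!: less_imp_le[OF min_inverse_pos])
  also have "(\<Sum>r\<le>R. real (2 * r + 1) * f r) \<le> 4 * X + 5 / s\<^sup>2"
    unfolding R_def f_def by (rule sum_min_inverse_grid_le[OF s X])
  finally show ?thesis by simp
qed

lemma well_spacedD:
  assumes "well_spaced \<theta> Q" "k \<noteq> 0" "gnorm k < Q"
  shows "1 / (3 * sqrt Q) \<le> gdist (cx k * \<theta>)"
  using assms by (auto simp: well_spaced_def)

section \<open>The points \<open>cx k * \<theta>\<close> with \<open>k\<close> in a disc\<close>

definition cell :: "real \<Rightarrow> gauss_int \<Rightarrow> int \<times> int" where
  "cell Q k = (\<lfloor>2 * of_int (gre k) / sqrt Q\<rfloor>, \<lfloor>2 * of_int (gim k) / sqrt Q\<rfloor>)"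

text \<open>Explains the side sqrt Q / 2 of the cells: it is short enough for
  \<open>well_spaced\<close> to apply to the difference of any two points in one cell.\<close>

lemma cell_eq_imp_close:
  assumes "Q > 0" "cell Q k = cell Q l"
  shows "gnorm (k - l) < Q"
proof -
  have *: "(x - y)\<^sup>2 < Q / 2" if "\<lfloor>2 * x / sqrt Q\<rfloor> = \<lfloor>2 * y / sqrt Q\<rfloor>" for x y
  proof -
    have "\<bar>2 * x / sqrt Q - 2 * y / sqrt Q\<bar> < 1" using that by linarith
    then have "\<bar>x - y\<bar> < sqrt Q / 2"
      using assms(1) by (auto simp: diff_divide_distrib[symmetric] field_simps abs_if split: if_splits)
    then have "\<bar>x - y\<bar>\<^sup>2 < (sqrt Q / 2)\<^sup>2" by (intro power_strict_mono) auto
    then show ?thesis using assms(1) by (simp add: power_divide)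
  qed
  show ?thesis
    using *[of "of_int (gre k)" "of_int (gre l)"] *[of "of_int (gim k)" "of_int (gim l)"] assms(2)
    by (simp add: gnorm_eq cell_def)
qed

lemma sum_min_inverse_cell_le:
  assumes well_spaced: "well_spaced \<theta> Q" and X: "X > 0" and "finite S"
    and "\<And>k l. k \<in> S \<Longrightarrow> l \<in> S \<Longrightarrow> cell Q k = cell Q l"
  shows "(\<Sum>k\<in>S. min_inverse X (gdist (cx k * \<theta>))) \<le> 16 * X + 180 * Q"
proof -
  have Q: "Q \<ge> 1" using well_spaced by (simp add: well_spaced_def)
  then have "sqrt 1 \<le> sqrt Q" by (intro real_sqrt_le_mono)
  then have "sqrt Q \<ge> 1" by simp
  then have "(\<Sum>k\<in>S. min_inverse X (gdist (cx k * \<theta>))) \<le> 16 * X + 20 / (1 / (3 * sqrt Q))\<^sup>2"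
  proof (intro sum_min_inverse_spaced_le X)
    show "1 / (3 * sqrt Q) \<le> gdist (cx (k - l) * \<theta>)" if "k \<in> S" "l \<in> S" "k \<noteq> l" for k l
      using that assms(4)[of k l] Q by (intro well_spacedD[OF well_spaced] cell_eq_imp_close) auto
    show "1 / (3 * sqrt Q) \<le> 1 / 2" using \<open>sqrt Q \<ge> 1\<close> by (intro divide_left_mono) (linarith, simp_all)
  qed (use \<open>sqrt Q \<ge> 1\<close> assms(3) in \<open>simp_all\<close>)
  also have "20 / (1 / (3 * sqrt Q))\<^sup>2 = 180 * Q" using Q by (simp add: power_divide power_mult_distrib)
  finally show ?thesis .
qed

lemma sum_min_inverse_gdisc_le_aux:
  assumes well_spaced: "well_spaced \<theta> Q" and X: "X > 0" and "finite S" "finite T" "cell Q ` S \<subseteq> T"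
  shows "(\<Sum>k\<in>S. min_inverse X (gdist (cx k * \<theta>))) \<le> real (card T) * (16 * X + 180 * Q)"
proof -
  have "(\<Sum>k\<in>S. min_inverse X (gdist (cx k * \<theta>))) =
      (\<Sum>t\<in>T. \<Sum>k\<in>{k \<in> S. cell Q k = t}. min_inverse X (gdist (cx k * \<theta>)))"
    by (rule sum.group[symmetric]) (use assms in auto)
  also have "\<dots> \<le> (\<Sum>t\<in>T. 16 * X + 180 * Q)"
    by (intro sum_mono sum_min_inverse_cell_le[OF well_spaced X]) (use assms in auto)
  finally show ?thesis by simp
qed

text \<open>The disc is covered by about K / Q cells. The four cells at the origin are treated
  apart: their nonzero points have norm below \<open>Q\<close>, so \<open>well_spaced\<close>
  applies to \<open>k\<close> itself and \<open>X\<close> may be replaced by 3 sqrt Q. Bounding them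
  like the others would leave a term of size X even for small \<open>K\<close>, where only K X / Q
  is affordable.\<close>

lemma sum_min_inverse_gdisc_le:
  assumes well_spaced: "well_spaced \<theta> Q" and X: "X > 0" and K: "K \<ge> 0"
  shows "(\<Sum>k\<in>gdisc K. min_inverse X (gdist (cx k * \<theta>))) \<le> 12000 * (Q + K + K * X / Q)"
proof -
  let ?f = "\<lambda>k. min_inverse X (gdist (cx k * \<theta>))"
  have Q: "Q \<ge> 1" using well_spaced by (simp add: well_spaced_def)
  then have sQ: "sqrt Q > 0" by simp
  define N where "N = {k. k \<noteq> 0 \<and> cell Q k \<in> {-1, 0} \<times> {-1, 0}}"
  have near: "k \<noteq> 0 \<and> gnorm k < Q" if "k \<in> N" for k
  proof -
    have *: "x\<^sup>2 \<le> Q / 4" if "\<lfloor>2 * x / sqrt Q\<rfloor> \<in> {-1, 0}" for x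
    proof -
      have "\<bar>2 * x / sqrt Q\<bar> \<le> 1" using that by simp linarith
      then have "\<bar>x\<bar> \<le> sqrt Q / 2" using sQ by (simp add: field_simps abs_mult)
      then have "\<bar>x\<bar>\<^sup>2 \<le> (sqrt Q / 2)\<^sup>2" by (intro power_mono) auto
      then show ?thesis using Q by (simp add: power_divide)
    qed
    show ?thesis using that *[of "of_int (gre k)"] *[of "of_int (gim k)"] Q
      by (auto simp: N_def cell_def gnorm_eq)
  qed
  have "(\<Sum>k\<in>gdisc K \<inter> N. ?f k) \<le>
      (\<Sum>k\<in>gdisc K \<inter> N. min_inverse (3 * sqrt Q) (gdist (cx k * \<theta>)))"
  proof (rule sum_mono)
    fix k assume "k \<in> gdisc K \<inter> N"
    then have "1 / (3 * sqrt Q) \<le> gdist (cx k * \<theta>)" using near by (intro well_spacedD[OF well_spaced]) auto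
    then have "inverse (3 * sqrt Q) \<le> gdist (cx k * \<theta>)" "gdist (cx k * \<theta>) > 0"
      using sQ by (auto simp: inverse_eq_divide intro: less_le_trans[rotated])
    then show "?f k \<le> min_inverse (3 * sqrt Q) (gdist (cx k * \<theta>))"
      using min_inverse_le_inverse by (simp add: min_inverse_def max_absorb2)
  qed
  also have "\<dots> \<le> real (card ({-1, 0 :: int} \<times> {-1, 0 :: int})) * (16 * (3 * sqrt Q) + 180 * Q)"
    using sQ by (intro sum_min_inverse_gdisc_le_aux[OF well_spaced]) (auto simp: N_def)
  also have "\<dots> \<le> 912 * Q"
  proof -
    have "sqrt Q \<le> Q" using Q by (intro real_le_lsqrt) (auto simp: power2_eq_square)
    then show ?thesis by simp
  qed
  finally have 1: "(\<Sum>k\<in>gdisc K \<inter> N. ?f k) \<le> 912 * Q" .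
  have 2: "(\<Sum>k\<in>gdisc K - N. ?f k) \<le> (64 * K / Q) * (16 * X + 180 * Q)"
  \<comment> \<open>In this case both coordinates are below sqrt Q / 2 in modulus, so the disc lies
    inside the four central cells.\<close>
  proof (cases "K < Q / 4")
    case True
    have "gdisc K - N = {}"
    proof (rule ccontr)
      assume "gdisc K - N \<noteq> {}"
      then obtain k where k: "k \<in> gdisc K" "k \<notin> N" by blast
      have "sqrt K < sqrt (Q / 4)" using True by (rule real_sqrt_less_mono)
      then have K: "2 * sqrt K < sqrt Q" by (simp add: real_sqrt_divide)
      have *: "\<lfloor>2 * of_int a / sqrt Q\<rfloor> \<in> {-1, 0}" if "real_of_int \<bar>a\<bar> \<le> sqrt K" for a
      proof -
        have "\<bar>2 * real_of_int a / sqrt Q\<bar> < 1" using that K sQ by (simp add: abs_mult)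
        then show ?thesis unfolding insert_iff floor_eq_iff by (simp only: of_int_minus of_int_1 of_int_0 empty_iff simp_thms) linarith
      qed
      then have "cell Q k \<in> {-1, 0} \<times> {-1, 0}"
        unfolding cell_def using gnorm_le_bounds[of k K] k by (intro SigmaI *) (simp_all add: gdisc_def)
      then show False using k by (auto simp: N_def gdisc_def)
    qed
    then have "(\<Sum>k\<in>gdisc K - N. ?f k) = 0"
      by (simp only: sum.empty)
    also have "\<dots> \<le> (64 * K / Q) * (16 * X + 180 * Q)"
      using K X Q by (intro mult_nonneg_nonneg divide_nonneg_nonneg) auto
    finally show ?thesis .
  next
    case False
    define m where "m = 2 * sqrt K / sqrt Q"
    have "sqrt (Q / 4) \<le> sqrt K" using False by (intro real_sqrt_le_mono) simp
    then have m: "m \<ge> 1" using sQ by (simp add: m_def field_simps real_sqrt_divide)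
    have msq: "m\<^sup>2 = 4 * K / Q" using K Q by (simp add: m_def power_divide power_mult_distrib)
    let ?I = "{\<lfloor>- m\<rfloor>..\<lfloor>m\<rfloor>}"
    have "real (card ?I) \<le> 2 * m + 2" using m by simp linarith
    then have card: "real (card ?I) \<le> 4 * m" using m by linarith
    have "(\<Sum>k\<in>gdisc K - N. ?f k) \<le> real (card (?I \<times> ?I)) * (16 * X + 180 * Q)"
    proof (rule sum_min_inverse_gdisc_le_aux[OF well_spaced X])
      have *: "\<lfloor>2 * of_int a / sqrt Q\<rfloor> \<in> ?I" if "real_of_int \<bar>a\<bar> \<le> sqrt K" for a
      proof -
        have "\<bar>2 * real_of_int a / sqrt Q\<bar> \<le> m" unfolding m_def using that sQ by (simp add: abs_mult divide_right_mono)
        then have "- m \<le> 2 * real_of_int a / sqrt Q" "2 * real_of_int a / sqrt Q \<le> m" by linarith+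
        then show ?thesis by (simp add: floor_mono)
      qed
      show "cell Q ` (gdisc K - N) \<subseteq> ?I \<times> ?I"
      proof (rule image_subsetI)
        fix k assume "k \<in> gdisc K - N"
        then show "cell Q k \<in> ?I \<times> ?I"
          unfolding cell_def using gnorm_le_bounds[of k K] by (intro SigmaI *) (simp_all add: gdisc_def)
      qed
    qed auto
    also have "real (card (?I \<times> ?I)) = (real (card ?I))\<^sup>2" by (simp only: card_cartesian_product power2_eq_square of_nat_mult)
    also have "(real (card ?I))\<^sup>2 \<le> (4 * m)\<^sup>2" using card by (intro power_mono) auto
    also have "(4 * m)\<^sup>2 = 64 * K / Q" by (simp add: power_mult_distrib msq)
    finally show ?thesis using X Q by (simp add: mult_right_mono)
  qed
  have "(\<Sum>k\<in>gdisc K. ?f k) =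
     (\<Sum>k\<in>gdisc K \<inter> N. ?f k) + (\<Sum>k\<in>gdisc K - N. ?f k)"
    by (rule sum.Int_Diff) simp
  also have "\<dots> \<le> 912 * Q + (64 * K / Q) * (16 * X + 180 * Q)" using 1 2 by linarith
  also have "\<dots> = 912 * Q + 11520 * K + 1024 * (K * X / Q)" using Q by (simp add: field_simps)
  also have "\<dots> \<le> 12000 * (Q + K + K * X / Q)"
  proof -
    have "K * X / Q \<ge> 0" using K X Q by simp
    then show ?thesis using K Q by simp
  qed
  finally show ?thesis .
qed

text \<open>The products \<open>d * h\<close> with \<open>h\<close> fixed are distinct elements of
  the disc of norm at most H D. By positivity the sum may be extended to that whole disc, so that
  the spacing of the multiples of \<theta> serves for every \<open>h\<close> at once.\<close>

lemma sum_min_inverse_gdisc_mult_le: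
  assumes well_spaced: "well_spaced \<theta> Q" and X: "X > 0" and D: "D \<ge> 0" and h: "h \<noteq> 0" "gnorm h \<le> H"
  shows "(\<Sum>d\<in>gdisc D. min_inverse X (gdist (cx d * (cx h * \<theta>)))) \<le> 12000 * (Q + H * D + H * D * X / Q)"
proof -
  have inj: "inj_on (\<lambda>d. d * h) (gdisc D)" using h by (auto simp: inj_on_def)
  have "(\<Sum>d\<in>gdisc D. min_inverse X (gdist (cx d * (cx h * \<theta>)))) =
      (\<Sum>k\<in>(\<lambda>d. d * h) ` gdisc D. min_inverse X (gdist (cx k * \<theta>)))"
    by (subst sum.reindex[OF inj]) (simp add: mult.assoc)
  also have "\<dots> \<le> (\<Sum>k\<in>gdisc (H * D). min_inverse X (gdist (cx k * \<theta>)))"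
  proof (rule sum_mono2)
    show "(\<lambda>d. d * h) ` gdisc D \<subseteq> gdisc (H * D)"
    proof clarify
      fix d assume "d \<in> gdisc D"
      then have "gnorm h * gnorm d \<le> H * D" "d \<noteq> 0"
        using h by (auto simp: gdisc_def intro!: mult_mono order_trans[OF gnorm_nonneg])
      then show "d * h \<in> gdisc (H * D)" using h by (simp add: gdisc_def gnorm_mult mult.commute)
    qed
  qed (use X in \<open>auto intro!: less_imp_le[OF min_inverse_pos]\<close>)
  also have "\<dots> \<le> 12000 * (Q + H * D + H * D * X / Q)"
    using D h order_trans[OF gnorm_nonneg h(2)] by (intro sum_min_inverse_gdisc_le[OF well_spaced X]) auto
  finally show ?thesis .
qed

lemma sum_disc_bound_gdisc_le:
  assumes well_spaced: "well_spaced \<theta> Q" and Z: "Z > 0" and D: "D \<ge> 0" and h: "h \<noteq> 0" "gnorm h \<le> H"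
  shows "(\<Sum>d\<in>gdisc D. disc_bound Z (cx d * (cx h * \<theta>))) \<le> 216000 * (Q * sqrt Z + H * D * sqrt Z + H * D * Z / Q)"
proof -
  have Q: "Q \<ge> 1" using well_spaced by (simp add: well_spaced_def)
  have H: "H \<ge> 0" using order_trans[OF gnorm_nonneg h(2)] .
  have "(\<Sum>d\<in>gdisc D. disc_bound Z (cx d * (cx h * \<theta>))) =
     6 * sqrt Z * (\<Sum>d\<in>gdisc D. min_inverse (3 * sqrt Z) (gdist (cx d * (cx h * \<theta>))))"
    by (simp add: disc_bound_def sum_distrib_left)
  also have "\<dots> \<le> 6 * sqrt Z * (12000 * (Q + H * D + H * D * (3 * sqrt Z) / Q))"
    using Z by (intro mult_left_mono sum_min_inverse_gdisc_mult_le[OF well_spaced _ D h]) auto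
  also have "\<dots> = 72000 * (Q * sqrt Z) + 72000 * (H * D * sqrt Z) + 216000 * (H * D * Z / Q)"
    using Z by (simp add: field_simps)
  also have "\<dots> \<le> 216000 * (Q * sqrt Z + H * D * sqrt Z + H * D * Z / Q)"
  proof -
    have "Q * sqrt Z \<ge> 0" "H * D * sqrt Z \<ge> 0" using Q H D Z by simp_all
    then show ?thesis by argo
  qed
  finally show ?thesis .
qed

text \<open>The variable modulus \<open>y / N d\<close> is frozen on dyadic ranges of \<open>N d\<close>.\<close>

definition dyadic :: "real \<Rightarrow> nat" where
  "dyadic x = nat \<lfloor>log 2 x\<rfloor>"

lemma dyadic_bounds:
  assumes "x \<ge> 1"
  shows "2 ^ dyadic x \<le> x" "x < 2 * 2 ^ dyadic x"
proof -
  have "log 2 x \<ge> 0" using assms by simp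
  then have "real (dyadic x) \<le> log 2 x" "log 2 x < real (dyadic x) + 1" by (simp_all add: dyadic_def)
  then have "2 powr real (dyadic x) \<le> 2 powr log 2 x" "2 powr log 2 x < 2 powr (real (dyadic x) + 1)"
    by simp_all
  then show "2 ^ dyadic x \<le> x" "x < 2 * 2 ^ dyadic x"
    using assms by (simp_all add: powr_add powr_realpow)
qed

text \<open>On the range P <= N d < 2P the three terms become Q sqrt (y / P), largest at P = 1; H
  sqrt (y P) up to a constant, largest at P = D; and H y / Q, independent of P. So each of the
  \<open>n\<close> ranges costs the same.\<close>

lemma sum_disc_bound_hyperbola_le:
  assumes well_spaced: "well_spaced \<theta> Q" and y: "y \<ge> 1" and h: "h \<noteq> 0" "gnorm h \<le> H" and n: "D < 2 ^ n" and D: "D \<ge> 0"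
  shows "(\<Sum>d\<in>gdisc D. disc_bound (y / gnorm d) (cx d * (cx h * \<theta>))) \<le>
    432000 * real n * (Q * sqrt y + H * sqrt (y * D) + H * y / Q)"
proof -
  let ?D = "\<lambda>i. {d \<in> gdisc D. dyadic (gnorm d) = i}"
  let ?E = "\<lambda>Z d. disc_bound Z (cx d * (cx h * \<theta>))"
  define B where "B = 432000 * (Q * sqrt y + H * sqrt (y * D) + H * y / Q)"
  have Q: "Q \<ge> 1" using well_spaced by (simp add: well_spaced_def)
  have H: "H \<ge> 0" using order_trans[OF gnorm_nonneg h(2)] .
  have B: "B \<ge> 0" using Q H y D by (simp add: B_def)
  have "(\<Sum>d\<in>gdisc D. ?E (y / gnorm d) d) =
      (\<Sum>i<n. \<Sum>d\<in>?D i. ?E (y / gnorm d) d)"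
  proof (rule sum.group[symmetric])
    show "(\<lambda>d. dyadic (gnorm d)) ` gdisc D \<subseteq> {..<n}"
    proof clarsimp
      fix d assume "d \<in> gdisc D"
      then have "2 ^ dyadic (gnorm d) \<le> gnorm d" "gnorm d \<le> D"
        using dyadic_bounds(1) gnorm_ge_1 by (auto simp: gdisc_def)
      then have "2 ^ dyadic (gnorm d) < (2 :: real) ^ n" using n by (meson order_le_less_trans)
      then show "dyadic (gnorm d) < n" by simp
    qed
  qed auto
  also have "\<dots> \<le> (\<Sum>i<n. B)"
  proof (rule sum_mono)
    fix i
    show "(\<Sum>d\<in>?D i. ?E (y / gnorm d) d) \<le> B"
    proof (cases "?D i = {}")
      case True
      then show ?thesis using B by (metis sum.empty)
    next
      case False
      define P :: real where "P = 2 ^ i"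
      have P: "P \<ge> 1" by (simp add: P_def)
      have mem: "P \<le> gnorm d" "gnorm d \<le> 2 * P" "d \<noteq> 0" "gnorm d \<le> D"
        if "d \<in> gdisc D" "dyadic (gnorm d) = i" for d
        using that dyadic_bounds[of "gnorm d"] gnorm_ge_1[of d] by (auto simp: gdisc_def P_def)
      have PD: "P \<le> D" using False mem by force
      have "(\<Sum>d\<in>?D i. ?E (y / gnorm d) d) \<le>
         (\<Sum>d\<in>?D i. ?E (y / P) d)"
      proof (rule sum_mono)
        fix d assume "d \<in> ?D i"
        then have d: "P \<le> gnorm d" using mem by auto
        then have "0 < y / gnorm d" using y P by (intro divide_pos_pos) linarith+
        moreover have "y / gnorm d \<le> y / P" using y P d by (intro divide_left_mono mult_pos_pos) linarith+
        ultimately show "?E (y / gnorm d) d \<le> ?E (y / P) d"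
          by (rule disc_bound_mono)
      qed
      also have "\<dots> \<le> (\<Sum>d\<in>gdisc (2 * P). ?E (y / P) d)"
      proof (rule sum_mono2)
        show "?D i \<subseteq> gdisc (2 * P)"
        proof clarify
          fix d assume "d \<in> gdisc D" "i = dyadic (gnorm d)"
          then show "d \<in> gdisc (2 * P)" using mem(2,3)[of d] by (simp add: gdisc_def)
        qed
        have "0 < y / P" using y P by (intro divide_pos_pos) linarith+
        then show "?E (y / P) d \<ge> 0" for d by (rule disc_bound_nonneg)
      qed simp
      also have "\<dots> \<le> 216000 * (Q * sqrt (y / P) + H * (2 * P) * sqrt (y / P) + H * (2 * P) * (y / P) / Q)"
        by (rule sum_disc_bound_gdisc_le[OF well_spaced _ _ h]) (use y P in \<open>simp_all add: divide_pos_pos\<close>)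
      also have "\<dots> \<le> 216000 * (Q * sqrt y + 2 * (H * sqrt (y * D)) + 2 * (H * y / Q))"
      proof -
        have "sqrt (y / P) \<le> sqrt y" using y P by (intro real_sqrt_le_mono) (simp add: divide_le_eq)
        then have "Q * sqrt (y / P) \<le> Q * sqrt y" using Q by (intro mult_left_mono) auto
        moreover have "y * P = P\<^sup>2 * (y / P)" using P by (simp add: power2_eq_square)
        then have "P * sqrt (y / P) = sqrt (y * P)"
          using P by (simp only: real_sqrt_mult real_sqrt_abs)
        then have e1: "H * (2 * P) * sqrt (y / P) = 2 * (H * sqrt (y * P))" by (simp add: mult_ac)
        moreover have "H * sqrt (y * P) \<le> H * sqrt (y * D)"
          using PD H y by (intro mult_left_mono real_sqrt_le_mono) auto
        moreover have e2: "H * (2 * P) * (y / P) / Q = 2 * (H * y / Q)" using P by simp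
        ultimately show ?thesis unfolding e1 e2
          by (intro mult_left_mono[of _ _ 216000] add_mono mult_left_mono[of _ _ 2]) (assumption | simp)+
      qed
      also have "\<dots> \<le> B" using Q y by (simp add: B_def)
      finally show ?thesis .
    qed
  qed
  finally show ?thesis by (simp add: B_def mult_ac)
qed

subsection \<open>Type I and type II sums\<close>

lemma card_gdisc_le:
  assumes "x \<ge> 1"
  shows "real (card (gdisc x)) \<le> 9 * x"
proof -
  define r where "r = \<lfloor>sqrt x\<rfloor>"
  have "sqrt 1 \<le> sqrt x" using assms by (intro real_sqrt_le_mono)
  then have sq: "sqrt x \<ge> 1" by simp
  then have r: "r \<ge> 0" "of_int r \<le> sqrt x" by (auto simp: r_def)
  have "inj_on (\<lambda>n. (gre n, gim n)) (gdisc x)"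
    by (rule inj_onI) (simp add: gauss_int_eq_iff)
  moreover have "(\<lambda>n. (gre n, gim n)) ` gdisc x \<subseteq> {-r..r} \<times> {-r..r}"
  proof (rule image_subsetI)
    fix n assume "n \<in> gdisc x"
    then have "\<bar>gre n\<bar> \<le> r" "\<bar>gim n\<bar> \<le> r"
      unfolding r_def le_floor_iff using gnorm_le_bounds[of n x] by (auto simp: gdisc_def)
    then show "(gre n, gim n) \<in> {-r..r} \<times> {-r..r}" by auto
  qed
  ultimately have "card (gdisc x) \<le> card ({-r..r} \<times> {-r..r})"
    by (rule card_inj_on_le) auto
  also have "real \<dots> = (2 * of_int r + 1)\<^sup>2" using r by (simp add: power2_eq_square)
  also have "\<dots> \<le> (3 * sqrt x)\<^sup>2" using r sq by (intro power_mono) linarith+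
  finally show ?thesis using assms by (simp add: power_mult_distrib)
qed

lemma gchar_mult: "gchar \<beta> (m * n) = gchar (cx m * \<beta>) n"
  by (simp add: gchar_def mult_ac)

lemma gchar_diff: "gchar \<beta> (m - n) = gchar \<beta> m * cnj (gchar \<beta> n)"
  by (simp add: gchar_def cis_cnj cis_mult algebra_simps)

lemma mem_gdisc_div_swap:
  "d \<noteq> 0 \<Longrightarrow> k \<noteq> 0 \<Longrightarrow> k \<in> gdisc (y / gnorm d) \<longleftrightarrow> d \<in> gdisc (y / gnorm k)"
  by (auto simp: gdisc_def gnorm_pos pos_le_divide_eq mult.commute)

lemma gnorm_diff_le:
  assumes "gnorm k \<le> x" "gnorm l \<le> x"
  shows "gnorm (k - l) \<le> 4 * x"
proof -
  have "cmod (cx k) \<le> sqrt x" "cmod (cx l) \<le> sqrt x" using assms by (metis sqrt_gnorm real_sqrt_le_iff)+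
  then have "cmod (cx (k - l)) \<le> 2 * sqrt x" using norm_triangle_ineq4[of "cx k" "cx l"] by simp
  then have "(cmod (cx (k - l)))\<^sup>2 \<le> (2 * sqrt x)\<^sup>2" by (intro power_mono) auto
  moreover have "x \<ge> 0" using assms gnorm_nonneg order_trans by blast
  ultimately show ?thesis by (simp add: gauss_norm_def power_mult_distrib)
qed

text \<open>The logarithmic part of \<open>type_I_split\<close> costs 2 ln y times the disc bound at
  \<open>d\<close>. The other part depends on \<open>d\<close> and \<open>c\<close> only through
  their product e, of norm at most U V, and the coefficients collect to at most ln y. Altogether
  three copies of the hyperbola sum arise, and 3 * 432000 = 1296000.\<close>

lemma type_I_bound:
  assumes well_spaced: "well_spaced \<theta> Q" and h: "h \<noteq> 0" "gnorm h \<le> H"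
    and y: "y \<ge> 1" "y < 2 ^ n" and UV: "U \<ge> 1" "V \<ge> 1" "U * V \<le> y"
  shows "cmod (\<Sum>d\<in>ndisc V. \<Sum>k\<in>gdisc (y / gnorm d). gmoebius d * gmangoldt_big U k * gchar (cx h * \<theta>) (d * k)) \<le>
    1296000 * real n * ln y * (Q * sqrt y + H * sqrt (y * (U * V)) + H * y / Q)"
proof -
  define \<alpha> where "\<alpha> = cx h * \<theta>"
  define E where "E = (\<lambda>d. disc_bound (y / gnorm d) (cx d * \<alpha>))"
  define G where "G = (\<lambda>e. cmod (\<Sum>m\<in>gdisc (y / gnorm e). gchar (cx e * \<alpha>) m))"
  define B where "B = 432000 * real n * (Q * sqrt y + H * sqrt (y * (U * V)) + H * y / Q)"
  have H: "H \<ge> 0" using order_trans[OF gnorm_nonneg h(2)] .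
  have Q: "Q \<ge> 1" using well_spaced by (simp add: well_spaced_def)
  have L: "ln y \<ge> 0" using y by simp
  have VUV: "V \<le> U * V" using UV mult_right_mono[of 1 U V] by simp
  have E: "E d \<ge> 0" if "d \<noteq> 0" for d
    unfolding E_def using that y by (intro disc_bound_nonneg divide_pos_pos gnorm_pos) auto
  have G: "G d \<le> E d" if "d \<noteq> 0" for d
    unfolding E_def G_def using that y by (intro cmod_gdisc_sum_le divide_pos_pos gnorm_pos) auto
  have sum: "(\<Sum>d\<in>gdisc (U * V). E d) \<le> B"
    unfolding E_def B_def \<alpha>_def using UV y by (intro sum_disc_bound_hyperbola_le[OF well_spaced y(1) h]) auto
  have inner: "cmod (\<Sum>k\<in>gdisc (y / gnorm d). gmoebius d * gmangoldt_big U k * gchar \<alpha> (d * k)) \<le>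
      2 * ln y * E d + (\<Sum>c\<in>ndisc U. gmangoldt c * G (d * c))" if "d \<in> ndisc V" for d
  proof -
    let ?x = "y / gnorm d" and ?\<beta> = "cx d * \<alpha>"
    have d: "d \<noteq> 0" "gnorm d \<le> V" using that by (auto simp: ndisc_def gdisc_def)
    have d1: "gnorm d \<ge> 1" using gnorm_ge_1[OF d(1)] .
    have "gnorm d \<le> y" using d VUV UV by linarith
    then have x: "?x \<ge> 1" "?x \<le> y" using d1 y by (auto simp: divide_le_eq)
    have "(\<Sum>k\<in>gdisc ?x. gmoebius d * gmangoldt_big U k * gchar \<alpha> (d * k)) = gmoebius d * (\<Sum>k\<in>gdisc ?x. gmangoldt_big U k * gchar ?\<beta> k)"
      by (simp add: sum_distrib_left gchar_mult mult.assoc)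
    then have "cmod (\<Sum>k\<in>gdisc ?x. gmoebius d * gmangoldt_big U k * gchar \<alpha> (d * k)) =
        \<bar>gmoebius d\<bar> * cmod (\<Sum>k\<in>gdisc ?x. gmangoldt_big U k * gchar ?\<beta> k)" by (simp add: norm_mult)
    also have "\<dots> \<le> 1 * cmod (\<Sum>k\<in>gdisc ?x. gmangoldt_big U k * gchar ?\<beta> k)"
      by (intro mult_right_mono abs_gmoebius_le) auto
    also have "\<dots> \<le> cmod (\<Sum>k\<in>gdisc ?x. ln (gnorm k) * gchar ?\<beta> k) +
        cmod (\<Sum>c\<in>ndisc ?x. if gnorm c \<le> U then gmangoldt c * (\<Sum>m\<in>gdisc (?x / gnorm c). gchar ?\<beta> (c * m)) else 0)"
      unfolding type_I_split mult_1 by (rule norm_triangle_ineq4)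
    also have "cmod (\<Sum>k\<in>gdisc ?x. ln (gnorm k) * gchar ?\<beta> k) \<le> 2 * ln ?x * disc_bound ?x ?\<beta>"
      by (rule cmod_ln_gdisc_sum_le[OF x(1) order_refl])
    also have "2 * ln ?x * disc_bound ?x ?\<beta> \<le> 2 * ln y * E d"
      unfolding E_def using x by (intro mult_right_mono disc_bound_nonneg) auto
    also have "cmod (\<Sum>c\<in>ndisc ?x. if gnorm c \<le> U then gmangoldt c * (\<Sum>m\<in>gdisc (?x / gnorm c). gchar ?\<beta> (c * m)) else 0)
        \<le> (\<Sum>c\<in>ndisc ?x. if gnorm c \<le> U then gmangoldt c * G (d * c) else 0)"
      by (rule sum_norm_le)
         (auto simp: norm_mult gmangoldt_nonneg G_def gchar_mult gnorm_mult mult_ac)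
    also have "\<dots> = (\<Sum>c\<in>{c \<in> ndisc ?x. gnorm c \<le> U}. gmangoldt c * G (d * c))"
      by (simp add: sum.inter_filter)
    also have "\<dots> \<le> (\<Sum>c\<in>ndisc U. gmangoldt c * G (d * c))"
      by (rule sum_mono2[OF finite_ndisc]) (auto simp: ndisc_def gdisc_def gmangoldt_nonneg G_def)
    finally show ?thesis by simp
  qed
  have "cmod (\<Sum>d\<in>ndisc V. \<Sum>k\<in>gdisc (y / gnorm d). gmoebius d * gmangoldt_big U k * gchar \<alpha> (d * k)) \<le>
      (\<Sum>d\<in>ndisc V. 2 * ln y * E d + (\<Sum>c\<in>ndisc U. gmangoldt c * G (d * c)))"
    by (rule sum_norm_le[OF inner])
  also have "\<dots> = 2 * ln y * (\<Sum>d\<in>ndisc V. E d) + (\<Sum>d\<in>ndisc V. \<Sum>c\<in>ndisc U. gmangoldt c * G (d * c))"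
    by (simp add: sum.distrib sum_distrib_left)
  also have "(\<Sum>d\<in>ndisc V. E d) \<le> (\<Sum>d\<in>gdisc (U * V). E d)"
    using VUV by (intro sum_mono2[OF finite_gdisc] E) (auto simp: ndisc_def gdisc_def)
  also note sum
  also have "(\<Sum>d\<in>ndisc V. \<Sum>c\<in>ndisc U. gmangoldt c * G (d * c)) \<le> (\<Sum>e\<in>gdisc (U * V). ln (gnorm e) * G e)"
    using UV by (intro sum_gmangoldt_products_le) (auto simp: G_def)
  also have "\<dots> \<le> (\<Sum>e\<in>gdisc (U * V). ln y * E e)"
  proof (rule sum_mono)
    fix e assume "e \<in> gdisc (U * V)"
    then have e: "e \<noteq> 0" "gnorm e \<le> y" using UV by (auto simp: gdisc_def)
    then show "ln (gnorm e) * G e \<le> ln y * E e"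
      using L gnorm_pos[of e] by (intro mult_mono G) (auto simp: G_def)
  qed
  also have "\<dots> = ln y * (\<Sum>e\<in>gdisc (U * V). E e)" by (simp add: sum_distrib_left)
  also have "\<dots> \<le> ln y * B" using sum L by (intro mult_left_mono)
  finally have "cmod (\<Sum>d\<in>ndisc V. \<Sum>k\<in>gdisc (y / gnorm d). gmoebius d * gmangoldt_big U k * gchar \<alpha> (d * k)) \<le>
      2 * ln y * B + ln y * B" using L by (simp add: mult_left_mono)
  then show ?thesis unfolding \<alpha>_def B_def by (simp add: algebra_simps)
qed

text \<open>
  With the outer variable extended to the whole disc \<open>N d \<le> 2 P\<close>, opening the square gives sums over
  complete discs, since \<open>k \<in> gdisc (y / N d)\<close> is symmetric in \<open>d\<close> and \<open>k\<close>.
\<close>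

lemma sum_norm_bilinear_le:
  fixes b :: "gauss_int \<Rightarrow> real"
  assumes well_spaced: "well_spaced \<theta> Q" and h: "h \<noteq> 0" "gnorm h \<le> H" and P: "1 \<le> P" "P \<le> y"
    and b: "\<And>k. k \<in> gdisc (y / P) \<Longrightarrow> \<bar>b k\<bar> \<le> L"
  shows "(\<Sum>d\<in>gdisc (2 * P). (cmod (\<Sum>k\<in>gdisc (y / P) \<inter> gdisc (y / gnorm d). b k * gchar (cx h * \<theta>) (d * k)))\<^sup>2)
    \<le> 15552000 * L\<^sup>2 * (y / P) * (P + Q * sqrt P + H * y / sqrt P + H * y / Q)"
proof -
  define \<alpha> where "\<alpha> = cx h * \<theta>"
  define K where "K = gdisc (y / P)"
  define X where "X = (\<lambda>k l. gdisc (2 * P) \<inter> gdisc (y / gnorm k) \<inter> gdisc (y / gnorm l))"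
  let ?F = "\<lambda>d. cmod (\<Sum>k\<in>K \<inter> gdisc (y / gnorm d). b k * gchar \<alpha> (d * k))"
  let ?T = "\<lambda>d k l. if k \<in> gdisc (y / gnorm d) \<and> l \<in> gdisc (y / gnorm d) then b k * b l * gchar (cx (k - l) * \<alpha>) d else 0"
  have Q: "Q \<ge> 1" using well_spaced by (simp add: well_spaced_def)
  have H: "H \<ge> 0" using order_trans[OF gnorm_nonneg h(2)] .
  have yP: "y / P \<ge> 1" using P by simp
  have K0: "k \<noteq> 0" if "k \<in> K" for k using that by (simp add: K_def gdisc_def)
  have "complex_of_real (\<Sum>d\<in>gdisc (2 * P). (?F d)\<^sup>2) =
    (\<Sum>d\<in>gdisc (2 * P). \<Sum>k\<in>K. \<Sum>l\<in>K.
      ?T d k l)"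
    unfolding of_real_sum
  proof (rule sum.cong)
    fix d
    let ?I = "gdisc (y / gnorm d)"
    let ?f = "\<lambda>k. if k \<in> ?I then b k * gchar \<alpha> (d * k) else 0"
    have "complex_of_real ((cmod (\<Sum>k\<in>K \<inter> ?I. b k * gchar \<alpha> (d * k)))\<^sup>2) = (\<Sum>k\<in>K. ?f k) * cnj (\<Sum>k\<in>K. ?f k)"
      unfolding complex_norm_square by (simp add: sum.inter_restrict K_def)
    also have "\<dots> = (\<Sum>k\<in>K. \<Sum>l\<in>K. ?f k * cnj (?f l))"
      by (simp only: cnj_sum sum_product)
    also have "\<dots> = (\<Sum>k\<in>K. \<Sum>l\<in>K. if k \<in> ?I \<and> l \<in> ?I then b k * b l * gchar (cx (k - l) * \<alpha>) d else 0)"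
    proof (intro sum.cong refl)
      fix k l
      have "gchar (cx (k - l) * \<alpha>) d = gchar \<alpha> (d * k) * cnj (gchar \<alpha> (d * l))"
        by (simp only: gchar_mult[symmetric] gchar_diff[symmetric]) (simp add: algebra_simps)
      then show "?f k * cnj (?f l) = (if k \<in> ?I \<and> l \<in> ?I then b k * b l * gchar (cx (k - l) * \<alpha>) d else 0)"
        by simp
    qed
    finally show "complex_of_real ((cmod (\<Sum>k\<in>K \<inter> ?I. b k * gchar \<alpha> (d * k)))\<^sup>2) = \<dots>" .
  qed simp
  also have "\<dots> = (\<Sum>k\<in>K. \<Sum>l\<in>K. \<Sum>d\<in>gdisc (2 * P).
      ?T d k l)"
    by (rule trans[OF sum.swap]) (rule sum.cong[OF refl], rule sum.swap)
  also have "\<dots> = (\<Sum>k\<in>K. \<Sum>l\<in>K. b k * b l * (\<Sum>d\<in>X k l. gchar (cx (k - l) * \<alpha>) d))"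
  proof (intro sum.cong refl)
    fix k l assume kl: "k \<in> K" "l \<in> K"
    have "(\<Sum>d\<in>gdisc (2 * P). ?T d k l) =
      (\<Sum>d\<in>gdisc (2 * P). if d \<in> gdisc (y / gnorm k) \<inter> gdisc (y / gnorm l) then b k * b l * gchar (cx (k - l) * \<alpha>) d else 0)"
    proof (intro sum.cong refl)
      fix d assume "d \<in> gdisc (2 * P)"
      then have "d \<noteq> 0" by (simp add: gdisc_def)
      then show "(?T d k l) =
        (if d \<in> gdisc (y / gnorm k) \<inter> gdisc (y / gnorm l) then b k * b l * gchar (cx (k - l) * \<alpha>) d else 0)"
        using mem_gdisc_div_swap[of d k y] mem_gdisc_div_swap[of d l y] K0[OF kl(1)] K0[OF kl(2)] by simp
    qed
    also have "\<dots> = (\<Sum>d\<in>X k l. b k * b l * gchar (cx (k - l) * \<alpha>) d)"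
      unfolding X_def Int_assoc by (rule sum.inter_restrict[symmetric]) simp
    finally show "(\<Sum>d\<in>gdisc (2 * P). ?T d k l) =
      b k * b l * (\<Sum>d\<in>X k l. gchar (cx (k - l) * \<alpha>) d)" by (simp add: sum_distrib_left)
  qed
  finally have eq: "complex_of_real (\<Sum>d\<in>gdisc (2 * P). (?F d)\<^sup>2) =
    (\<Sum>k\<in>K. \<Sum>l\<in>K. b k * b l * (\<Sum>d\<in>X k l. gchar (cx (k - l) * \<alpha>) d))" .
  \<comment> \<open>\<open>36 * P\<close> is the trivial bound on the diagonal \<open>k = l\<close>;
    the rest sums over the differences \<open>k - l\<close>, which are nonzero of norm at most 4 y /
    P.\<close>
  define W where "W = 36 * P + 216000 * (Q * sqrt (2 * P) + H * (4 * y / P) * sqrt (2 * P) + H * (4 * y / P) * (2 * P) / Q)"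
  have "(\<Sum>d\<in>gdisc (2 * P). (?F d)\<^sup>2)
      = cmod (complex_of_real (\<Sum>d\<in>gdisc (2 * P). (?F d)\<^sup>2))"
    unfolding norm_of_real by (intro abs_of_nonneg[symmetric] sum_nonneg) simp
  also have "\<dots> \<le> (\<Sum>k\<in>K. \<Sum>l\<in>K. L * L * disc_bound (2 * P) (cx (k - l) * \<alpha>))"
    unfolding eq
  proof (intro sum_norm_le)
    fix k l assume kl: "k \<in> K" "l \<in> K"
    have "X k l = gdisc (min (2 * P) (min (y / gnorm k) (y / gnorm l)))"
      by (auto simp: X_def gdisc_def)
    then have "cmod (\<Sum>d\<in>X k l. gchar (cx (k - l) * \<alpha>) d) \<le> disc_bound (2 * P) (cx (k - l) * \<alpha>)"
      using P by (simp only:) (intro cmod_gdisc_sum_le, auto)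
    then show "cmod (b k * b l * (\<Sum>d\<in>X k l. gchar (cx (k - l) * \<alpha>) d)) \<le> L * L * disc_bound (2 * P) (cx (k - l) * \<alpha>)"
      using b[of k] b[of l] kl unfolding norm_mult norm_of_real K_def abs_mult by (intro mult_mono) auto
  qed
  also have "\<dots> \<le> (\<Sum>k\<in>K. L * L * W)"
  proof (rule sum_mono)
    fix k assume k: "k \<in> K"
    have "(\<Sum>l\<in>K. disc_bound (2 * P) (cx (k - l) * \<alpha>)) = (\<Sum>m\<in>(\<lambda>l. k - l) ` K. disc_bound (2 * P) (cx m * \<alpha>))"
      by (subst sum.reindex) (auto simp: inj_on_def)
    also have "\<dots> \<le> (\<Sum>m\<in>insert 0 (gdisc (4 * y / P)). disc_bound (2 * P) (cx m * \<alpha>))"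
    proof (rule sum_mono2)
      show "(\<lambda>l. k - l) ` K \<subseteq> insert 0 (gdisc (4 * y / P))"
        using k gnorm_diff_le[of k "y / P"] by (auto simp: K_def gdisc_def)
    qed (use P in \<open>auto intro!: disc_bound_nonneg\<close>)
    also have "\<dots> = disc_bound (2 * P) (cx 0 * \<alpha>) + (\<Sum>m\<in>gdisc (4 * y / P). disc_bound (2 * P) (cx m * \<alpha>))"
      by (rule sum.insert) (auto simp: gdisc_def finite_gdisc[unfolded gdisc_def])
    also have "disc_bound (2 * P) (cx 0 * \<alpha>) \<le> 36 * P" using disc_bound_le[of "2 * P" "cx 0 * \<alpha>"] P by simp
    also have "(\<Sum>m\<in>gdisc (4 * y / P). disc_bound (2 * P) (cx m * \<alpha>)) \<le>
        216000 * (Q * sqrt (2 * P) + H * (4 * y / P) * sqrt (2 * P) + H * (4 * y / P) * (2 * P) / Q)"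
      unfolding \<alpha>_def using P by (intro sum_disc_bound_gdisc_le[OF well_spaced _ _ h]) auto
    finally have "(\<Sum>l\<in>K. disc_bound (2 * P) (cx (k - l) * \<alpha>)) \<le> W" by (simp add: W_def)
    then show "(\<Sum>l\<in>K. L * L * disc_bound (2 * P) (cx (k - l) * \<alpha>)) \<le> L * L * W"
      unfolding sum_distrib_left[symmetric] by (intro mult_left_mono) auto
  qed
  also have "\<dots> = real (card K) * (L\<^sup>2 * W)" by (simp add: power2_eq_square)
  also have "\<dots> \<le> (9 * (y / P)) * (L\<^sup>2 * (1728000 * (P + Q * sqrt P + H * y / sqrt P + H * y / Q)))"
  proof (intro mult_mono mult_left_mono)
    show "real (card K) \<le> 9 * (y / P)" unfolding K_def by (rule card_gdisc_le[OF yP])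
    have s2: "sqrt (2 * P) \<le> 2 * sqrt P"
    proof -
      have "sqrt 2 \<le> 2" by (rule real_le_lsqrt) auto
      then show ?thesis using P by (simp add: real_sqrt_mult mult_right_mono)
    qed
    have "P / sqrt P = sqrt P" using P by (simp add: real_div_sqrt)
    then have PP: "sqrt P / P = 1 / sqrt P" using P by (simp add: field_simps)
    have "Q * sqrt (2 * P) \<le> Q * (2 * sqrt P)" using s2 Q by (intro mult_left_mono) auto
    moreover have "H * (4 * y / P) * sqrt (2 * P) \<le> H * (4 * y / P) * (2 * sqrt P)"
      using s2 H P by (intro mult_left_mono) auto
    moreover have "H * (4 * y / P) * (2 * sqrt P) = 8 * (H * y * (sqrt P / P))" by simp
    moreover have "H * (4 * y / P) * (2 * P) / Q = 8 * (H * y / Q)" using P by simp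
    moreover have "Q * sqrt P \<ge> 0" "H * y / Q \<ge> 0" "H * y / sqrt P \<ge> 0" using Q P H by simp_all
    ultimately show "W \<le> 1728000 * (P + Q * sqrt P + H * y / sqrt P + H * y / Q)"
      unfolding W_def PP using P by simp
    show W0: "0 \<le> W" using P Q H by (simp add: W_def)
    then show "0 \<le> L\<^sup>2 * W" by simp
  qed (use P in auto)
  finally show ?thesis unfolding K_def \<alpha>_def by (simp add: mult_ac)
qed

text \<open>Cauchy-Schwarz on each dyadic range of N d, starting at P. Only ranges with V / 2 < P <=
  y / U contribute. In the bilinear bound P + Q sqrt P increases and H y / sqrt P decreases, so the
  former is taken at the upper end y / U and the latter at the lower end, where sqrt V <= 2 sqrt P
  costs a factor 2.\<close>

lemma type_II_bound:
  assumes well_spaced: "well_spaced \<theta> Q" and h: "h \<noteq> 0" "gnorm h \<le> H"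
    and y: "y \<ge> 1" "y < 2 ^ n" and UV: "U \<ge> 1" "V \<ge> 1"
  shows "cmod (\<Sum>d\<in>ndisc y - ndisc V. \<Sum>k\<in>gdisc (y / gnorm d). gmoebius d * gmangoldt_big U k * gchar (cx h * \<theta>) (d * k)) \<le>
    25000 * real n * ln y * sqrt (y * (y / U + Q * sqrt (y / U) + H * y / sqrt V + H * y / Q))"
proof -
  let ?P = "\<lambda>P. P + Q * sqrt P + H * y / sqrt P + H * y / Q"
  define \<alpha> where "\<alpha> = cx h * \<theta>"
  define W where "W = y / U + Q * sqrt (y / U) + H * y / sqrt V + H * y / Q"
  define g where "g = (\<lambda>d. \<Sum>k\<in>gdisc (y / gnorm d). gmoebius d * gmangoldt_big U k * gchar \<alpha> (d * k))"
  define S where "S = (\<lambda>i. {d \<in> ndisc y - ndisc V. dyadic (gnorm d) = i})"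
  have Q: "Q \<ge> 1" using well_spaced by (simp add: well_spaced_def)
  have H: "H \<ge> 0" using order_trans[OF gnorm_nonneg h(2)] .
  have L: "ln y \<ge> 0" using y by simp
  have W: "W \<ge> 0" unfolding W_def using y UV Q H by (intro add_nonneg_nonneg mult_nonneg_nonneg divide_nonneg_nonneg) auto
  have "(\<Sum>d\<in>ndisc y - ndisc V. g d) = (\<Sum>i<n. \<Sum>d\<in>S i. g d)"
    unfolding S_def
  proof (rule sum.group[symmetric])
    show "(\<lambda>d. dyadic (gnorm d)) ` (ndisc y - ndisc V) \<subseteq> {..<n}"
    proof (rule image_subsetI)
      fix d assume "d \<in> ndisc y - ndisc V"
      then have "2 ^ dyadic (gnorm d) \<le> gnorm d" "gnorm d \<le> y"
        using dyadic_bounds(1) gnorm_ge_1 by (auto simp: ndisc_def gdisc_def)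
      then have "2 ^ dyadic (gnorm d) < (2 :: real) ^ n" using y by (meson order_le_less_trans)
      then show "dyadic (gnorm d) \<in> {..<n}" by simp
    qed
  qed auto
  also have "cmod \<dots> \<le> (\<Sum>i<n. 25000 * ln y * sqrt (y * W))"
  proof (rule sum_norm_le)
    fix i
    define P :: real where "P = 2 ^ i"
    have P: "P \<ge> 1" by (simp add: P_def)
    have mem: "P \<le> gnorm d" "gnorm d < 2 * P" "d \<noteq> 0" "gnorm d > V" if "d \<in> S i" for d
      using that dyadic_bounds[of "gnorm d"] gnorm_ge_1[of d] by (auto simp: S_def ndisc_def gdisc_def P_def)
    have div: "y / gnorm d \<le> y / P" if "d \<in> S i" for d
      using mem[OF that] y P by (intro divide_left_mono mult_pos_pos) linarith+
    show "cmod (\<Sum>d\<in>S i. g d) \<le> 25000 * ln y * sqrt (y * W)"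
    \<comment> \<open>For P > y / U every \<open>k\<close> in the inner sum has norm below
      \<open>U\<close>, where \<open>gmangoldt_big U\<close> vanishes.\<close>
    proof (cases "S i = {} \<or> P > y / U")
      case True
      have "g d = 0" if "d \<in> S i" for d
      proof -
        have "P > y / U" using True that by auto
        then have "y / P < U" using P UV y by (simp add: field_simps)
        then have "gmangoldt_big U k = 0" if "k \<in> gdisc (y / gnorm d)" for k
          using div[OF \<open>d \<in> S i\<close>] that by (intro gmangoldt_big_eq_0) (auto simp: gdisc_def)
        then show ?thesis unfolding g_def by (intro sum.neutral) auto
      qed
      then have "(\<Sum>d\<in>S i. g d) = 0" by (intro sum.neutral) auto
      then show ?thesis using L y W by simp
    next
      case False
      have PU: "P \<le> y / U" using False by simp
      have "y / U \<le> y" using y UV by (simp add: divide_le_eq)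
      then have Py: "P \<le> y" using PU by linarith
      obtain d0 where "d0 \<in> S i" using False by auto
      then have VP: "V < 2 * P" using mem[of d0] by linarith
      define F where "F = (\<lambda>d. cmod (\<Sum>k\<in>gdisc (y / P) \<inter> gdisc (y / gnorm d). gmangoldt_big U k * gchar \<alpha> (d * k)))"
      have gF: "cmod (g d) \<le> F d" if "d \<in> S i" for d
      proof -
        have "gdisc (y / gnorm d) = gdisc (y / P) \<inter> gdisc (y / gnorm d)"
          using gdisc_mono[OF div[OF that]] by blast
        then have "g d = gmoebius d * (\<Sum>k\<in>gdisc (y / P) \<inter> gdisc (y / gnorm d). gmangoldt_big U k * gchar \<alpha> (d * k))"
          unfolding g_def by (simp add: sum_distrib_left mult.assoc)
        then have "cmod (g d) = \<bar>gmoebius d\<bar> * F d" by (simp add: norm_mult F_def)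
        also have "\<dots> \<le> 1 * F d" by (intro mult_right_mono abs_gmoebius_le) (simp add: F_def)
        finally show ?thesis by simp
      qed
      have sub: "S i \<subseteq> gdisc (2 * P)"
      proof
        fix d assume "d \<in> S i"
        then show "d \<in> gdisc (2 * P)" using mem[of d] by (simp add: gdisc_def)
      qed
      have "cmod (\<Sum>d\<in>S i. g d) \<le> (\<Sum>d\<in>S i. F d)" by (rule sum_norm_le[OF gF])
      then have "(cmod (\<Sum>d\<in>S i. g d))\<^sup>2 \<le> (\<Sum>d\<in>S i. F d)\<^sup>2" by (intro power_mono) auto
      also have "\<dots> \<le> (\<Sum>d\<in>S i. (F d)\<^sup>2) * card (S i)"
        by (rule sum_squared_le_sum_of_squares)
      also have "\<dots> \<le> (15552000 * (ln y)\<^sup>2 * (y / P) * (?P P)) * (18 * P)"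
      proof (rule mult_mono)
        have "(\<Sum>d\<in>S i. (F d)\<^sup>2) \<le> (\<Sum>d\<in>gdisc (2 * P). (F d)\<^sup>2)"
          using sub by (intro sum_mono2) auto
        also have "\<dots> \<le> 15552000 * (ln y)\<^sup>2 * (y / P) * (?P P)"
          unfolding F_def \<alpha>_def
        proof (rule sum_norm_bilinear_le[OF well_spaced h P Py])
          fix k assume "k \<in> gdisc (y / P)"
          moreover have "y / P \<le> y" using P y by (simp add: divide_le_eq)
          ultimately have "k \<noteq> 0" "gnorm k \<le> y" by (auto simp: gdisc_def)
          then show "\<bar>gmangoldt_big U k\<bar> \<le> ln y"
            using gmangoldt_big_le[of k U] gmangoldt_big_nonneg[of U k] gnorm_pos[of k] y
            by (simp add: order_trans[OF _ ln_mono])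
        qed
        finally show "(\<Sum>d\<in>S i. (F d)\<^sup>2) \<le> 15552000 * (ln y)\<^sup>2 * (y / P) * (?P P)" .
        have "card (S i) \<le> card (gdisc (2 * P))" using sub by (intro card_mono) auto
        then show "real (card (S i)) \<le> 18 * P" using card_gdisc_le[of "2 * P"] P by linarith
        show "0 \<le> 15552000 * (ln y)\<^sup>2 * (y / P) * (?P P)"
          using y P Q H by (intro mult_nonneg_nonneg add_nonneg_nonneg divide_nonneg_nonneg) auto
      qed auto
      also have "\<dots> = 279936000 * (ln y)\<^sup>2 * y * (?P P)"
        using P by simp
      also have "\<dots> \<le> 279936000 * (ln y)\<^sup>2 * y * (2 * W)"
      proof (rule mult_left_mono)
        have "sqrt P \<le> sqrt (y / U)" using PU by (rule real_sqrt_le_mono)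
        then have "Q * sqrt P \<le> Q * sqrt (y / U)" using Q by (intro mult_left_mono) auto
        moreover have "sqrt V \<le> 2 * sqrt P"
        proof -
          have "sqrt V \<le> sqrt (4 * P)" using VP P by (intro real_sqrt_le_mono) linarith
          then show ?thesis by (simp add: real_sqrt_mult)
        qed
        then have "H * y / sqrt P \<le> 2 * (H * y / sqrt V)"
          using H y P UV mult_left_mono[of "sqrt V" "2 * sqrt P" "H * y"] by (simp add: field_simps)
        moreover have "0 \<le> y / U" "0 \<le> Q * sqrt (y / U)" "0 \<le> H * y / Q" using y UV Q H by simp_all
        ultimately show "?P P \<le> 2 * W"
          unfolding W_def using PU by argo
      qed (use y in auto)
      \<comment> \<open>The constant 2 * 279936000 is rounded up to 25000^2 to make it a
        square.\<close>
      also have "\<dots> \<le> 625000000 * ((ln y)\<^sup>2 * (y * W))"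
        using y W by (simp add: mult_right_mono)
      also have "\<dots> = (25000 * ln y * sqrt (y * W))\<^sup>2"
        using y W by (simp add: power_mult_distrib)
      finally show ?thesis
        by (rule power2_le_imp_le) (use L y W in auto)
    qed
  qed
  finally show ?thesis by (simp add: g_def \<alpha>_def W_def mult_ac)
qed

text \<open>The terms of norm at most \<open>U\<close> are estimated trivially; the outer variable
  up to \<open>V\<close> gives the type I sum, beyond \<open>V\<close> the type II sum.\<close>

lemma exp_sum_bound:
  assumes well_spaced: "well_spaced \<theta> Q" and h: "h \<noteq> 0" "gnorm h \<le> H"
    and y: "y \<ge> 1" "y < 2 ^ n" and UV: "U \<ge> 1" "V \<ge> 1" "U * V \<le> y"
  shows "cmod (\<Sum>m\<in>gdisc y. gmangoldt m * gchar (cx h * \<theta>) m) \<le>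
    9 * U * ln y + 1296000 * real n * ln y * (Q * sqrt y + H * sqrt (y * (U * V)) + H * y / Q) +
    25000 * real n * ln y * sqrt (y * (y / U + Q * sqrt (y / U) + H * y / sqrt V + H * y / Q))"
proof -
  define \<alpha> where "\<alpha> = cx h * \<theta>"
  define g where "g = (\<lambda>d. \<Sum>k\<in>gdisc (y / gnorm d). gmoebius d * gmangoldt_big U k * gchar \<alpha> (d * k))"
  have L: "ln y \<ge> 0" using y by simp
  have "1 * V \<le> U * V" using UV by (intro mult_right_mono) auto
  then have "V \<le> y" using UV by linarith
  then have sub: "ndisc V \<subseteq> ndisc y" using gdisc_mono[of V y] by (auto simp: ndisc_def)
  have "cmod (\<Sum>m\<in>gdisc y \<inter> gdisc U. gmangoldt m * gchar \<alpha> m) \<le> (\<Sum>m\<in>gdisc y \<inter> gdisc U. ln y)"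
  proof (rule sum_norm_le)
    fix m assume "m \<in> gdisc y \<inter> gdisc U"
    then have "m \<noteq> 0" "gnorm m \<le> y" by (auto simp: gdisc_def)
    then show "cmod (gmangoldt m * gchar \<alpha> m) \<le> ln y"
      using gmangoldt_le[of m] gmangoldt_nonneg[of m] gnorm_pos[of m] y
      by (simp add: norm_mult order_trans[OF _ ln_mono])
  qed
  also have "\<dots> = real (card (gdisc y \<inter> gdisc U)) * ln y" by simp
  also have "\<dots> \<le> 9 * U * ln y"
  proof (rule mult_right_mono[OF _ L])
    have "card (gdisc y \<inter> gdisc U) \<le> card (gdisc U)" by (intro card_mono) auto
    then show "real (card (gdisc y \<inter> gdisc U)) \<le> 9 * U" using card_gdisc_le[OF UV(1)] by linarith
  qed
  finally have 1: "cmod (\<Sum>m\<in>gdisc y \<inter> gdisc U. gmangoldt m * gchar \<alpha> m) \<le> 9 * U * ln y" .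
  have "(\<Sum>m\<in>gdisc y. gmangoldt m * gchar \<alpha> m) = (\<Sum>m\<in>gdisc y \<inter> gdisc U. gmangoldt m * gchar \<alpha> m) + (\<Sum>d\<in>ndisc y. g d)"
    unfolding g_def by (rule sum_gmangoldt_eq_bilinear)
  also have "(\<Sum>d\<in>ndisc y. g d) = (\<Sum>d\<in>ndisc V. g d) + (\<Sum>d\<in>ndisc y - ndisc V. g d)"
    using sum.subset_diff[OF sub, of g] by simp
  finally have "cmod (\<Sum>m\<in>gdisc y. gmangoldt m * gchar \<alpha> m) \<le>
      cmod (\<Sum>m\<in>gdisc y \<inter> gdisc U. gmangoldt m * gchar \<alpha> m) + (cmod (\<Sum>d\<in>ndisc V. g d) + cmod (\<Sum>d\<in>ndisc y - ndisc V. g d))"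
    by (simp add: norm_triangle_le norm_triangle_ineq)
  then show ?thesis
    using 1 type_I_bound[OF well_spaced h y UV] type_II_bound[OF well_spaced h y UV(1,2)]
    unfolding \<alpha>_def g_def by linarith
qed

subsection \<open>Counting Gaussian integers in discs\<close>

lemma content_unit_box_complex:
  "measure lborel (box (z - Complex (1/2) (1/2)) (z + Complex (1/2) (1/2))) = 1"
  "measure lborel (cbox (z - Complex (1/2) (1/2)) (z + Complex (1/2) (1/2))) = 1"
  by (simp_all add: measure_lborel_box_eq measure_lborel_cbox_eq Basis_complex_def inner_complex_def)

lemma cdisc_eq_insert: "x \<ge> 0 \<Longrightarrow> cdisc x = insert 0 (gdisc x)"
  by (auto simp: cdisc_def gdisc_def)

lemma card_cdisc: "x \<ge> 0 \<Longrightarrow> card (cdisc x) = card (gdisc x) + 1"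
  unfolding cdisc_eq_insert by (subst card_insert_disjoint) (auto simp: gdisc_def finite_gdisc[unfolded gdisc_def])

lemma mem_cdisc_iff: "n \<in> cdisc x \<longleftrightarrow> cmod (cx n) \<le> sqrt x"
  unfolding cdisc_def by (simp flip: sqrt_gnorm)

lemma cmod_le_1_if_half:
  assumes "\<bar>Re w\<bar> \<le> 1 / 2" "\<bar>Im w\<bar> \<le> 1 / 2"
  shows "cmod w < 1"
proof -
  have "(Re w)\<^sup>2 \<le> (1/2)\<^sup>2" "(Im w)\<^sup>2 \<le> (1/2)\<^sup>2"
    using assms abs_le_square_iff[of "Re w" "1/2"] abs_le_square_iff[of "Im w" "1/2"] by simp_all
  then have "(Re w)\<^sup>2 + (Im w)\<^sup>2 < 1" by (simp add: power2_eq_square)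
  then have "(cmod w)\<^sup>2 < 1" by (simp only: cmod_power2)
  then show ?thesis by (simp add: power2_less_1_iff)
qed

text \<open>Gauss's area argument: the open unit squares centred at the lattice points are disjoint
  and lie in a slightly larger disc, the half diagonal being less than 1. The constant pi matters,
  since the Mertens argument below compares upper and lower bounds for these counts.\<close>

lemma card_gdisc_le_pi:
  assumes "x \<ge> 0"
  shows "real (card (gdisc x)) \<le> pi * (sqrt x + 1)\<^sup>2"
proof -
  let ?B = "\<lambda>n. box (cx n - Complex (1/2) (1/2)) (cx n + Complex (1/2) (1/2))"
  have memD: "\<bar>Re z - Re (cx n)\<bar> < 1/2 \<and> \<bar>Im z - Im (cx n)\<bar> < 1/2" if "z \<in> ?B n" for z n
    using that unfolding in_box_complex_iff abs_less_iff greaterThanLessThan_iff minus_complex.sel plus_complex.sel complex.sel by linarith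
  have disj: "disjoint_family_on ?B (cdisc x)"
  unfolding disjoint_family_on_def
  proof (intro ballI impI, rule ccontr)
    fix m n assume "m \<noteq> n" "?B m \<inter> ?B n \<noteq> {}"
    then obtain z where z: "z \<in> ?B m" "z \<in> ?B n" by blast
    have "\<bar>Re (cx m) - Re (cx n)\<bar> < 1" "\<bar>Im (cx m) - Im (cx n)\<bar> < 1"
      using memD[OF z(1)] memD[OF z(2)] by linarith+
    then have "\<bar>gre m - gre n\<bar> < 1" "\<bar>gim m - gim n\<bar> < 1"
      by (simp_all flip: of_int_gre of_int_gim)
    then show False using \<open>m \<noteq> n\<close> by (simp add: gauss_int_eq_iff)
  qed
  have "real (card (cdisc x)) = (\<Sum>n\<in>cdisc x. measure lborel (?B n))"
    by (simp add: content_unit_box_complex)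
  also have "\<dots> = measure lborel (\<Union>n\<in>cdisc x. ?B n)"
    by (rule measure_finite_Union[symmetric]) (use disj emeasure_lborel_box_finite in \<open>auto simp: less_top\<close>)
  also have "\<dots> \<le> measure lborel (ball 0 (sqrt x + 1) :: complex set)"
  proof (rule measure_mono_fmeasurable)
    show "(\<Union>n\<in>cdisc x. ?B n) \<subseteq> ball 0 (sqrt x + 1)"
    proof
      fix z assume "z \<in> (\<Union>n\<in>cdisc x. ?B n)"
      then obtain n where n: "n \<in> cdisc x" "z \<in> ?B n" by blast
      have "cmod (z - cx n) < 1" using memD[OF n(2)] by (intro cmod_le_1_if_half) auto
      moreover have "cmod (cx n) \<le> sqrt x" using n(1) by (simp add: mem_cdisc_iff)
      moreover have "cmod z \<le> cmod (z - cx n) + cmod (cx n)" by (metis diff_add_cancel norm_triangle_ineq)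
      ultimately show "z \<in> ball 0 (sqrt x + 1)" by simp
    qed
  qed (auto intro!: fmeasurableI emeasure_bounded_finite)
  also have "\<dots> = pi * (sqrt x + 1)\<^sup>2"
    using assms content_ball[of "sqrt x + 1" "0 :: complex"] by (simp add: unit_ball_vol_2 DIM_complex)
  finally show ?thesis using card_cdisc[OF assms] by simp
qed

text \<open>Dually, the closed unit squares at the lattice points of the disc cover a slightly
  smaller disc. The final -1 accounts for the origin, which \<open>gdisc\<close> omits.\<close>

lemma card_gdisc_ge_pi:
  assumes "x \<ge> 1"
  shows "pi * (sqrt x - 1)\<^sup>2 - 1 \<le> real (card (gdisc x))"
proof -
  let ?B = "\<lambda>n. cbox (cx n - Complex (1/2) (1/2)) (cx n + Complex (1/2) (1/2))"
  have "sqrt 1 \<le> sqrt x" using assms by (intro real_sqrt_le_mono)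
  then have "pi * (sqrt x - 1)\<^sup>2 = measure lborel (ball 0 (sqrt x - 1) :: complex set)"
    using content_ball[of "sqrt x - 1" "0 :: complex"] by (simp add: unit_ball_vol_2 DIM_complex)
  also have "\<dots> \<le> measure lborel (\<Union>n\<in>cdisc x. ?B n)"
  proof (rule measure_mono_fmeasurable)
    show "ball 0 (sqrt x - 1) \<subseteq> (\<Union>n\<in>cdisc x. ?B n)"
    proof
      fix z :: complex assume "z \<in> ball 0 (sqrt x - 1)"
      then have z: "cmod z < sqrt x - 1" by simp
      define n where "n = nearest z"
      have d: "\<bar>Re z - Re (cx n)\<bar> \<le> 1/2" "\<bar>Im z - Im (cx n)\<bar> \<le> 1/2"
        using of_int_round_abs_le[of "Re z"] of_int_round_abs_le[of "Im z"]
        by (simp_all add: n_def nearest_def cx_gauss_of abs_minus_commute)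
      then have "cmod (cx n - z) < 1" by (intro cmod_le_1_if_half) (simp_all add: abs_minus_commute)
      then have "cmod (cx n) \<le> sqrt x"
        using z norm_triangle_ineq[of "cx n - z" z] by simp
      then have "n \<in> cdisc x" by (simp add: mem_cdisc_iff)
      moreover have "z \<in> ?B n" using d unfolding in_cbox_complex_iff abs_le_iff atLeastAtMost_iff minus_complex.sel plus_complex.sel complex.sel by linarith
      ultimately show "z \<in> (\<Union>n\<in>cdisc x. ?B n)" by blast
    qed
  qed (auto intro!: fmeasurable.finite_UN)
  also have "\<dots> \<le> (\<Sum>n\<in>cdisc x. measure lborel (?B n))"
    by (rule measure_UNION_le) auto
  also have "\<dots> = real (card (cdisc x))" by (simp add: content_unit_box_complex)
  finally show ?thesis using card_cdisc[of x] assms by simp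
qed

text \<open>From radius 100 on, enlarging or shrinking the radius by 1 changes the area by at most 3
  or 2 percent; the third percent of the lower bound absorbs the omitted origin.\<close>

lemma card_gdisc_bounds_large:
  assumes "x \<ge> 10000"
  shows "97 / 100 * pi * x \<le> real (card (gdisc x))" "real (card (gdisc x)) \<le> 103 / 100 * pi * x"
proof -
  define s where "s = sqrt x"
  have s: "s \<ge> 100" "s\<^sup>2 = x" using assms real_le_rsqrt[of 100 x] by (auto simp: s_def)
  have sq: "100 * s \<le> s\<^sup>2" using s unfolding power2_eq_square by (intro mult_right_mono) auto
  have "(s + 1)\<^sup>2 \<le> 103 / 100 * s\<^sup>2" using sq s by (simp add: power2_sum)
  then have pis: "pi * (s + 1)\<^sup>2 \<le> pi * (103 / 100 * x)" unfolding s(2) by (intro mult_left_mono) auto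
  show "real (card (gdisc x)) \<le> 103 / 100 * pi * x"
    using order_trans[OF card_gdisc_le_pi[of x] pis[unfolded s_def]] assms by (simp add: mult_ac)
  have "98 / 100 * s\<^sup>2 \<le> (s - 1)\<^sup>2" using sq s by (simp add: power2_diff)
  then have "pi * (98 / 100 * s\<^sup>2) \<le> pi * (s - 1)\<^sup>2" by (intro mult_left_mono) auto
  then have "98 / 100 * (pi * s\<^sup>2) \<le> pi * (s - 1)\<^sup>2" by (simp only: mult_ac)
  moreover have "1 \<le> pi * (1 / 100 * s\<^sup>2)"
  proof -
    have "1 * 1 \<le> pi * (1 / 100 * s\<^sup>2)" using pi_gt3 sq s by (intro mult_mono) auto
    then show ?thesis by simp
  qed
  moreover have "pi * (s - 1)\<^sup>2 - 1 \<le> real (card (gdisc x))"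
    using card_gdisc_ge_pi[of x] assms by (simp add: s_def)
  ultimately show "97 / 100 * pi * x \<le> real (card (gdisc x))"
    unfolding s(2) by linarith
qed

subsection \<open>A lower bound for the Chebyshev function\<close>

text \<open>The counterpart of Legendre's formula for the logarithm of a factorial.\<close>

lemma sum_ln_gdisc:
  "(\<Sum>n\<in>gdisc y. ln (gnorm n)) = (\<Sum>d\<in>ndisc y. gmangoldt d * real (card (gdisc (y / gnorm d))))"
proof -
  have "(\<Sum>n\<in>gdisc y. ln (gnorm n)) = (\<Sum>n\<in>gdisc y. \<Sum>d\<in>gdivisors n. gmangoldt d)"
    by (intro sum.cong) (auto simp: gdisc_def sum_gmangoldt_gdivisors)
  also have "\<dots> = (\<Sum>d\<in>ndisc y. \<Sum>k\<in>gdisc (y / gnorm d). gmangoldt d)"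
    by (rule sum_gdivisors_hyperbola[where g = "\<lambda>d _. gmangoldt d"])
  finally show ?thesis by (simp add: mult.commute)
qed

definition mertens_sum :: "real \<Rightarrow> real" where
  "mertens_sum z = (\<Sum>d\<in>ndisc z. gmangoldt d / gnorm d)"

lemma sum_ln_gdisc_le: "y \<ge> 1 \<Longrightarrow> (\<Sum>n\<in>gdisc y. ln (gnorm n)) \<le> real (card (gdisc y)) * ln y"
  by (rule sum_bounded_above) (auto simp: gdisc_def gnorm_pos)

text \<open>Apply \<open>sum_ln_gdisc\<close> at \<open>X = z * 10000\<close> instead of
  \<open>z\<close>: then X / N d >= 10000 for all \<open>d\<close> that count, so the discs have the
  expected size up to 3 percent, and the price is only the additive constant ln 10000.\<close>

lemma mertens_sum_le:
  assumes "z \<ge> 1"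
  shows "mertens_sum z \<le> 103 / 97 * (ln z + ln 10000)"
proof -
  define X where "X = z * 10000"
  have X: "X \<ge> 10000" using assms by (simp add: X_def)
  have lnX: "ln X = ln z + ln 10000" using assms by (simp add: X_def ln_mult)
  have "97 / 100 * pi * X * mertens_sum z = (\<Sum>d\<in>ndisc z. gmangoldt d * (97 / 100 * pi * (X / gnorm d)))"
    unfolding mertens_sum_def sum_distrib_left by (intro sum.cong) auto
  also have "\<dots> \<le> (\<Sum>d\<in>ndisc z. gmangoldt d * real (card (gdisc (X / gnorm d))))"
  proof (intro sum_mono mult_left_mono gmangoldt_nonneg)
    fix d assume "d \<in> ndisc z"
    then have "gnorm d > 0" "gnorm d \<le> z" by (auto simp: ndisc_def gdisc_def gnorm_pos)
    then show "97 / 100 * pi * (X / gnorm d) \<le> real (card (gdisc (X / gnorm d)))"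
      by (intro card_gdisc_bounds_large) (simp add: X_def pos_le_divide_eq)
  qed
  also have "\<dots> \<le> (\<Sum>d\<in>ndisc X. gmangoldt d * real (card (gdisc (X / gnorm d))))"
    using gdisc_mono[of z X] assms by (intro sum_mono2) (auto simp: ndisc_def X_def gmangoldt_nonneg)
  also have "\<dots> \<le> real (card (gdisc X)) * ln X"
    unfolding sum_ln_gdisc[symmetric] using X by (intro sum_ln_gdisc_le) auto
  also have "\<dots> \<le> (103 / 100 * pi * X) * ln X"
    using X by (intro mult_right_mono card_gdisc_bounds_large) auto
  finally have "(pi * X) * (97 / 100 * mertens_sum z) \<le> (pi * X) * (103 / 100 * ln X)" by (simp add: mult_ac)
  then have "97 / 100 * mertens_sum z \<le> 103 / 100 * ln X" using X by simp
  then show ?thesis unfolding lnX by (simp add: field_simps)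
qed

text \<open>Cut the range dyadically from above: where Y / (2P) < N d <= Y / P, the hypothesis at Y
  / P bounds the sum of \<Lambda> by c Y / P, and 1 / N d is below 2P / Y. Each dyadic range thus
  contributes at most 2c.\<close>

lemma mertens_sum_diff_le:
  assumes Z: "1 \<le> Z" "Z \<le> Y" and c: "c \<ge> 0"
    and small: "\<And>y. Z \<le> y \<Longrightarrow> y \<le> Y \<Longrightarrow> (\<Sum>d\<in>ndisc y. gmangoldt d) \<le> c * y"
  shows "mertens_sum Y - mertens_sum Z \<le> 2 * c * (log 2 (Y / Z) + 1)"
proof -
  define k where "k = nat \<lfloor>log 2 (Y / Z)\<rfloor> + 1"
  have YZ: "Y / Z \<ge> 1" using Z by simp
  then have lg: "log 2 (Y / Z) \<ge> 0" by simp
  define D where "D = ndisc Y - ndisc Z"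
  have D: "d \<noteq> 0 \<and> Z < gnorm d \<and> gnorm d \<le> Y \<and> normalize d = d" if "d \<in> D" for d
    using that by (auto simp: D_def ndisc_def gdisc_def)
  have "ndisc Z \<subseteq> ndisc Y" using gdisc_mono[OF Z(2)] by (auto simp: ndisc_def)
  then have "mertens_sum Y - mertens_sum Z = (\<Sum>d\<in>D. gmangoldt d / gnorm d)"
    unfolding mertens_sum_def D_def by (subst sum.subset_diff[of "ndisc Z" "ndisc Y"]) auto
  also have "\<dots> = (\<Sum>i<k. \<Sum>d\<in>{d \<in> D. dyadic (Y / gnorm d) = i}. gmangoldt d / gnorm d)"
  proof (rule sum.group[symmetric])
    show "(\<lambda>d. dyadic (Y / gnorm d)) ` D \<subseteq> {..<k}"
    proof (rule image_subsetI)
      fix d assume "d \<in> D"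
      note d = D[OF this]
      have "Y / gnorm d \<le> Y / Z" using d Z by (intro divide_left_mono) auto
      then have "log 2 (Y / gnorm d) \<le> log 2 (Y / Z)" using d Z by simp
      then show "dyadic (Y / gnorm d) \<in> {..<k}"
        unfolding dyadic_def k_def by (simp add: less_Suc_eq_le nat_mono floor_mono)
    qed
  qed (auto simp: D_def)
  also have "\<dots> \<le> (\<Sum>i<k. 2 * c)"
  proof (rule sum_mono)
    fix i
    let ?S = "{d \<in> D. dyadic (Y / gnorm d) = i}"
    define P :: real where "P = 2 ^ i"
    have P: "P \<ge> 1" by (simp add: P_def)
    have S: "P * gnorm d \<le> Y \<and> Y < 2 * P * gnorm d" if "d \<in> ?S" for d
    proof -
      have d: "d \<noteq> 0" "gnorm d \<le> Y" "dyadic (Y / gnorm d) = i" using that D by auto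
      have "Y / gnorm d \<ge> 1" using d gnorm_pos[of d] by simp
      then have "P \<le> Y / gnorm d" "Y / gnorm d < 2 * P" using dyadic_bounds[of "Y / gnorm d"] d(3) by (auto simp: P_def)
      then show ?thesis using gnorm_pos[OF d(1)] by (simp add: field_simps)
    qed
    show "(\<Sum>d\<in>?S. gmangoldt d / gnorm d) \<le> 2 * c"
    proof (cases "?S = {}")
      case True
      then show ?thesis using c by (simp only: sum.empty)
    next
      case False
      then obtain d0 where d0: "d0 \<in> ?S" by blast
      have "Z < gnorm d0" using D d0 by auto
      also have "gnorm d0 \<le> Y / P" using S[OF d0] P by (simp add: field_simps)
      finally have YP: "Z \<le> Y / P" "Y / P \<le> Y" using P Z by (auto simp: divide_le_eq)
      have Ypos: "Y > 0" using Z by simp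
      have "(\<Sum>d\<in>?S. gmangoldt d / gnorm d) \<le> (\<Sum>d\<in>?S. gmangoldt d * (2 * P / Y))"
      proof (rule sum_mono)
        fix d assume d: "d \<in> ?S"
        have pos: "gnorm d > 0" using D d by (auto simp: gnorm_pos)
        have "1 / gnorm d \<le> 2 * P / Y" using S[OF d] pos Ypos by (simp add: field_simps)
        then have "gmangoldt d * (1 / gnorm d) \<le> gmangoldt d * (2 * P / Y)" by (intro mult_left_mono gmangoldt_nonneg)
        then show "gmangoldt d / gnorm d \<le> gmangoldt d * (2 * P / Y)" by simp
      qed
      also have "\<dots> = (\<Sum>d\<in>?S. gmangoldt d) * (2 * P / Y)" by (rule sum_distrib_right[symmetric])
      also have "\<dots> \<le> (c * (Y / P)) * (2 * P / Y)"
      proof (rule mult_right_mono)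
        have "(\<Sum>d\<in>?S. gmangoldt d) \<le> (\<Sum>d\<in>ndisc (Y / P). gmangoldt d)"
        proof (rule sum_mono2)
          show "?S \<subseteq> ndisc (Y / P)"
          proof
            fix d assume d: "d \<in> ?S"
            then have "gnorm d \<le> Y / P" using S[OF d] P by (simp add: field_simps)
            then show "d \<in> ndisc (Y / P)" using D d by (auto simp: ndisc_def gdisc_def)
          qed
        qed (auto simp: gmangoldt_nonneg)
        also have "\<dots> \<le> c * (Y / P)" by (rule small[OF YP])
        finally show "(\<Sum>d\<in>?S. gmangoldt d) \<le> c * (Y / P)" .
      qed (use P Ypos in auto)
      also have "\<dots> = 2 * c" using P Ypos by simp
      finally show ?thesis .
    qed
  qed
  also have "\<dots> = 2 * c * real k" by simp
  also have "\<dots> \<le> 2 * c * (log 2 (Y / Z) + 1)"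
    using c lg by (intro mult_left_mono) (auto simp: k_def)
  finally show ?thesis .
qed

text \<open>Almost all elements of the disc have norm above Y^(99/100), hence a logarithm of at
  least 99/100 ln Y. This crude form loses 1 percent, which the comparison below can afford.\<close>

lemma sum_ln_gdisc_ge:
  "eventually (\<lambda>Y. 98 / 100 * pi * Y * ln Y \<le> (\<Sum>n\<in>gdisc Y. ln (gnorm n))) at_top"
proof -
  have "eventually (\<lambda>Y::real. 98 / 100 * pi * Y * ln Y \<le>
      99 / 100 * ln Y * ((pi * (sqrt Y - 1)\<^sup>2 - 1) - 9 * Y powr (99 / 100))) at_top"
    by real_asymp
  moreover have "eventually (\<lambda>Y::real. Y \<ge> 1) at_top" by (rule eventually_ge_at_top)
  ultimately show ?thesis
  proof eventually_elim
    case (elim Y)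
    define X where "X = Y powr (99 / 100)"
    have "Y powr 0 \<le> Y powr (99 / 100)" using elim by (intro powr_mono) auto
    then have X: "X \<ge> 1" using elim by (simp add: X_def)
    have "Y powr (99 / 100) \<le> Y powr 1" using elim by (intro powr_mono) auto
    then have XY: "X \<le> Y" using elim by (simp add: X_def)
    have lnX: "ln X = 99 / 100 * ln Y" using elim by (simp add: X_def ln_powr)
    have "99 / 100 * ln Y * ((pi * (sqrt Y - 1)\<^sup>2 - 1) - 9 * X) \<le> 99 / 100 * ln Y * (real (card (gdisc Y)) - real (card (gdisc X)))"
      using card_gdisc_ge_pi[of Y] card_gdisc_le[OF X] elim by (intro mult_left_mono diff_mono) auto
    also have "real (card (gdisc Y)) - real (card (gdisc X)) = real (card (gdisc Y - gdisc X))"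
      using gdisc_mono[OF XY] by (simp add: card_Diff_subset card_mono of_nat_diff)
    also have "99 / 100 * ln Y * real (card (gdisc Y - gdisc X)) = (\<Sum>n\<in>gdisc Y - gdisc X. ln X)"
      by (simp add: lnX)
    also have "\<dots> \<le> (\<Sum>n\<in>gdisc Y - gdisc X. ln (gnorm n))"
      using X by (intro sum_mono) (auto simp: gdisc_def gnorm_pos)
    also have "\<dots> \<le> (\<Sum>n\<in>gdisc Y. ln (gnorm n))"
      by (intro sum_mono2) (auto simp: gdisc_def gnorm_ge_1 finite_gdisc[unfolded gdisc_def])
    finally show ?case using elim(1) by (simp add: X_def)
  qed
qed

text \<open>Suppose the Chebyshev function is below y / 100 on the whole range. Then the Mertens sum
  at \<open>Y\<close> is at most about 0.64 ln Y from norms up to Y^(3/5) and 0.02 ln Y from the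
  rest, whereas \<open>sum_ln_gdisc\<close> demands about 0.95 ln Y. The exponent 3/5 is (12/5) / 4,
  the ratio of the ends of the admissible range for y in terms of Q.\<close>

lemma sum_gmangoldt_large:
  "eventually (\<lambda>Y. \<exists>y. Y powr (3 / 5) \<le> y \<and> y \<le> Y \<and> y / 100 \<le> (\<Sum>n\<in>gdisc y. gmangoldt n)) at_top"
proof -
  let ?B = "\<lambda>Y. 103 / 97 * (3 / 5 * ln Y + ln 10000) + 2 * (1 / 100) * (2 / 5 * ln Y / ln 2 + 1) :: real"
  have "eventually (\<lambda>Y::real. 98 / 100 * pi * Y * ln Y > 103 / 100 * pi * Y *
      (?B Y) + 90000 * (1 / 100 * Y)) at_top"
  proof -
    \<comment> \<open>Large enough for ln Y to absorb the crude bound 10000 for ln 10000 and the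
      constant 300, where 300 pi Y dominates the 900 Y coming from small discs.\<close>
    have "eventually (\<lambda>Y::real. Y \<ge> exp 40000) at_top" by (rule eventually_ge_at_top)
    then show ?thesis
    proof eventually_elim
      case (elim Y)
      have "0 < exp (40000 :: real)" by simp
      then have Y: "Y > 0" using elim by linarith
      then have L: "ln Y \<ge> 40000" using elim by (simp add: ln_ge_iff)
      have l2: "ln 2 \<ge> (1 / 2 :: real)" using ln2_ge_two_thirds by linarith
      have "2 / 5 * ln Y / ln 2 \<le> 2 / 5 * ln Y / (1 / 2)"
        using L l2 by (intro divide_left_mono) auto
      moreover have "ln (10000 :: real) \<le> 10000" using ln_le_minus_one[of "10000 :: real"] by simp
      ultimately have "103 / 100 * (?B Y) + 300 < 98 / 100 * ln Y"
        using L by argo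
      then have "(pi * Y) * (103 / 100 * (?B Y) + 300) < (pi * Y) * (98 / 100 * ln Y)"
        using Y by (intro mult_strict_left_mono) auto
      moreover have "90000 * (1 / 100 * Y) \<le> (pi * Y) * 300" using pi_gt3 Y by simp
      ultimately show ?case by (simp add: algebra_simps)
    qed
  qed
  moreover have "eventually (\<lambda>Y::real. Y \<ge> 10000) at_top" by (rule eventually_ge_at_top)
  ultimately show ?thesis using sum_ln_gdisc_ge
  proof eventually_elim
    case (elim Y)
    define Z where "Z = Y powr (3 / 5)"
    have "Y powr 0 \<le> Y powr (3 / 5)" using elim by (intro powr_mono) auto
    then have Z: "Z \<ge> 1" using elim by (simp add: Z_def)
    have "Y powr (3 / 5) \<le> Y powr 1" using elim by (intro powr_mono) auto
    then have ZY: "Z \<le> Y" using elim by (simp add: Z_def)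
    have lnZ: "ln Z = 3 / 5 * ln Y" using elim by (simp add: Z_def ln_powr)
    show ?case
    proof (rule ccontr)
      assume *: "\<not> ?case"
      have small: "(\<Sum>d\<in>ndisc y. gmangoldt d) \<le> 1 / 100 * y" if "Z \<le> y" "y \<le> Y" for y
      proof -
        have "(\<Sum>d\<in>ndisc y. gmangoldt d) \<le> (\<Sum>n\<in>gdisc y. gmangoldt n)"
          by (intro sum_mono2 ndisc_subset) (auto simp: gmangoldt_nonneg)
        also have "\<dots> \<le> 1 / 100 * y" using *[unfolded not_ex, rule_format, of y] that by (simp add: Z_def)
        finally show ?thesis .
      qed
      have "mertens_sum Y \<le> ?B Y"
      proof -
        have "log 2 (Y / Z) = 2 / 5 * ln Y / ln 2"
          using Z ZY by (simp add: log_def ln_div lnZ)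
        moreover have "mertens_sum Y - mertens_sum Z \<le> 2 * (1 / 100) * (log 2 (Y / Z) + 1)"
          by (rule mertens_sum_diff_le[OF Z ZY _ small]) auto
        ultimately show ?thesis using mertens_sum_le[OF Z] unfolding lnZ by argo
      qed
      then have m: "103 / 100 * pi * Y * mertens_sum Y \<le> 103 / 100 * pi * Y *
          (?B Y)"
        using elim by (intro mult_left_mono) auto
      have "(\<Sum>n\<in>gdisc Y. ln (gnorm n)) = (\<Sum>d\<in>ndisc Y. gmangoldt d * real (card (gdisc (Y / gnorm d))))"
        by (rule sum_ln_gdisc)
      also have "\<dots> \<le> (\<Sum>d\<in>ndisc Y. 103 / 100 * pi * Y * (gmangoldt d / gnorm d) + 90000 * gmangoldt d)"
      proof (rule sum_mono)
        fix d assume "d \<in> ndisc Y"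
        then have d: "gnorm d > 0" "gnorm d \<le> Y" by (auto simp: ndisc_def gdisc_def gnorm_pos)
        \<comment> \<open>The precise count is valid only from 10000 on; below that the trivial
          bound 9 * 10000 is added.\<close>
        have "real (card (gdisc (Y / gnorm d))) \<le> 103 / 100 * pi * (Y / gnorm d) + 90000"
        proof (cases "Y / gnorm d \<ge> 10000")
          case True
          then show ?thesis using card_gdisc_bounds_large(2) by fastforce
        next
          case False
          have "Y / gnorm d \<ge> 1" using d by simp
          then have "real (card (gdisc (Y / gnorm d))) \<le> 9 * (Y / gnorm d)" by (rule card_gdisc_le)
          also have "\<dots> \<le> 90000" using False by simp
          finally show ?thesis using d elim by (simp add: add_increasing)
        qed
        then have "gmangoldt d * real (card (gdisc (Y / gnorm d))) \<le> gmangoldt d * (103 / 100 * pi * (Y / gnorm d) + 90000)"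
          by (intro mult_left_mono gmangoldt_nonneg)
        then show "gmangoldt d * real (card (gdisc (Y / gnorm d))) \<le> 103 / 100 * pi * Y * (gmangoldt d / gnorm d) + 90000 * gmangoldt d"
          by (simp add: algebra_simps)
      qed
      also have "\<dots> = 103 / 100 * pi * Y * mertens_sum Y + 90000 * (\<Sum>d\<in>ndisc Y. gmangoldt d)"
        by (simp only: sum.distrib sum_distrib_left mertens_sum_def)
      also have "\<dots> \<le> 103 / 100 * pi * Y * (?B Y)
          + 90000 * (1 / 100 * Y)"
        using small[OF ZY order_refl] m by linarith
      finally show False using elim by linarith
    qed
  qed
qed

subsection \<open>Detecting small distances\<close>

text \<open>Only the sign of the coefficients and the degree matter. Nonnegative coefficients have
  total mass equal to the value at z = 1, which controls all nonzero frequencies together. The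
  degree k (J - 1) is rounded up to \<open>k * J\<close>.\<close>

lemma geometric_power_coeffs:
  "\<exists>q :: nat \<Rightarrow> real. (\<forall>i. q i \<ge> 0) \<and> (\<forall>z :: complex. (\<Sum>j<J. z ^ j) ^ k = (\<Sum>i\<le>k * J. of_real (q i) * z ^ i))"
proof (induction k)
  case 0
  show ?case by (rule exI[of _ "\<lambda>_. 1"]) simp
next
  case (Suc k)
  then obtain q :: "nat \<Rightarrow> real" where q: "\<And>i. q i \<ge> 0" "\<And>z :: complex. (\<Sum>j<J. z ^ j) ^ k = (\<Sum>i\<le>k * J. of_real (q i) * z ^ i)"
    by blast
  define r where "r = (\<lambda>m. \<Sum>(i, j)\<in>{p \<in> {..k * J} \<times> {..<J}. fst p + snd p = m}. q i)"
  have "(\<Sum>j<J. z ^ j) ^ Suc k = (\<Sum>m\<le>Suc k * J. of_real (r m) * z ^ m)" for z :: complex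
  proof -
    have "(\<Sum>j<J. z ^ j) ^ Suc k = (\<Sum>i\<le>k * J. of_real (q i) * z ^ i) * (\<Sum>j<J. z ^ j)"
      by (simp add: q(2) mult.commute)
    also have "\<dots> = (\<Sum>p\<in>{..k * J} \<times> {..<J}. of_real (q (fst p)) * z ^ (fst p + snd p))"
      unfolding sum_product sum.cartesian_product by (intro sum.cong refl) (auto simp: power_add mult_ac)
    also have "\<dots> = (\<Sum>m\<le>Suc k * J. \<Sum>p\<in>{p \<in> {..k * J} \<times> {..<J}. fst p + snd p = m}. of_real (q (fst p)) * z ^ (fst p + snd p))"
      by (rule sum.group[symmetric]) auto
    also have "\<dots> = (\<Sum>m\<le>Suc k * J. of_real (r m) * z ^ m)"
      unfolding r_def of_real_sum sum_distrib_right
      by (intro sum.cong refl) (auto simp: case_prod_unfold)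
    finally show ?thesis .
  qed
  moreover have "r m \<ge> 0" for m unfolding r_def by (intro sum_nonneg) (auto simp: q(1))
  ultimately show ?case by blast
qed

definition geometric_kernel :: "nat \<Rightarrow> real \<Rightarrow> complex" where
  "geometric_kernel J u = (\<Sum>j<J. cis (2 * pi * u) ^ j)"

lemma cmod_geometric_kernel_le: "cmod (geometric_kernel J u) \<le> real J"
  unfolding geometric_kernel_def by (rule order_trans[OF norm_sum]) (simp add: norm_power)

lemma cmod_geometric_kernel_dist: "cmod (geometric_kernel J u) * dist_nearest_int u \<le> 1"
proof (cases "J = 0")
  case False
  have "geometric_kernel J u = (\<Sum>a\<in>{0..int J - 1}. cis (2 * pi * (u * of_int a)))"
    unfolding geometric_kernel_def
  proof (rule sum.reindex_bij_witness[of _ nat int])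
    fix a assume "a \<in> {0..int J - 1}"
    then show "nat a \<in> {..<J}" using False by auto
  qed (auto simp: Complex.DeMoivre mult_ac)
  then show ?thesis using cmod_sum_cis_le by simp
qed (simp add: geometric_kernel_def)

text \<open>A power of the Fejer kernel in each coordinate, up to scaling. The high power makes the
  weight at distances beyond \<delta> smaller than the peak by (1 / (\<delta> J))^(2k), so with
  large \<open>k\<close> a distance only slightly above 1 / J is detected.\<close>

definition kernel_weight :: "nat \<Rightarrow> nat \<Rightarrow> complex \<Rightarrow> real" where
  "kernel_weight J k z = (cmod (geometric_kernel J (Re z) ^ k))\<^sup>2 * (cmod (geometric_kernel J (Im z) ^ k))\<^sup>2"

lemma cmod_geometric_kernel_power_le: "(cmod (geometric_kernel J u ^ k))\<^sup>2 \<le> real J ^ (2 * k)"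
proof -
  have "(cmod (geometric_kernel J u ^ k))\<^sup>2 = cmod (geometric_kernel J u) ^ (2 * k)" by (simp add: norm_power power_even_eq)
  also have "\<dots> \<le> real J ^ (2 * k)" by (intro power_mono cmod_geometric_kernel_le) auto
  finally show ?thesis .
qed

lemma kernel_weight_le: "kernel_weight J k z \<le> real J ^ (4 * k)"
proof -
  have "kernel_weight J k z \<le> real J ^ (2 * k) * real J ^ (2 * k)"
    unfolding kernel_weight_def by (intro mult_mono cmod_geometric_kernel_power_le) auto
  then show ?thesis by (simp flip: power_add)
qed

lemma kernel_weight_le_far:
  assumes "\<delta> > 0" "gdist z > \<delta>"
  shows "kernel_weight J k z \<le> real J ^ (2 * k) * (1 / \<delta>) ^ (2 * k)"
proof -
  have *: "(cmod (geometric_kernel J u ^ k))\<^sup>2 \<le> (1 / \<delta>) ^ (2 * k)" if "dist_nearest_int u > \<delta>" for u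
  proof -
    have "cmod (geometric_kernel J u) * \<delta> \<le> cmod (geometric_kernel J u) * dist_nearest_int u" using that by (intro mult_left_mono) auto
    then have "cmod (geometric_kernel J u) \<le> 1 / \<delta>" using cmod_geometric_kernel_dist[of J u] assms(1) by (simp add: field_simps)
    then have "cmod (geometric_kernel J u) ^ (2 * k) \<le> (1 / \<delta>) ^ (2 * k)" by (intro power_mono) auto
    then show ?thesis by (simp add: norm_power power_even_eq)
  qed
  have "dist_nearest_int (Re z) > \<delta> \<or> dist_nearest_int (Im z) > \<delta>"
    using assms(2) by (auto simp: dist_nearest_gauss_int_def max_def split: if_splits)
  then show ?thesis
  proof
    assume "dist_nearest_int (Re z) > \<delta>"
    then have "kernel_weight J k z \<le> (1 / \<delta>) ^ (2 * k) * real J ^ (2 * k)"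
      unfolding kernel_weight_def using assms by (intro mult_mono * cmod_geometric_kernel_power_le) auto
    then show ?thesis by (simp add: mult.commute)
  next
    assume "dist_nearest_int (Im z) > \<delta>"
    then show ?thesis
      unfolding kernel_weight_def using assms by (intro mult_mono * cmod_geometric_kernel_power_le) auto
  qed
qed

text \<open>Expand the weight into characters with nonnegative coefficients of total mass J^(4k).
  Each nonzero frequency contributes at least -M times its coefficient. Frequency zero carries the
  Chebyshev function, and Cauchy-Schwarz shows that its coefficient is at least a proportion 1 / (k
  J + 1)^2 of the mass.\<close>

lemma sum_gmangoldt_kernel_weight_ge:
  assumes k: "k \<ge> 1" and J: "J \<ge> 1"
    and M: "\<And>h. h \<noteq> 0 \<Longrightarrow> gnorm h \<le> 2 * (real (k * J))\<^sup>2 \<Longrightarrow> cmod (\<Sum>n\<in>gdisc y. gmangoldt n * gchar (cx h * \<theta>) n) \<le> M"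
  shows "real J ^ (4 * k) * ((\<Sum>n\<in>gdisc y. gmangoldt n) / (real (k * J + 1))\<^sup>2 - M) \<le> (\<Sum>n\<in>gdisc y. gmangoldt n * kernel_weight J k (cx n * \<theta>))"
proof -
  let ?W = "\<Sum>n\<in>gdisc y. gmangoldt n * kernel_weight J k (cx n * \<theta>)"
  let ?D = "(\<lambda>(i, l). ((i, i), (l, l))) ` ({..k * J} \<times> {..k * J})"
  let ?I = "{..k * J}"
  let ?T = "(?I \<times> ?I) \<times> (?I \<times> ?I)"
  let ?\<psi> = "\<Sum>n\<in>gdisc y. gmangoldt n"
  obtain q :: "nat \<Rightarrow> real" where q: "\<And>i. q i \<ge> 0" "\<And>z :: complex. (\<Sum>j<J. z ^ j) ^ k = (\<Sum>i\<in>?I. of_real (q i) * z ^ i)"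
    using geometric_power_coeffs[of J k] by blast
  define c where "c = (\<lambda>((i, j), (l, m)). q i * q j * (q l * q m))"
  \<comment> \<open>The sign of the imaginary part is chosen because
    \<open>Re ((a - b * \<i>) * z) = a * Re z + b * Im z\<close>, so one Gaussian integer encodes
    the frequencies of both coordinates.\<close>
  define hh where "hh = (\<lambda>((i, j), (l, m)). gauss_of (int i - int j) (- (int l - int m)))"
  define S where "S = (\<lambda>h. \<Sum>n\<in>gdisc y. gmangoldt n * gchar (cx h * \<theta>) n)"
  have c0: "c t \<ge> 0" for t by (auto simp: c_def q split: prod.split)
  have sumq: "(\<Sum>i\<in>?I. q i) = real J ^ k"
    using arg_cong[OF q(2)[of 1], of Re] by (simp flip: of_nat_power)
  have geometric_kernel: "(cmod (geometric_kernel J u ^ k))\<^sup>2 = (\<Sum>(i, j)\<in>?I \<times> ?I. q i * q j * cis (2 * pi * (real i - real j) * u))" for u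
  proof -
    have "complex_of_real ((cmod (geometric_kernel J u ^ k))\<^sup>2) = geometric_kernel J u ^ k * cnj (geometric_kernel J u ^ k)"
      by (rule complex_norm_square)
    also have "\<dots> = (\<Sum>i\<in>?I. q i * cis (2 * pi * u) ^ i) * (\<Sum>j\<in>?I. q j * cnj (cis (2 * pi * u) ^ j))"
      unfolding geometric_kernel_def q(2) by simp
    also have "\<dots> = (\<Sum>(i, j)\<in>?I \<times> ?I. q i * cis (2 * pi * u) ^ i * (q j * cnj (cis (2 * pi * u) ^ j)))"
      by (simp add: sum_product sum.cartesian_product)
    also have "\<dots> = (\<Sum>(i, j)\<in>?I \<times> ?I. q i * q j * cis (2 * pi * (real i - real j) * u))"
      by (intro sum.cong refl) (auto simp: Complex.DeMoivre cis_cnj cis_mult algebra_simps)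
    finally show ?thesis by simp
  qed
  have kernel_weight: "complex_of_real (kernel_weight J k (cx n * \<theta>)) = (\<Sum>t\<in>?T. c t * gchar (cx (hh t) * \<theta>) n)" for n
  proof -
    have "complex_of_real (kernel_weight J k (cx n * \<theta>)) =
      (\<Sum>p\<in>?I \<times> ?I. case p of (i, j) \<Rightarrow> q i * q j * cis (2 * pi * (real i - real j) * Re (cx n * \<theta>))) *
      (\<Sum>p\<in>?I \<times> ?I. case p of (l, m) \<Rightarrow> q l * q m * cis (2 * pi * (real l - real m) * Im (cx n * \<theta>)))"
      unfolding kernel_weight_def of_real_mult geometric_kernel ..
    also have "\<dots> = (\<Sum>t\<in>?T. (case fst t of (i, j) \<Rightarrow> q i * q j * cis (2 * pi * (real i - real j) * Re (cx n * \<theta>))) *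
        (case snd t of (l, m) \<Rightarrow> q l * q m * cis (2 * pi * (real l - real m) * Im (cx n * \<theta>))))"
      unfolding sum_product sum.cartesian_product by (simp add: case_prod_unfold)
    also have "\<dots> = (\<Sum>t\<in>?T. c t * gchar (cx (hh t) * \<theta>) n)"
      by (intro sum.cong refl)
         (auto simp: c_def hh_def gchar_def cx_gauss_of cis_mult algebra_simps)
    finally show ?thesis .
  qed
  have "complex_of_real ?W = (\<Sum>n\<in>gdisc y. \<Sum>t\<in>?T. c t * (gmangoldt n * gchar (cx (hh t) * \<theta>) n))"
    unfolding of_real_sum of_real_mult kernel_weight sum_distrib_left by (simp add: mult_ac)
  also have "\<dots> = (\<Sum>t\<in>?T. c t * S (hh t))"
    unfolding S_def sum_distrib_left by (rule sum.swap)
  finally have "?W = Re (\<Sum>t\<in>?T. c t * S (hh t))"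
    by (metis Re_complex_of_real)
  also have "\<dots> = (\<Sum>t\<in>?T. c t * Re (S (hh t)))" by simp
  also have "\<dots> \<ge> (\<Sum>t\<in>?T. (if hh t = 0 then c t * ?\<psi> else 0) - c t * M)"
  proof (rule sum_mono)
    fix t assume t: "t \<in> ?T"
    \<comment> \<open>The hypothesis at \<open>h = 1\<close> is available because k J >= 1.
      Nonnegativity allows subtracting \<open>c t * M\<close> at frequency zero as well, so that the
      subtracted total is the full mass.\<close>
    have M0: "M \<ge> 0"
    proof -
      have "(1 :: real)\<^sup>2 \<le> (real (k * J))\<^sup>2" using k J by (intro power_mono) (simp_all add: Suc_le_eq flip: of_nat_mult)
      then show ?thesis using order_trans[OF norm_ge_zero M[of 1]] by simp
    qed
    show "(if hh t = 0 then c t * ?\<psi> else 0) - c t * M \<le> c t * Re (S (hh t))"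
    proof (cases "hh t = 0")
      case True
      then have "Re (S (hh t)) = ?\<psi>" by (simp add: S_def gchar_def)
      then show ?thesis using True c0[of t] M0 by simp
    next
      case False
      have "gnorm (hh t) \<le> 2 * (real (k * J))\<^sup>2"
      proof -
        obtain i j l m where ijlm: "t = ((i, j), (l, m))" by (metis surj_pair)
        have "(int i - int j)\<^sup>2 \<le> (int (k * J))\<^sup>2" "(int l - int m)\<^sup>2 \<le> (int (k * J))\<^sup>2"
          using t unfolding ijlm abs_le_square_iff[symmetric] by (simp_all del: of_nat_mult) linarith+
        then have "(int i - int j)\<^sup>2 + (- (int l - int m))\<^sup>2 \<le> 2 * (int (k * J))\<^sup>2" by (simp add: power2_commute)
        then have "real_of_int ((int i - int j)\<^sup>2 + (- (int l - int m))\<^sup>2) \<le> real_of_int (2 * (int (k * J))\<^sup>2)"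
          by (simp only: of_int_le_iff)
        then show ?thesis unfolding gnorm_eq ijlm hh_def by simp
      qed
      then have "cmod (S (hh t)) \<le> M" unfolding S_def by (rule M[OF False])
      then have "- M \<le> Re (S (hh t))" using abs_Re_le_cmod[of "S (hh t)"] by linarith
      then have "c t * (- M) \<le> c t * Re (S (hh t))" using c0 by (intro mult_left_mono)
      then show ?thesis using False by simp
    qed
  qed
  also have "(\<Sum>t\<in>?T. (if hh t = 0 then c t * ?\<psi> else 0) - c t * M) =
      (\<Sum>t\<in>?T. if hh t = 0 then c t * ?\<psi> else 0) - (\<Sum>t\<in>?T. c t) * M"
    by (simp add: sum_subtractf sum_distrib_right)
  also have "(\<Sum>t\<in>?T. c t) = real J ^ (4 * k)"
  proof -
    have "(\<Sum>t\<in>?T. c t) = ((\<Sum>i\<in>?I. q i) * (\<Sum>i\<in>?I. q i)) * ((\<Sum>i\<in>?I. q i) * (\<Sum>i\<in>?I. q i))"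
      unfolding sum_product sum.cartesian_product c_def by (simp add: case_prod_unfold)
    moreover have "k + k + (k + k) = 4 * k" by simp
    ultimately show ?thesis unfolding sumq power_add[symmetric] by metis
  qed
  finally have lower: "(\<Sum>t\<in>?T. if hh t = 0 then c t * ?\<psi> else 0) - real J ^ (4 * k) * M
      \<le> ?W" .
  have diag: "(\<Sum>t\<in>?T. if hh t = 0 then c t * ?\<psi> else 0) \<ge> (\<Sum>t\<in>?D. c t * ?\<psi>)"
  proof -
    have "(\<Sum>t\<in>?D. c t * ?\<psi>) =
        (\<Sum>t\<in>?D. if hh t = 0 then c t * ?\<psi> else 0)"
    proof (intro sum.cong refl)
      fix t assume "t \<in> ?D"
      then have "hh t = 0" by (auto simp: hh_def gauss_int_eq_iff gre_def gim_def cx_gauss_of)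
      then show "c t * ?\<psi> = (if hh t = 0 then c t * ?\<psi> else 0)" by simp
    qed
    also have "\<dots> \<le> (\<Sum>t\<in>?T. if hh t = 0 then c t * ?\<psi> else 0)"
      by (intro sum_mono2) (auto intro!: mult_nonneg_nonneg c0 sum_nonneg gmangoldt_nonneg)
    finally show ?thesis .
  qed
  have diag_eq: "(\<Sum>t\<in>?D. c t * P) =
      (\<Sum>i\<in>?I. (q i)\<^sup>2) * (\<Sum>l\<in>?I. (q l)\<^sup>2) * P" for P
  proof -
    have "(\<Sum>i\<in>?I. (q i)\<^sup>2) * (\<Sum>l\<in>?I. (q l)\<^sup>2) = (\<Sum>p\<in>?I \<times> ?I. (q (fst p))\<^sup>2 * (q (snd p))\<^sup>2)"
      unfolding sum_product sum.cartesian_product by (simp add: case_prod_unfold)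
    moreover have "(\<Sum>t\<in>?D. c t * P) =
        (\<Sum>p\<in>?I \<times> ?I. (q (fst p))\<^sup>2 * (q (snd p))\<^sup>2 * P)"
      by (subst sum.reindex) (auto simp: inj_on_def c_def power2_eq_square mult_ac intro!: sum.cong)
    ultimately show ?thesis by (simp only: sum_distrib_right)
  qed
  \<comment> \<open>The coefficients sum to J^k and there are k J + 1 of them, so Cauchy-Schwarz
    bounds the sum of their squares from below.\<close>
  have "(\<Sum>i\<in>?I. (q i)\<^sup>2) * (\<Sum>l\<in>?I. (q l)\<^sup>2) * ?\<psi> \<ge> (real J ^ (2 * k) / real (k * J + 1)) * (real J ^ (2 * k) / real (k * J + 1)) * ?\<psi>"
  proof -
    have "(\<Sum>i\<in>?I. q i)\<^sup>2 \<le> (\<Sum>i\<in>?I. (q i)\<^sup>2) * real (card ?I)"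
      by (rule sum_squared_le_sum_of_squares)
    then have "real J ^ (2 * k) / real (k * J + 1) \<le> (\<Sum>i\<in>?I. (q i)\<^sup>2)"
      unfolding sumq by (subst pos_divide_le_eq) (simp_all add: power_even_eq add_pos_nonneg)
    then show ?thesis
      by (intro mult_right_mono mult_mono) (auto intro!: sum_nonneg gmangoldt_nonneg)
  qed
  then have "(real J ^ (2 * k) / real (k * J + 1)) * (real J ^ (2 * k) / real (k * J + 1)) * ?\<psi> - real J ^ (4 * k) * M
      \<le> ?W" using lower diag unfolding diag_eq by linarith
  moreover have "(real J ^ (2 * k) / real (k * J + 1)) * (real J ^ (2 * k) / real (k * J + 1)) * ?\<psi> = real J ^ (4 * k) * (?\<psi> / (real (k * J + 1))\<^sup>2)"
    by (simp add: power2_eq_square flip: power_add)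
  ultimately show ?thesis by (simp only: right_diff_distrib)
qed

section \<open>From the weighted sum to a prime\<close>

lemma gmangoldt_nonprime_obtain:
  assumes "n \<noteq> 0" "gmangoldt n \<noteq> 0" "\<not> prime_elem n"
  obtains p j where "prime p" "j \<ge> 2" "normalize n = normalize (p ^ j)"
proof -
  have "card (prime_factors n) = 1" using assms(2) by (auto simp: gmangoldt_def split: if_splits)
  then obtain p where p: "prime_factors n = {p}" by (auto simp: card_1_singleton_iff)
  define j where "j = count (prime_factorization n) p"
  have "prime p" using p by (metis in_prime_factors_imp_prime singletonI)
  have "prime_factorization n = replicate_mset j p"
    using p by (intro multiset_eqI) (auto simp: j_def not_in_iff[symmetric])
  then have nn: "normalize n = normalize (p ^ j)"
    using prod_mset_prime_factorization_weak[OF assms(1)] by simp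
  have "j \<noteq> 0" using p by (simp add: j_def count_eq_zero_iff)
  moreover have "j \<noteq> 1"
  proof
    assume "j = 1"
    then have "normalize n = p" using nn \<open>prime p\<close> by simp
    then have "prime_elem (normalize n)" using \<open>prime p\<close> by simp
    then show False using assms(3) by simp
  qed
  ultimately have "j \<ge> 2" by linarith
  then show ?thesis using that \<open>prime p\<close> nn by blast
qed

text \<open>A contributing \<open>n\<close> is a unit times the normalized power p^j with j >= 2.
  Then N p <= sqrt y, j < N because 2^j <= N p^j <= y, and the unit lies in \<open>gdisc 1\<close>;
  the count 9 * (9 sqrt y) * N gives the constant 81.\<close>

lemma sum_gmangoldt_nonprime_le:
  assumes y: "y \<ge> 1" "y < 2 ^ N"
  shows "(\<Sum>n\<in>{n \<in> gdisc y. \<not> prime_elem n}. gmangoldt n) \<le> 81 * sqrt y * real N * ln y"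
proof -
  let ?A = "{n \<in> gdisc y. \<not> prime_elem n \<and> gmangoldt n \<noteq> 0}"
  have sy: "sqrt y \<ge> 1" using y by simp
  have "?A \<subseteq> (\<lambda>(u, p, j). u * normalize (p ^ j)) ` (gdisc 1 \<times> gdisc (sqrt y) \<times> {..<N})"
  proof
    fix n assume n: "n \<in> ?A"
    then have n0: "n \<noteq> 0" "gnorm n \<le> y" by (auto simp: gdisc_def)
    obtain p j where pj: "prime p" "j \<ge> 2" "normalize n = normalize (p ^ j)"
      using gmangoldt_nonprime_obtain[of n] n n0 by auto
    have p2: "gnorm p \<ge> 2" by (rule gnorm_prime_ge_2[OF pj(1)])
    have "gnorm (normalize n) = gnorm (normalize (p ^ j))" using pj(3) by simp
    then have pn: "gnorm p ^ j \<le> y" using n0 by (simp add: gnorm_power)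
    have "gnorm p ^ 2 \<le> gnorm p ^ j" using p2 pj by (intro power_increasing) auto
    then have "gnorm p \<le> sqrt y" using pn by (intro real_le_rsqrt) linarith
    moreover have "j < N"
    proof -
      have "2 ^ j \<le> gnorm p ^ j" using p2 by (intro power_mono) auto
      then have "(2 :: real) ^ j < 2 ^ N" using pn y by linarith
      then show ?thesis by simp
    qed
    moreover have "unit_factor n \<in> gdisc 1" using n0 is_unit_gnorm[of "unit_factor n"] by (simp add: gdisc_def)
    moreover have "n = unit_factor n * normalize (p ^ j)" using pj(3) by (metis unit_factor_mult_normalize)
    moreover have "p \<noteq> 0" using pj by auto
    ultimately show "n \<in> (\<lambda>(u, p, j). u * normalize (p ^ j)) ` (gdisc 1 \<times> gdisc (sqrt y) \<times> {..<N})"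
      by (intro image_eqI[of _ _ "(unit_factor n, p, j)"]) (auto simp: gdisc_def)
  qed
  then have "card ?A \<le> card ((\<lambda>(u, p, j). u * normalize (p ^ j)) ` (gdisc 1 \<times> gdisc (sqrt y) \<times> {..<N}))"
    by (intro card_mono) auto
  also have "\<dots> \<le> card (gdisc 1 \<times> gdisc (sqrt y) \<times> {..<N})" by (intro card_image_le) auto
  also have "real \<dots> = real (card (gdisc 1)) * real (card (gdisc (sqrt y))) * real N"
    by (simp add: card_cartesian_product)
  also have "\<dots> \<le> 9 * (9 * sqrt y) * real N"
    using card_gdisc_le[of 1] card_gdisc_le[OF sy] by (intro mult_right_mono mult_mono) auto
  finally have card: "real (card ?A) \<le> 81 * sqrt y * real N" by simp
  have "(\<Sum>n\<in>{n \<in> gdisc y. \<not> prime_elem n}. gmangoldt n) = (\<Sum>n\<in>?A. gmangoldt n)"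
    by (rule sum.mono_neutral_right) auto
  also have "\<dots> \<le> real (card ?A) * ln y"
  proof (rule sum_bounded_above)
    fix n assume "n \<in> ?A"
    then have n: "n \<noteq> 0" "gnorm n \<le> y" by (auto simp: gdisc_def)
    have "ln (gnorm n) \<le> ln y" using n y gnorm_pos[of n] by simp
    then show "gmangoldt n \<le> ln y" using gmangoldt_le[OF n(1)] by linarith
  qed
  also have "\<dots> \<le> 81 * sqrt y * real N * ln y" using card y by (intro mult_right_mono) auto
  finally show ?thesis .
qed

text \<open>If no prime were close, primes would only receive the tail of the weight and all other
  elements at most its peak J^(4k). Dividing by the peak contradicts the lower bound for the
  weighted sum.\<close>

lemma ex_prime_close:
  assumes k: "k \<ge> 1" and J: "J \<ge> 1" and y: "y \<ge> 1" "y < 2 ^ N" and \<delta>: "\<delta> > 0"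
    and M: "\<And>h. h \<noteq> 0 \<Longrightarrow> gnorm h \<le> 2 * (real (k * J))\<^sup>2 \<Longrightarrow> cmod (\<Sum>n\<in>gdisc y. gmangoldt n * gchar (cx h * \<theta>) n) \<le> M"
    and main: "M + 81 * sqrt y * real N * ln y + (1 / (\<delta> * real J)) ^ (2 * k) * (\<Sum>n\<in>gdisc y. gmangoldt n) < (\<Sum>n\<in>gdisc y. gmangoldt n) / (real (k * J + 1))\<^sup>2"
  shows "\<exists>p. prime_elem p \<and> gnorm p \<le> y \<and> gdist (cx p * \<theta>) \<le> \<delta>"
proof (rule ccontr)
  assume "\<not> ?thesis"
  then have far: "gdist (cx p * \<theta>) > \<delta>" if "prime_elem p" "p \<in> gdisc y" for p
    using that by (auto simp: gdisc_def not_le)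
  let ?\<psi> = "\<Sum>n\<in>gdisc y. gmangoldt n"
  let ?J = "real J ^ (4 * k)"
  have Jpos: "?J > 0" using J by simp
  have "?J * (?\<psi> / (real (k * J + 1))\<^sup>2 - M) \<le> (\<Sum>n\<in>gdisc y. gmangoldt n * kernel_weight J k (cx n * \<theta>))"
    by (rule sum_gmangoldt_kernel_weight_ge[OF k J M])
  also have "\<dots> \<le> (\<Sum>n\<in>gdisc y. ?J * ((1 / (\<delta> * real J)) ^ (2 * k) * gmangoldt n) + (if \<not> prime_elem n then ?J * gmangoldt n else 0))"
  proof (rule sum_mono)
    fix n assume n: "n \<in> gdisc y"
    show "gmangoldt n * kernel_weight J k (cx n * \<theta>) \<le> ?J * ((1 / (\<delta> * real J)) ^ (2 * k) * gmangoldt n) + (if \<not> prime_elem n then ?J * gmangoldt n else 0)"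
    proof (cases "prime_elem n")
      case True
      have "gmangoldt n * kernel_weight J k (cx n * \<theta>) \<le> gmangoldt n * (real J ^ (2 * k) * (1 / \<delta>) ^ (2 * k))"
        using far[OF True n] \<delta> by (intro mult_left_mono kernel_weight_le_far gmangoldt_nonneg)
      also have "real J ^ (2 * k) * (1 / \<delta>) ^ (2 * k) = ?J * (1 / (\<delta> * real J)) ^ (2 * k)"
      proof -
        have "?J = real J ^ (2 * k) * real J ^ (2 * k)" by (simp flip: power_add)
        then show ?thesis using J by (simp add: power_divide power_mult_distrib)
      qed
      finally show ?thesis using True by (simp add: mult_ac)
    next
      case False
      have "gmangoldt n * kernel_weight J k (cx n * \<theta>) \<le> gmangoldt n * ?J" by (intro mult_left_mono kernel_weight_le gmangoldt_nonneg)
      moreover have "0 \<le> ?J * ((1 / (\<delta> * real J)) ^ (2 * k) * gmangoldt n)"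
        using \<delta> by (intro mult_nonneg_nonneg gmangoldt_nonneg) auto
      ultimately show ?thesis using False by (simp add: mult.commute)
    qed
  qed
  also have "\<dots> = ?J * ((1 / (\<delta> * real J)) ^ (2 * k) * ?\<psi>) + ?J * (\<Sum>n\<in>{n \<in> gdisc y. \<not> prime_elem n}. gmangoldt n)"
    by (simp only: sum.distrib sum_distrib_left sum.inter_filter[OF finite_gdisc, symmetric])
  also have "\<dots> \<le> ?J * ((1 / (\<delta> * real J)) ^ (2 * k) * ?\<psi>) + ?J * (81 * sqrt y * real N * ln y)"
    using sum_gmangoldt_nonprime_le[OF y] Jpos by (intro add_left_mono mult_left_mono) auto
  finally have "?J * (?\<psi> / (real (k * J + 1))\<^sup>2 - M) \<le> ?J * ((1 / (\<delta> * real J)) ^ (2 * k) * ?\<psi> + 81 * sqrt y * real N * ln y)"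
    by (simp only: distrib_left)
  then have "?\<psi> / (real (k * J + 1))\<^sup>2 - M \<le> (1 / (\<delta> * real J)) ^ (2 * k) * ?\<psi> + 81 * sqrt y * real N * ln y"
    using Jpos by (simp only: mult_le_cancel_left_pos)
  then show False using main by linarith
qed

subsection \<open>Combining the estimates\<close>

lemma sum_gmangoldt_le: "y \<ge> 1 \<Longrightarrow> (\<Sum>n\<in>gdisc y. gmangoldt n) \<le> 9 * y * ln y"
proof -
  assume y: "y \<ge> 1"
  have "(\<Sum>n\<in>gdisc y. gmangoldt n) \<le> real (card (gdisc y)) * ln y"
  proof (rule sum_bounded_above)
    fix n assume "n \<in> gdisc y"
    then have n: "n \<noteq> 0" "gnorm n \<le> y" by (auto simp: gdisc_def)
    then have "ln (gnorm n) \<le> ln y" using y gnorm_pos[of n] by simp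
    then show "gmangoldt n \<le> ln y" using gmangoldt_le[OF n(1)] by linarith
  qed
  also have "\<dots> \<le> 9 * y * ln y" using y card_gdisc_le[OF y] by (intro mult_right_mono) auto
  finally show ?thesis .
qed

text \<open>With these cuts every type I term is at most K y^(11/12), and every term of the type II
  factor under the root is at most K y^(5/6), so that after multiplication by y the root is again of
  order y^(11/12). \<open>K\<close> allows the frequencies to exceed y^(1/12) by a constant.\<close>

lemma exp_sum_bound_powr:
  assumes well_spaced: "well_spaced \<theta> Q" and Q: "y powr (1/4) \<le> Q" "Q \<le> y powr (5/12)"
    and y: "y \<ge> exp 1" "y < 2 ^ N" and N: "real N \<le> 3 * ln y"
    and K: "K \<ge> 1" and h: "h \<noteq> 0" "gnorm h \<le> K * y powr (1/12)"
  shows "cmod (\<Sum>m\<in>gdisc y. gmangoldt m * gchar (cx h * \<theta>) m) \<le> 12000000 * K * (ln y)\<^sup>2 * y powr (11/12)"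
proof -
  define L where "L = ln y"
  define x where "x = y powr (11/12)"
  define w where "w = y powr (5/6)"
  define H where "H = K * y powr (1/12)"
  define U where "U = y powr (1/6)"
  define V where "V = y powr (1/2)"
  let ?S = "y / U + Q * sqrt (y / U) + H * y / sqrt V + H * y / Q"
  have "exp 1 \<ge> (1 :: real)" by simp
  then have y1: "y \<ge> 1" using y by linarith
  have L: "L \<ge> 1" using y y1 by (simp add: L_def ln_ge_iff)
  have pw: "y powr a \<le> y powr b" if "a \<le> b" for a b using that y1 by (intro powr_mono) auto
  have pw1: "y powr a \<ge> 1" if "a \<ge> 0" for a using that y1 by (intro ge_one_powr_ge_zero) auto
  have sq: "sqrt (y powr a) = y powr (a / 2)" for a
    using y1 by (simp add: powr_half_sqrt[symmetric] powr_powr)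
  have sqy: "sqrt y = y powr (1/2)" using y1 by (simp add: powr_half_sqrt)
  have Q0: "Q > 0" using Q(1) pw1[of "1/4"] by simp
  have H0: "H \<ge> 0" using K by (simp add: H_def)
  have UV: "U * V = y powr (2/3)" by (simp add: U_def V_def flip: powr_add)
  have UVy: "U * V \<le> y" unfolding UV using pw[of "2/3" 1] y1 by simp
  have wx: "w \<le> x" unfolding w_def x_def by (rule pw) simp
  have x0: "x \<ge> 1" "w \<ge> 1" by (auto simp: x_def w_def intro!: pw1)
  have U0: "U \<ge> 0" by (simp add: U_def)
  have t1: "U \<le> x" unfolding U_def x_def by (rule pw) simp
  have t2: "Q * sqrt y \<le> x"
  proof -
    have "Q * sqrt y \<le> y powr (5/12) * y powr (1/2)" unfolding sqy using Q by (intro mult_right_mono) auto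
    then show ?thesis by (simp add: x_def flip: powr_add)
  qed
  have t3: "H * sqrt (y * (U * V)) = K * x"
  proof -
    have "y * (U * V) = y powr (5/3)" using y1 powr_add[of y 1 "2/3"] by (simp add: UV)
    then show ?thesis by (simp add: sq H_def x_def flip: powr_add)
  qed
  have Hy: "H * y = K * y powr (13/12)" using y1 powr_add[of y "1/12" 1] by (simp add: H_def)
  have t4: "H * y / Q \<le> K * w"
  proof -
    have "H * y / Q \<le> H * y / y powr (1/4)" using Q Q0 H0 y1 pw1[of "1/4"] by (intro divide_left_mono mult_pos_pos) auto
    also have "\<dots> = K * (y powr (13/12) / y powr (1/4))" unfolding Hy by simp
    also have "\<dots> = K * w" by (simp add: w_def flip: powr_diff)
    finally show ?thesis .
  qed
  have yU: "y / U = w" using y1 powr_diff[of y 1 "1/6"] by (simp add: U_def w_def)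
  have t5: "Q * sqrt (y / U) \<le> w"
  proof -
    have "Q * sqrt (y / U) \<le> y powr (5/12) * y powr (5/12)" unfolding yU unfolding w_def sq using Q by (intro mult_mono) auto
    then show ?thesis by (simp add: w_def flip: powr_add)
  qed
  have t6: "H * y / sqrt V = K * w"
  proof -
    have "H * y / sqrt V = K * (y powr (13/12) / y powr (1/4))" unfolding Hy V_def sq by simp
    then show ?thesis by (simp add: w_def flip: powr_diff)
  qed
  have root: "sqrt (y * (?S)) \<le> 2 * K * x"
  proof (rule real_le_lsqrt)
    have "w \<le> K * w" using K x0 by simp
    then have "?S \<le> 4 * (K * w)"
      using t4 t5 t6 yU by linarith
    then have "y * (?S) \<le> y * (4 * (K * w))"
      using y1 by (intro mult_left_mono) auto
    also have "\<dots> = 4 * K * (y powr 1 * y powr (5/6))" using y1 by (simp add: w_def)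
    also have "y powr 1 * y powr (5/6) = x\<^sup>2"
      unfolding x_def power2_eq_square powr_add[symmetric] by simp
    also have "4 * K * x\<^sup>2 \<le> 4 * K\<^sup>2 * x\<^sup>2"
      using K by (intro mult_right_mono) (auto simp: power2_eq_square)
    also have "\<dots> = (2 * K * x)\<^sup>2" by (simp add: power_mult_distrib)
    finally show "y * (?S) \<le> (2 * K * x)\<^sup>2" .
  qed (use K x0 in auto)
  have "cmod (\<Sum>m\<in>gdisc y. gmangoldt m * gchar (cx h * \<theta>) m) \<le>
    9 * U * ln y + 1296000 * real N * ln y * (Q * sqrt y + H * sqrt (y * (U * V)) + H * y / Q) +
    25000 * real N * ln y * sqrt (y * (?S))"
    using h by (intro exp_sum_bound[OF well_spaced _ _ y1 y(2) _ _ UVy]) (auto simp: H_def U_def V_def intro!: pw1)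
  also have "\<dots> \<le> 9 * x * L + 1296000 * (3 * L) * L * (3 * (K * x)) + 25000 * (3 * L) * L * (2 * K * x)"
  proof (intro add_mono mult_mono)
    have "x \<le> K * x" "K * w \<le> K * x" using K x0 wx by auto
    then show "Q * sqrt y + H * sqrt (y * (U * V)) + H * y / Q \<le> 3 * (K * x)"
      using t2 t3 t4 by linarith
    show "0 \<le> Q * sqrt y + H * sqrt (y * (U * V)) + H * y / Q"
      using Q0 H0 y1 UV by (intro add_nonneg_nonneg mult_nonneg_nonneg divide_nonneg_nonneg) auto
    show "0 \<le> sqrt (y * (?S))"
      using Q0 H0 y1 by (intro real_sqrt_ge_zero add_nonneg_nonneg mult_nonneg_nonneg divide_nonneg_nonneg) (auto simp: U_def V_def)
  qed (use t1 U0 N L root x0 K in \<open>auto simp: L_def\<close>)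
  \<comment> \<open>1296000 * 9 + 25000 * 6 = 11814000; rounding up to 12000000 leaves room for the
    trivial term.\<close>
  also have "\<dots> = 9 * (L * x) + 11814000 * (K * L\<^sup>2 * x)" by (simp add: power2_eq_square)
  also have "\<dots> \<le> 12000000 * (K * L\<^sup>2 * x)"
  proof -
    have "1 * L \<le> (K * L) * L" using K L mult_mono[of 1 K 1 L] by (intro mult_right_mono) auto
    then have "L * x \<le> (K * L\<^sup>2) * x" using x0 by (intro mult_right_mono) (auto simp: power2_eq_square)
    moreover have "0 \<le> L * x" using L x0 by simp
    ultimately show ?thesis by linarith
  qed
  finally show ?thesis by (simp add: L_def x_def mult_ac)
qed

text \<open>Taking J near y^(1/24 - e/2) splits the saving e in two uses. The frequencies have norm
  at most a constant times y^(1/12 - e), so the main term beats y^(11/12) by y^e, which absorbs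
  logarithms and constants. Also \<delta> J >= y^(e/2), so the tail of the weight is at most y^(-k
  e).\<close>

lemma ex_prime_close_powr:
  assumes e: "0 < e" "e \<le> 1/48"
  shows "eventually (\<lambda>y. \<forall>\<theta> Q. well_spaced \<theta> Q \<longrightarrow> y powr (1/4) \<le> Q \<longrightarrow> Q \<le> y powr (5/12) \<longrightarrow> y / 100 \<le> (\<Sum>n\<in>gdisc y. gmangoldt n) \<longrightarrow>
    (\<exists>p. prime_elem p \<and> gnorm p \<le> y \<and> gdist (cx p * \<theta>) \<le> y powr (- 1/24 + e))) at_top"
proof -
  \<comment> \<open>Chosen so that k e >= 2, which makes the tail at most y^(-2) and hence
    negligible against any bound for the Chebyshev function.\<close>
  define k where "k = nat \<lceil>2 / e\<rceil>"
  have ke: "real k \<ge> 2 / e" by (simp add: k_def) linarith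
  then have k2: "real k * e \<ge> 2" using e by (simp add: field_simps)
  have k: "k \<ge> 1" using k2 by (cases k) auto
  define K where "K = 16 * (real k)\<^sup>2"
  have "(real k)\<^sup>2 \<ge> 1" using k by simp
  then have K: "K \<ge> 16" by (simp add: K_def)
  \<comment> \<open>The error constant 13000000 times 100 from the Chebyshev bound y / 100, with one
    factor \<open>K\<close> from the exponential sums and one from (k J + 1)^2.\<close>
  define C where "C = 1300000000 * K\<^sup>2"
  have "eventually (\<lambda>y. C * (ln y)\<^sup>2 < y powr e) at_top"
    using e by real_asymp
  moreover have "eventually (\<lambda>y::real. y \<ge> exp 1) at_top" by (rule eventually_ge_at_top)
  ultimately show ?thesis
  proof eventually_elim
    case (elim y)
    define L where "L = ln y"
    define a where "a = 1/24 - e/2"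
    define J where "J = nat \<lceil>y powr a\<rceil>"
    define \<delta> where "\<delta> = y powr (- 1/24 + e)"
    define N where "N = dyadic y + 1"
    define x where "x = y powr (11/12)"
    have "exp 1 \<ge> (1 :: real)" by simp
    then have y1: "y \<ge> 1" using elim by linarith
    have L: "L \<ge> 1" using elim y1 by (simp add: L_def ln_ge_iff)
    have yN: "y < 2 ^ N" using dyadic_bounds(2)[OF y1] by (simp add: N_def)
    have N: "real N \<le> 3 * ln y"
    proof -
      have "ln 2 \<ge> (1 / 2 :: real)" using ln2_ge_two_thirds by linarith
      then have "L / ln 2 \<le> L / (1 / 2)" using L by (intro divide_left_mono) auto
      moreover have "real (dyadic y) \<le> L / ln 2"
        using y1 by (simp add: dyadic_def log_def L_def)
      ultimately show ?thesis using L by (simp add: N_def L_def)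
    qed
    have x1: "x \<ge> 1" unfolding x_def using y1 by (intro ge_one_powr_ge_zero) auto
    have ya: "y powr a \<ge> 1" using y1 e by (intro ge_one_powr_ge_zero) (auto simp: a_def)
    have J: "y powr a \<le> real J" "real J \<le> 2 * y powr a"
      using ya by (auto simp: J_def) linarith
    have J1: "J \<ge> 1" using J(1) ya by linarith
    have kJ: "(real (k * J + 1))\<^sup>2 \<le> K * y powr (1/12 - e)" "2 * (real (k * J))\<^sup>2 \<le> K * y powr (1/12 - e)"
    proof -
      have ya2: "(y powr a)\<^sup>2 = y powr (1/12 - e)"
        by (simp add: a_def power2_eq_square flip: powr_add)
      have "1 * 1 \<le> k * J" using k J1 by (intro mult_mono) auto
      then have "real (k * J + 1) \<le> 2 * real (k * J)" by linarith
      moreover have kJ': "real (k * J) \<le> real k * (2 * y powr a)" using J by (simp add: mult_left_mono)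
      ultimately have "real (k * J + 1) \<le> 4 * (real k * y powr a)" by linarith
      then have "(real (k * J + 1))\<^sup>2 \<le> (4 * (real k * y powr a))\<^sup>2" by (intro power_mono) auto
      then show "(real (k * J + 1))\<^sup>2 \<le> K * y powr (1/12 - e)" by (simp add: power_mult_distrib ya2 K_def)
      have "(real (k * J))\<^sup>2 \<le> (real k * (2 * y powr a))\<^sup>2" using kJ' by (intro power_mono) auto
      then have "2 * (real (k * J))\<^sup>2 \<le> 8 * ((real k)\<^sup>2 * y powr (1/12 - e))" by (simp add: power_mult_distrib ya2 mult_ac)
      also have "\<dots> \<le> K * y powr (1/12 - e)" by (simp add: K_def)
      finally show "2 * (real (k * J))\<^sup>2 \<le> K * y powr (1/12 - e)" .
    qed
    show ?case
    proof (intro allI impI)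
      fix \<theta> Q assume *: "well_spaced \<theta> Q" "y powr (1/4) \<le> Q" "Q \<le> y powr (5/12)" "y / 100 \<le> (\<Sum>n\<in>gdisc y. gmangoldt n)"
      let ?\<psi> = "\<Sum>n\<in>gdisc y. gmangoldt n"
      show "\<exists>p. prime_elem p \<and> gnorm p \<le> y \<and> gdist (cx p * \<theta>) \<le> y powr (- 1/24 + e)"
        unfolding \<delta>_def[symmetric]
      proof (rule ex_prime_close[OF k J1 y1 yN])
        show "\<delta> > 0" using y1 by (simp add: \<delta>_def)
        show "cmod (\<Sum>n\<in>gdisc y. gmangoldt n * gchar (cx h * \<theta>) n) \<le> 12000000 * K * L\<^sup>2 * x"
          if "h \<noteq> 0" "gnorm h \<le> 2 * (real (k * J))\<^sup>2" for h
          unfolding L_def x_def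
        proof (rule exp_sum_bound_powr[OF *(1-3) elim(2) yN N _ that(1)])
          have "y powr (1/12 - e) \<le> y powr (1/12)" using y1 e by (intro powr_mono) auto
          then have "K * y powr (1/12 - e) \<le> K * y powr (1/12)" using K by (intro mult_left_mono) auto
          then show "gnorm h \<le> K * y powr (1/12)" using that kJ(2) by linarith
        qed (use K in auto)
        have "12000000 * K * L\<^sup>2 * x + 81 * sqrt y * real N * ln y + (1 / (\<delta> * real J)) ^ (2 * k) * ?\<psi>
          \<le> 12000000 * (K * L\<^sup>2 * x) + 243 * (L\<^sup>2 * x) + 9 * (L\<^sup>2 * x)"
        proof (intro add_mono)
          have "sqrt y = y powr (1/2)" using y1 by (simp add: powr_half_sqrt)
          also have "\<dots> \<le> x" unfolding x_def using y1 by (intro powr_mono) auto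
          finally have "81 * sqrt y * real N * ln y \<le> 81 * x * (3 * L) * L"
            using N L x1 y1 by (intro mult_mono) (auto simp: L_def)
          then show "81 * sqrt y * real N * ln y \<le> 243 * (L\<^sup>2 * x)" by (simp add: power2_eq_square mult_ac)
          have "y powr (e/2) = \<delta> * y powr a" by (simp add: \<delta>_def a_def flip: powr_add)
          also have "\<dots> \<le> \<delta> * real J" using J by (intro mult_left_mono) (auto simp: \<delta>_def)
          finally have "1 / (\<delta> * real J) \<le> 1 / y powr (e/2)"
            using y1 J1 by (intro divide_left_mono) (auto simp: \<delta>_def)
          then have "(1 / (\<delta> * real J)) ^ (2 * k) \<le> (1 / y powr (e/2)) ^ (2 * k)"
            by (intro power_mono) (auto simp: \<delta>_def)
          also have "(1 / y powr (e/2)) ^ (2 * k) = 1 / y powr (real k * e)"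
            using y1 by (simp add: power_divide powr_powr mult_ac flip: powr_realpow)
          also have "\<dots> \<le> 1 / y powr 2" using y1 k2 by (intro divide_left_mono powr_mono) auto
          also have "y powr 2 = y\<^sup>2" using y1 by simp
          finally have "(1 / (\<delta> * real J)) ^ (2 * k) * ?\<psi> \<le> (1 / y\<^sup>2) * (9 * y * L)"
            using sum_gmangoldt_le[OF y1] by (intro mult_mono) (auto simp: L_def intro!: sum_nonneg gmangoldt_nonneg)
          also have "\<dots> = (9 * L) * (1 / y)" using y1 by (simp add: power2_eq_square)
          also have "\<dots> \<le> (9 * L) * 1" using L y1 by (intro mult_left_mono) auto
          also have "\<dots> \<le> 9 * (L\<^sup>2 * x)"
          proof -
            have "L * (1 * 1) \<le> L * (L * x)" using L x1 by (intro mult_left_mono mult_mono) auto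
            then show ?thesis by (simp add: power2_eq_square mult_ac)
          qed
          finally show "(1 / (\<delta> * real J)) ^ (2 * k) * ?\<psi> \<le> 9 * (L\<^sup>2 * x)" .
        qed simp
        also have "\<dots> \<le> 13000000 * (K * L\<^sup>2 * x)"
        proof -
          have "1 * (L\<^sup>2 * x) \<le> K * (L\<^sup>2 * x)" using K x1 by (intro mult_right_mono) auto
          moreover have "0 \<le> L\<^sup>2 * x" using x1 by simp
          ultimately show ?thesis unfolding mult.assoc mult_1 by linarith
        qed
        also have "\<dots> = (x / (100 * K)) * (C * L\<^sup>2)" using K by (simp add: C_def power2_eq_square)
        also have "\<dots> < (x / (100 * K)) * y powr e"
          using elim(1) K x1 by (intro mult_strict_left_mono) (auto simp: L_def)
        also have "\<dots> = (y / 100) / (K * y powr (1/12 - e))"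
        proof -
          have "x * y powr e * y powr (1/12 - e) = y"
            using y1 by (simp add: x_def flip: powr_add)
          then show ?thesis using K y1 by (simp add: field_simps)
        qed
        also have "\<dots> \<le> ?\<psi> / (real (k * J + 1))\<^sup>2"
        proof (rule frac_le)
          show "0 < (real (k * J + 1))\<^sup>2" by (rule zero_less_power) linarith
        qed (use *(4) kJ(1) y1 in \<open>auto intro!: sum_nonneg gmangoldt_nonneg\<close>)
        finally show "12000000 * K * L\<^sup>2 * x + 81 * sqrt y * real N * ln y + (1 / (\<delta> * real J)) ^ (2 * k) * ?\<psi> < ?\<psi> / (real (k * J + 1))\<^sup>2" .
      qed
    qed
  qed
qed

lemma ex_prime_close_ge:
  assumes \<theta>: "\<theta> \<notin> gauss_rats" and e: "0 < e" "e \<le> 1/48"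
  shows "\<exists>y p. y \<ge> B \<and> prime_elem p \<and> gnorm p \<le> y \<and> gdist (cx p * \<theta>) \<le> y powr (- 1/24 + e)"
proof -
  obtain B1 where B1: "\<And>y \<theta> Q. y \<ge> B1 \<Longrightarrow> well_spaced \<theta> Q \<Longrightarrow> y powr (1/4) \<le> Q \<Longrightarrow> Q \<le> y powr (5/12) \<Longrightarrow> y / 100 \<le> (\<Sum>n\<in>gdisc y. gmangoldt n) \<Longrightarrow>
    \<exists>p. prime_elem p \<and> gnorm p \<le> y \<and> gdist (cx p * \<theta>) \<le> y powr (- 1/24 + e)"
    using ex_prime_close_powr[OF e] unfolding eventually_at_top_linorder by blast
  obtain B2 where B2: "\<And>Y. Y \<ge> B2 \<Longrightarrow> \<exists>y. Y powr (3 / 5) \<le> y \<and> y \<le> Y \<and> y / 100 \<le> (\<Sum>n\<in>gdisc y. gmangoldt n)"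
    using sum_gmangoldt_large unfolding eventually_at_top_linorder by blast
  define B3 where "B3 = Max {B, B1, B2, 1}"
  have B3: "B3 \<ge> B" "B3 \<ge> B1" "B3 \<ge> B2" "B3 \<ge> 1" by (auto simp: B3_def)
  obtain Q where Q: "Q \<ge> B3" "well_spaced \<theta> Q" using ex_well_spaced_ge[OF \<theta>] by blast
  have Q1: "Q \<ge> 1" using Q B3 by linarith
  \<comment> \<open>For this \<open>Y\<close>, the condition y <= Y reads y^(1/4) <= Q, and y >=
    Y^(3/5) = Q^(12/5) reads Q <= y^(5/12). Moreover y >= Q, so a large \<open>Q\<close> passes all
    thresholds.\<close>
  define Y where "Y = Q powr 4"
  have "Q powr 1 \<le> Y" unfolding Y_def using Q1 by (intro powr_mono) auto
  then have "Y \<ge> B2" using Q B3 Q1 by simp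
  then obtain y where y: "Y powr (3 / 5) \<le> y" "y \<le> Y" "y / 100 \<le> (\<Sum>n\<in>gdisc y. gmangoldt n)" using B2 by blast
  have Yp: "Y powr (3 / 5) = Q powr (12 / 5)" by (simp add: Y_def powr_powr)
  have "Q powr 1 \<le> Q powr (12 / 5)" using Q1 by (intro powr_mono) auto
  then have yQ: "y \<ge> Q" using y(1) Yp Q1 by simp
  have "y powr (1/4) \<le> Y powr (1/4)" using y yQ Q1 by (intro powr_mono2) auto
  then have 1: "y powr (1/4) \<le> Q" using Q1 powr_powr[of Q 4 "1/4"] by (simp add: Y_def del: powr_numeral)
  have "(Q powr (12 / 5)) powr (5/12) \<le> y powr (5/12)" using y(1) Yp by (intro powr_mono2) auto
  then have 2: "Q \<le> y powr (5/12)" using Q1 by (simp add: powr_powr)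
  have "y \<ge> B1" "y \<ge> B" using yQ Q B3 by linarith+
  then show ?thesis using B1[OF _ Q(2) 1 2 y(3)] by blast
qed

text \<open>As \<theta> is not in Q(i), every distance \<open>gdist (cx p * \<theta>)\<close> is
  positive, so finitely many primes would keep it above some \<eta>, while the distances found tend
  to 0 with growing y. Since the exponent is negative, the bound in y implies the bound in the norm
  of \<open>p\<close>, which is at most y.\<close>

lemma infinite_prime_close:
  assumes \<theta>: "\<theta> \<notin> gauss_rats" and e: "0 < e" "e \<le> 1/48"
  shows "infinite {p :: gauss_int. prime_elem p \<and> gdist (cx p * \<theta>) \<le> gnorm p powr (- 1/24 + e)}"
    (is "infinite ?S")
proof
  assume fin: "finite ?S"
  define \<eta> where "\<eta> = Min (insert 1 ((\<lambda>p. gdist (cx p * \<theta>)) ` ?S))"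
  have pos: "gdist (cx p * \<theta>) > 0" if "p \<in> ?S" for p
  proof -
    have "p \<noteq> 0" using that by auto
    then have "0 < sqrt 2 * gdist (cx p * \<theta>)"
      using approx_error_pos[OF \<theta>, of p] approx_error_le_dist[of \<theta> p] by linarith
    then show ?thesis by (simp add: zero_less_mult_iff)
  qed
  then have \<eta>: "\<eta> > 0" unfolding \<eta>_def using fin by (subst Min_gr_iff) auto
  have "((\<lambda>y. y powr (- 1/24 + e)) \<longlongrightarrow> 0) at_top"
    using e by (intro tendsto_neg_powr filterlim_ident) auto
  then have "eventually (\<lambda>y. y powr (- 1/24 + e) < \<eta>) at_top" using \<eta> by (rule order_tendstoD(2))
  then obtain B where B: "\<And>y. y \<ge> B \<Longrightarrow> y powr (- 1/24 + e) < \<eta>"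
    unfolding eventually_at_top_linorder by blast
  obtain y p where yp: "y \<ge> max B 1" "prime_elem p" "gnorm p \<le> y"
      "gdist (cx p * \<theta>) \<le> y powr (- 1/24 + e)"
    using ex_prime_close_ge[OF \<theta> e, of "max B 1"] by blast
  have "p \<noteq> 0" using yp by auto
  then have "y powr (- 1/24 + e) \<le> gnorm p powr (- 1/24 + e)"
    using yp gnorm_pos e by (intro powr_mono2') auto
  then have "p \<in> ?S" using yp by auto
  then have "\<eta> \<le> gdist (cx p * \<theta>)" unfolding \<eta>_def using fin by (intro Min_le) auto
  then show False using B[of y] yp by simp
qed

theorem corollary10p2:
  fixes \<theta> :: complex and \<epsilon> :: real
  assumes "\<theta> \<notin> gauss_rats" and "\<epsilon> > 0"
  shows "infinite {p :: gauss_int. prime_elem p \<and>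
           dist_nearest_gauss_int (complex_of_gauss_int p * \<theta>)
             \<le> gauss_norm p powr (- 1 / 24 + \<epsilon>)}"
proof (rule infinite_super)
  \<comment> \<open>Norms of nonzero elements are at least 1, so a smaller exponent gives a stronger
    inequality; the cap 1/48 keeps -1/24 + e negative.\<close>
  define e where "e = min \<epsilon> (1/48)"
  show "infinite {p :: gauss_int. prime_elem p \<and> dist_nearest_gauss_int (cx p * \<theta>) \<le> gauss_norm p powr (- 1/24 + e)}"
    using assms by (intro infinite_prime_close) (auto simp: e_def)
  show "{p :: gauss_int. prime_elem p \<and> dist_nearest_gauss_int (cx p * \<theta>) \<le> gauss_norm p powr (- 1/24 + e)} \<subseteq>
    {p :: gauss_int. prime_elem p \<and> dist_nearest_gauss_int (complex_of_gauss_int p * \<theta>) \<le> gauss_norm p powr (- 1 / 24 + \<epsilon>)}"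
  proof clarify
    fix p :: gauss_int assume p: "prime_elem p" "dist_nearest_gauss_int (cx p * \<theta>) \<le> gauss_norm p powr (- 1/24 + e)"
    then have "p \<noteq> 0" by auto
    then have "gauss_norm p powr (- 1/24 + e) \<le> gauss_norm p powr (- 1 / 24 + \<epsilon>)"
      using gnorm_ge_1 by (intro powr_mono) (auto simp: e_def)
    then show "dist_nearest_gauss_int (complex_of_gauss_int p * \<theta>) \<le> gauss_norm p powr (- 1 / 24 + \<epsilon>)"
      using p(2) by linarith
  qed
qed

end
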